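(* Consider the rescaled equation $$\partial_Tu+6u\,\partial_Xu+\varepsilon^2\partial_X^3u+\delta(\varepsilon\,\partial_X^2u+\varepsilon^3\partial_X^4u)=0\qquad(\ast)$$ with $\delta>0$ fixed, and a formal solution $u(X,T)=\sum_{j\ge0}\varepsilon^ju_j\big(\tfrac{\varphi(X,T)}{\varepsilon};X,T\big)$, $\varphi=\sum_{j\ge0}\varepsilon^j\varphi_j(X,T)$, with all $u_j(y;X,T)$, $\varphi_j(X,T)$ smooth and $u_j$ $1$-periodic in $y$. Set $k_0=\partial_X\varphi_0$ and $M_0=\langle u_0\rangle$, and suppose that $u_0(y;X,T)=U(y;k_0(X,T),M_0(X,T))$ and $\partial_T\varphi_0=-k_0\,c(k_0,M_0)$, where $(U,c)$ is the family of periodic travelling waves described in the context (so that $(\ast)$ holds at order $\varepsilon^{-1}$). If $(\ast)$ holds at order $\varepsilon^0$, then $(k_0,M_0)$ satisfies Whitham's system $$\partial_Tk_0+\partial_X\big(k_0\,c(k_0,M_0)\big)=0,\qquad \partial_TM_0+\partial_X\big(\bar q^{(0)}(k_0)+3M_0^2\big)=0,$$ where $\bar q^{(0)}(k)=3\langle (U(\cdot\,;k,M)-M)^2\rangle$ (independent of $M$), so that $\bar q^{(0)}(k_0)+3M_0^2=\langle 3U(\cdot\,;k_0,M_0)^2\rangle$. Conversely, if $k_0=\partial_X\varphi_0$ and $M_0$ are smooth, $\partial_T\varphi_0=-k_0c(k_0,M_0)$, $u_0=U(\cdot\,;k_0,M_0)$ and this system holds, then for every $\varphi_1$ the order-$\varepsilon^0$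 equation has a solution $u_1$ that is $1$-periodic in $y$.
   Context: $\langle f\rangle=\int_0^1 f(y)\,dy$ for $1$-periodic $f$. Formal solution: one substitutes $u=\sum_j\varepsilon^ju_j(y;X,T)$, replaces $\partial_X$ by $\partial_X+\varepsilon^{-1}(\partial_X\varphi)\partial_y$ and $\partial_T$ by $\partial_T+\varepsilon^{-1}(\partial_T\varphi)\partial_y$, and requires the resulting formal Laurent series in $\varepsilon$ to vanish for all $(y,X,T)$; "holds at order $\varepsilon^n$" means the coefficient of $\varepsilon^n$ vanishes. Travelling wave family: for $(k,M)$ in an open set with $k>0$, $U(\cdot\,;k,M)$ is a smooth non-constant $1$-periodic function and $c(k,M)\in\mathbb{R}$, both depending smoothly on $(k,M)$, with $\langle U\rangle=M$ and $$-kcU'+6kUU'+k^3U'''+\delta(k^2U''+k^4U'''')=0,$$ normalized so that $U(\cdot\,;k,M)=M+U^{(0)}(\cdot\,;k)$ and $c(k,M)=6M+c^{(0)}(k)$. Standing assumption: the operator on $1$-periodic functions $$\mathcal{L}_{k,M}f=k\big((6U-c)f\big)'+k^3f'''+\delta(k^2f''+k^4f'''')$$ has one-dimensional kernel spanned by $U'$; it is Fredholm of index $0$ and the kernel of its adjoint is spanned by the constant function $1$. *)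

theory Defs
  imports
    "HOL-Analysis.Analysis"
    "HOL-Computational_Algebra.Formal_Laurent_Series"
    "HOL-Library.Function_Algebras"
begin

section \<open>Smooth and periodic functions\<close>

fun differentiable_up_to ::
  "'a::real_normed_vector set \<Rightarrow> ('a \<Rightarrow> 'b::real_normed_vector) \<Rightarrow> nat \<Rightarrow> bool" where
  "differentiable_up_to S f 0 \<longleftrightarrow> continuous_on S f"
| "differentiable_up_to S f (Suc n) \<longleftrightarrow>
     (\<forall>x\<in>S. f differentiable (at x)) \<and>
     (\<forall>v. differentiable_up_to S (\<lambda>x. frechet_derivative f (at x) v) n)"

text \<open>The derivatives are taken in the ambient space, so this is the \<open>C\<^sup>\<infinity>\<close> notion for open \<open>S\<close>
  in a finite-dimensional space. It is only used there.\<close>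

definition smooth_on ::
  "'a::real_normed_vector set \<Rightarrow> ('a \<Rightarrow> 'b::real_normed_vector) \<Rightarrow> bool" where
  "smooth_on S f \<longleftrightarrow> (\<forall>n. differentiable_up_to S f n)"

definition mean :: "(real \<Rightarrow> real) \<Rightarrow> real" where
  "mean f = integral {0..1} f"

definition smooth_periodic :: "(real \<Rightarrow> real) set" where
  "smooth_periodic = {f. smooth_on UNIV f \<and> (\<forall>y. f (y + 1) = f y)}"


section \<open>Linear operators on spaces of real functions\<close>

definition fscale :: "real \<Rightarrow> (real \<Rightarrow> real) \<Rightarrow> real \<Rightarrow> real" where
  "fscale a f = (\<lambda>y. a * f y)"

interpretation fun_vs: vector_space fscale
  by unfold_locales (auto simp: fscale_def fun_eq_iff algebra_simps)

definition kernel_on :: "(real \<Rightarrow> real) set \<Rightarrow> ((real \<Rightarrow> real) \<Rightarrow> real \<Rightarrow> real) \<Rightarrow> (real \<Rightarrow> real) set" where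
  "kernel_on V A = {f \<in> V. A f = 0}"

text \<open>The index is \<open>dim (ker A) - codim (A ` V)\<close>; \<open>B\<close> is a basis of the kernel, and \<open>C\<close> one of a
  complement of the range. On the Frechet space of smooth periodic functions, the range of a
  continuous operator is closed as soon as its codimension is finite, so closedness is not
  a separate requirement.\<close>

definition fredholm_of_index ::
  "(real \<Rightarrow> real) set \<Rightarrow> ((real \<Rightarrow> real) \<Rightarrow> real \<Rightarrow> real) \<Rightarrow> int \<Rightarrow> bool" where
  "fredholm_of_index V A n \<longleftrightarrow>
     A ` V \<subseteq> V \<and>
     (\<exists>B C. finite B \<and> fun_vs.independent B \<and> fun_vs.span B = kernel_on V A \<and>
            finite C \<and> fun_vs.independent C \<and> C \<subseteq> V \<and>
            fun_vs.span C \<inter> A ` V = {0} \<and>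
            V = {g + h |g h. g \<in> A ` V \<and> h \<in> fun_vs.span C} \<and>
            n = int (card B) - int (card C))"

text \<open>\<open>adjoint_rel V A g h\<close> says that \<open>g\<close> is in the domain of the adjoint of \<open>A\<close> with respect to
  the \<open>L\<^sup>2\<close> pairing over one period, and that the adjoint maps \<open>g\<close> to \<open>h\<close>.\<close>

definition adjoint_rel ::
  "(real \<Rightarrow> real) set \<Rightarrow> ((real \<Rightarrow> real) \<Rightarrow> real \<Rightarrow> real) \<Rightarrow> (real \<Rightarrow> real) \<Rightarrow> (real \<Rightarrow> real) \<Rightarrow> bool" where
  "adjoint_rel V A g h \<longleftrightarrow> g \<in> V \<and> h \<in> V \<and> (\<forall>f\<in>V. mean (A f * g) = mean (f * h))"

definition adjoint_kernel_on ::
  "(real \<Rightarrow> real) set \<Rightarrow> ((real \<Rightarrow> real) \<Rightarrow> real \<Rightarrow> real) \<Rightarrow> (real \<Rightarrow> real) set" where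
  "adjoint_kernel_on V A = {g. adjoint_rel V A g 0}"


section \<open>The family of periodic travelling waves\<close>

definition profile_equation :: "real \<Rightarrow> real \<Rightarrow> real \<Rightarrow> (real \<Rightarrow> real) \<Rightarrow> bool" where
  "profile_equation \<delta> k cc V \<longleftrightarrow>
     (\<forall>y. - k * cc * deriv V y + 6 * k * V y * deriv V y + k ^ 3 * (deriv ^^ 3) V y
          + \<delta> * (k\<^sup>2 * (deriv ^^ 2) V y + k ^ 4 * (deriv ^^ 4) V y) = 0)"

definition linearized_op ::
  "real \<Rightarrow> real \<Rightarrow> real \<Rightarrow> (real \<Rightarrow> real) \<Rightarrow> (real \<Rightarrow> real) \<Rightarrow> real \<Rightarrow> real" where
  "linearized_op \<delta> k cc V f =
     (\<lambda>y. k * deriv (\<lambda>s. (6 * V s - cc) * f s) y + k ^ 3 * (deriv ^^ 3) f y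
          + \<delta> * (k\<^sup>2 * (deriv ^^ 2) f y + k ^ 4 * (deriv ^^ 4) f y))"

definition travelling_wave_family ::
  "real \<Rightarrow> (real \<times> real) set \<Rightarrow> (real \<Rightarrow> real \<Rightarrow> real \<Rightarrow> real) \<Rightarrow> (real \<Rightarrow> real \<Rightarrow> real) \<Rightarrow> bool" where
  "travelling_wave_family \<delta> P U c \<longleftrightarrow>
     open P \<and> (\<forall>(k, M)\<in>P. k > 0) \<and>
     smooth_on (UNIV \<times> P) (\<lambda>(y, k, M). U y k M) \<and>
     smooth_on P (\<lambda>(k, M). c k M) \<and>
     (\<forall>(k, M)\<in>P.
        (\<forall>y. U (y + 1) k M = U y k M) \<and>
        (\<exists>y y'. U y k M \<noteq> U y' k M) \<and>
        mean (\<lambda>y. U y k M) = M \<and>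
        profile_equation \<delta> k (c k M) (\<lambda>y. U y k M)) \<and>
     (\<exists>U0 c0. \<forall>(k, M)\<in>P. (\<forall>y. U y k M = M + U0 y k) \<and> c k M = 6 * M + c0 k) \<and>
     (\<forall>(k, M)\<in>P.
        let V = (\<lambda>y. U y k M); L = linearized_op \<delta> k (c k M) V in
          kernel_on smooth_periodic L = fun_vs.span {deriv V} \<and>
          fun_vs.dim (kernel_on smooth_periodic L) = 1 \<and>
          fredholm_of_index smooth_periodic L 0 \<and>
          adjoint_kernel_on smooth_periodic L = fun_vs.span {\<lambda>y. 1})"

text \<open>The value does not depend on the \<open>M\<close> that is chosen here.\<close>

definition qbar :: "(real \<times> real) set \<Rightarrow> (real \<Rightarrow> real \<Rightarrow> real \<Rightarrow> real) \<Rightarrow> real \<Rightarrow> real" where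
  "qbar P U k = (let M = (SOME M. (k, M) \<in> P) in 3 * mean (\<lambda>y. (U y k M - M)\<^sup>2))"


section \<open>Whitham's system\<close>

text \<open>Functions of the slow variables take the pair \<open>(X, T)\<close>.\<close>

definition slow_dX :: "(real \<times> real \<Rightarrow> real) \<Rightarrow> real \<times> real \<Rightarrow> real" where
  "slow_dX f = (\<lambda>(X, T). deriv (\<lambda>x. f (x, T)) X)"

definition slow_dT :: "(real \<times> real \<Rightarrow> real) \<Rightarrow> real \<times> real \<Rightarrow> real" where
  "slow_dT f = (\<lambda>(X, T). deriv (\<lambda>t. f (X, t)) T)"

definition whitham_system ::
  "(real \<times> real) set \<Rightarrow> (real \<Rightarrow> real \<Rightarrow> real \<Rightarrow> real) \<Rightarrow> (real \<Rightarrow> real \<Rightarrow> real) \<Rightarrow> (real \<times> real) set \<Rightarrow>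
   (real \<times> real \<Rightarrow> real) \<Rightarrow> (real \<times> real \<Rightarrow> real) \<Rightarrow> bool" where
  "whitham_system P U c \<Omega> k0 M0 \<longleftrightarrow>
     (\<forall>p\<in>\<Omega>. slow_dT k0 p + slow_dX (\<lambda>q. k0 q * c (k0 q) (M0 q)) p = 0 \<and>
             slow_dT M0 p + slow_dX (\<lambda>q. qbar P U (k0 q) + 3 * (M0 q)\<^sup>2) p = 0)"


section \<open>Formal solutions\<close>

text \<open>Functions of the fast phase and the slow variables take the triple \<open>(y, X, T)\<close>. With the
  pointwise ring structure on such functions, a formal series in \<open>\<epsilon>\<close> is an element of
  \<open>field fls\<close>, with \<open>\<epsilon>\<close> itself being \<^const>\<open>fls_X\<close>.\<close>

type_synonym field = "real \<times> real \<times> real \<Rightarrow> real"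

definition field_dy :: "field \<Rightarrow> field" where
  "field_dy f = (\<lambda>(y, p). deriv (\<lambda>s. f (s, p)) y)"

definition field_dX :: "field \<Rightarrow> field" where
  "field_dX f = (\<lambda>(y, p). slow_dX (\<lambda>q. f (y, q)) p)"

definition field_dT :: "field \<Rightarrow> field" where
  "field_dT f = (\<lambda>(y, p). slow_dT (\<lambda>q. f (y, q)) p)"

definition fls_map :: "('a::zero \<Rightarrow> 'b::zero) \<Rightarrow> 'a fls \<Rightarrow> 'b fls" where
  "fls_map D F = Abs_fls (\<lambda>n. D (fls_nth F n))"

lemma fls_nth_map:
  assumes "D 0 = 0"
  shows "fls_nth (fls_map D F) n = D (fls_nth F n)"
proof -
  have "\<forall>n<fls_subdegree F. D (fls_nth F n) = 0"
    using assms by simp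
  then show ?thesis
    unfolding fls_map_def by (subst nth_Abs_fls_lower_bound) auto
qed

lemma field_d_zero [simp]: "field_dy 0 = 0" "field_dX 0 = 0" "field_dT 0 = 0"
  by (auto simp: field_dy_def field_dX_def field_dT_def slow_dX_def slow_dT_def fun_eq_iff)

definition profile_series :: "(nat \<Rightarrow> field) \<Rightarrow> field fls" where
  "profile_series u = fps_to_fls (Abs_fps u)"

definition phase_series :: "(nat \<Rightarrow> real \<times> real \<Rightarrow> real) \<Rightarrow> field fls" where
  "phase_series \<phi> = fps_to_fls (Abs_fps (\<lambda>j (y, p). \<phi> j p))"

definition formal_dX :: "(nat \<Rightarrow> real \<times> real \<Rightarrow> real) \<Rightarrow> field fls \<Rightarrow> field fls" where
  "formal_dX \<phi> F =
     fls_map field_dX F + fls_X_inv * fls_map field_dX (phase_series \<phi>) * fls_map field_dy F"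

definition formal_dT :: "(nat \<Rightarrow> real \<times> real \<Rightarrow> real) \<Rightarrow> field fls \<Rightarrow> field fls" where
  "formal_dT \<phi> F =
     fls_map field_dT F + fls_X_inv * fls_map field_dT (phase_series \<phi>) * fls_map field_dy F"

definition residual ::
  "real \<Rightarrow> (nat \<Rightarrow> field) \<Rightarrow> (nat \<Rightarrow> real \<times> real \<Rightarrow> real) \<Rightarrow> field fls" where
  "residual \<delta> u \<phi> =
     (let F = profile_series u; D = formal_dX \<phi> in
        formal_dT \<phi> F + 6 * F * D F + fls_X ^ 2 * (D ^^ 3) F
        + fls_const (\<lambda>_. \<delta>) * (fls_X * (D ^^ 2) F + fls_X ^ 3 * (D ^^ 4) F))"

definition holds_at_order ::
  "real \<Rightarrow> (real \<times> real) set \<Rightarrow> (nat \<Rightarrow> field) \<Rightarrow> (nat \<Rightarrow> real \<times> real \<Rightarrow> real) \<Rightarrow> int \<Rightarrow> bool" where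
  "holds_at_order \<delta> \<Omega> u \<phi> n \<longleftrightarrow> (\<forall>y. \<forall>p\<in>\<Omega>. fls_nth (residual \<delta> u \<phi>) n (y, p) = 0)"

definition smooth_profile :: "(real \<times> real) set \<Rightarrow> field \<Rightarrow> bool" where
  "smooth_profile \<Omega> v \<longleftrightarrow> smooth_on (UNIV \<times> \<Omega>) v \<and> (\<forall>y. \<forall>p\<in>\<Omega>. v (y + 1, p) = v (y, p))"

definition formal_ansatz ::
  "(real \<times> real) set \<Rightarrow> (nat \<Rightarrow> field) \<Rightarrow> (nat \<Rightarrow> real \<times> real \<Rightarrow> real) \<Rightarrow> bool" where
  "formal_ansatz \<Omega> u \<phi> \<longleftrightarrow> (\<forall>j. smooth_profile \<Omega> (u j) \<and> smooth_on \<Omega> (\<phi> j))"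

definition modulated_wave ::
  "(real \<times> real) set \<Rightarrow> (real \<Rightarrow> real \<Rightarrow> real \<Rightarrow> real) \<Rightarrow> (real \<Rightarrow> real \<Rightarrow> real) \<Rightarrow> (real \<times> real) set \<Rightarrow>
   field \<Rightarrow> (real \<times> real \<Rightarrow> real) \<Rightarrow> (real \<times> real \<Rightarrow> real) \<Rightarrow> bool" where
  "modulated_wave P U c \<Omega> u0 \<phi>0 M0 \<longleftrightarrow>
     (\<forall>p\<in>\<Omega>. let k = slow_dX \<phi>0 p; M = M0 p in
        (k, M) \<in> P \<and> (\<forall>y. u0 (y, p) = U y k M) \<and> slow_dT \<phi>0 p = - k * c k M)"

end

(* The order-0 equation is L u1 = - R, where L is the linearization at the wave and R depends on u0 and the
   phases only. L u1 and all of R except d_T u0 + 3 d_X (u0^2) are y-derivatives of periodic functions or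
   X-derivatives of functions with zero mean, so averaging over a period gives Whitham's second equation; the
   first one is the equality of the mixed derivatives of the phase.

   Conversely the Fredholm hypotheses make f |-> L f + <U' f> a bijection of the smooth periodic functions at
   each (X, T), which solves the equation pointwise. Joint smoothness of the solution needs no theory of
   differential equations: a compactness argument gives an a-priori estimate that is locally uniform in (X, T),
   this makes the solution differentiable in (X, T), and its derivatives solve an equation with the same
   operator, which allows an induction on the order of differentiation. *)

theory Submission
  imports Defs "HOL-Complex_Analysis.Great_Picard"
begin

section \<open>Calculus of differentiable functions\<close>

text \<open>A solution u1 is determined only up to a multiple of U', so a choice made separately at
  each (X, T) need not even be continuous in (X, T). Adding the constant <U' f> to L f cures two
  defects at once: it detects the kernel, because <U'^2> > 0, and it supplies the nonzero constants,
  which the range of L misses because L f is a y-derivative. If the right-hand side has zero mean,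
  averaging the augmented equation shows that the added term vanishes, so its solution solves the
  original equation and is singled out by <U' u1> = 0. Bijectivity is known at each fixed (X, T)
  only, with no control of the inverse as (X, T) varies; compactness has to fill this gap. Division
  by the leading coefficient \<delta> k^4 pays off here: the top-order term is then the same for all
  parameters, and a change of parameters perturbs only terms of order below four.\<close>

abbreviation dderiv :: "('a::real_normed_vector \<Rightarrow> 'b::real_normed_vector) \<Rightarrow> 'a \<Rightarrow> 'a \<Rightarrow> 'b" where
  "dderiv f v \<equiv> (\<lambda>x. frechet_derivative f (at x) v)"

lemma dderiv_eqI: "(f has_derivative f') (at x) \<Longrightarrow> dderiv f v x = f' v"
  using frechet_derivative_at by metis

lemma differentiable_imp_has_derivative:
  "f differentiable (at x) \<Longrightarrow> (f has_derivative (\<lambda>v. dderiv f v x)) (at x)"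
  using frechet_derivative_works by fastforce

lemma dderiv_cong_open:
  assumes "open S" "x \<in> S" "\<And>x. x \<in> S \<Longrightarrow> f x = g x" "f differentiable (at x)"
  shows "dderiv f v x = dderiv g v x"
  using frechet_derivative_transform_within_open[OF assms(4,1,2,3)] by simp

lemma differentiable_cong_open:
  assumes "open S" "x \<in> S" "\<And>x. x \<in> S \<Longrightarrow> f x = g x" "f differentiable (at x)"
  shows "g differentiable (at x)"
  using assms has_derivative_transform_within_open unfolding differentiable_def by blast

text \<open>Differentiability up to order \<open>n\<close>, where in addition \<open>N\<close> holds for all the derivatives that occur.
  The instance that matters asks for functions whose restrictions to the lines \<open>p = const\<close> are smooth:
  the right-hand sides in the induction over the order must stay in the domain of the solution operator.\<close>

fun regular_up_to ::
  "(('a::real_normed_vector \<Rightarrow> real) \<Rightarrow> bool) \<Rightarrow> 'a set \<Rightarrow> ('a \<Rightarrow> real) \<Rightarrow> nat \<Rightarrow> bool" where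
  "regular_up_to N S f 0 \<longleftrightarrow> N f \<and> continuous_on S f"
| "regular_up_to N S f (Suc n) \<longleftrightarrow>
     N f \<and> (\<forall>x\<in>S. f differentiable (at x)) \<and> (\<forall>v. regular_up_to N S (dderiv f v) n)"

lemma regular_up_to_True: "regular_up_to (\<lambda>_. True) S f n \<longleftrightarrow> differentiable_up_to S f n"
  by (induction n arbitrary: f) auto

lemma regular_up_to_differentiable: "regular_up_to N S f n \<Longrightarrow> differentiable_up_to S f n"
  by (induction n arbitrary: f) auto

lemma regular_up_to_imp: "regular_up_to N S f n \<Longrightarrow> N f"
  by (cases n) auto

lemma regular_up_to_continuous: "regular_up_to N S f n \<Longrightarrow> continuous_on S f"
  by (cases n) (auto intro!: differentiable_imp_continuous_on differentiable_at_imp_differentiable_on)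

lemma regular_up_to_SucD: "regular_up_to N S f (Suc n) \<Longrightarrow> regular_up_to N S f n"
  by (induction n arbitrary: f) (auto dest: regular_up_to_continuous
      intro!: differentiable_imp_continuous_on differentiable_at_imp_differentiable_on)

text \<open>Leibniz' rule keeps a class of functions inside itself only if the side condition
  \<open>N\<close> is stable under sums and products. Collecting these demands proves the rules once
  for two instances: the trivial condition, which is plain differentiability, and smooth periodicity
  in y for each fixed parameter.\<close>

locale function_algebra =
  fixes S :: "'a::real_normed_vector set" and N :: "('a \<Rightarrow> real) \<Rightarrow> bool"
  assumes open_S: "open S"
    and N_const: "N (\<lambda>_. c)"
    and N_add: "N f \<Longrightarrow> N g \<Longrightarrow> N (\<lambda>x. f x + g x)"
    and N_mult: "N f \<Longrightarrow> N g \<Longrightarrow> N (\<lambda>x. f x * g x)"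
    and N_cong: "(\<And>x. x \<in> S \<Longrightarrow> f x = g x) \<Longrightarrow> N f \<Longrightarrow> N g"
begin

text \<open>Openness of \<open>S\<close> is essential: derivatives are taken in the ambient space,
  and agreement on \<open>S\<close> determines them only at interior points.\<close>

lemma regular_cong:
  assumes "\<And>x. x \<in> S \<Longrightarrow> f x = g x" "regular_up_to N S f n"
  shows "regular_up_to N S g n"
  using assms
proof (induction n arbitrary: f g)
  case 0
  then show ?case using N_cong[of f g] by (auto cong: continuous_on_cong)
next
  case (Suc n)
  have "regular_up_to N S (dderiv g v) n" for v
    using Suc.IH[of "dderiv f v" "dderiv g v"] Suc.prems dderiv_cong_open[OF open_S, of _ f g] by auto
  then show ?case
    using Suc.prems N_cong[of f g] differentiable_cong_open[OF open_S, of _ f g] by auto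
qed

lemma regular_const: "regular_up_to N S (\<lambda>_. c) n"
  by (induction n arbitrary: c) (auto simp: N_const)

lemma regular_add:
  "regular_up_to N S f n \<Longrightarrow> regular_up_to N S g n \<Longrightarrow> regular_up_to N S (\<lambda>x. f x + g x) n"
proof (induction n arbitrary: f g)
  case 0
  then show ?case by (auto intro: N_add continuous_on_add)
next
  case (Suc n)
  have eq: "dderiv (\<lambda>x. f x + g x) v x = dderiv f v x + dderiv g v x" if "x \<in> S" for v x
    using Suc.prems that
    by (intro dderiv_eqI derivative_intros differentiable_imp_has_derivative) auto
  have "regular_up_to N S (dderiv (\<lambda>x. f x + g x) v) n" for v
    using regular_cong[OF _ Suc.IH[of "dderiv f v" "dderiv g v"]] eq Suc.prems by fastforce
  then show ?case using Suc.prems by (auto intro: N_add)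
qed

lemma regular_mult:
  "regular_up_to N S f n \<Longrightarrow> regular_up_to N S g n \<Longrightarrow> regular_up_to N S (\<lambda>x. f x * g x) n"
proof (induction n arbitrary: f g)
  case 0
  then show ?case by (auto intro: N_mult continuous_on_mult)
next
  case (Suc n)
  have eq: "dderiv (\<lambda>x. f x * g x) v x = f x * dderiv g v x + dderiv f v x * g x" if "x \<in> S" for v x
    using Suc.prems that
    by (intro dderiv_eqI has_derivative_mult differentiable_imp_has_derivative) auto
  have "regular_up_to N S f n" "regular_up_to N S g n"
    using Suc.prems regular_up_to_SucD by blast+
  then have "regular_up_to N S (\<lambda>x. f x * dderiv g v x + dderiv f v x * g x) n" for v
    using Suc.prems by (intro regular_add Suc.IH) auto
  then have "regular_up_to N S (dderiv (\<lambda>x. f x * g x) v) n" for v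
    using regular_cong[of "\<lambda>x. f x * dderiv g v x + dderiv f v x * g x"] eq by fastforce
  then show ?case using Suc.prems by (auto intro: N_mult)
qed

lemma regular_minus:
  "regular_up_to N S f n \<Longrightarrow> regular_up_to N S (\<lambda>x. - f x) n"
  using regular_mult[OF regular_const[of "-1"], of f n] by simp

lemma regular_diff:
  "regular_up_to N S f n \<Longrightarrow> regular_up_to N S g n \<Longrightarrow> regular_up_to N S (\<lambda>x. f x - g x) n"
  using regular_add[OF _ regular_minus, of f n g] by simp

lemma regular_sum:
  "(\<And>i. i \<in> I \<Longrightarrow> regular_up_to N S (f i) n) \<Longrightarrow> regular_up_to N S (\<lambda>x. \<Sum>i\<in>I. f i x) n"
  by (induction I rule: infinite_finite_induct) (auto intro: regular_const regular_add)

end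

lemma function_algebra_True: "open S \<Longrightarrow> function_algebra S (\<lambda>_. True)"
  by unfold_locales auto

lemmas differentiable_up_to_SucD =
  regular_up_to_SucD[where N = "\<lambda>_. True", unfolded regular_up_to_True]
lemmas differentiable_up_to_cong =
  function_algebra.regular_cong[OF function_algebra_True, unfolded regular_up_to_True]
lemmas differentiable_up_to_const =
  function_algebra.regular_const[OF function_algebra_True, unfolded regular_up_to_True]
lemmas differentiable_up_to_add =
  function_algebra.regular_add[OF function_algebra_True, unfolded regular_up_to_True]
lemmas differentiable_up_to_mult =
  function_algebra.regular_mult[OF function_algebra_True, unfolded regular_up_to_True]
lemmas differentiable_up_to_minus =
  function_algebra.regular_minus[OF function_algebra_True, unfolded regular_up_to_True]
lemmas differentiable_up_to_diff =
  function_algebra.regular_diff[OF function_algebra_True, unfolded regular_up_to_True]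
lemmas differentiable_up_to_sum =
  function_algebra.regular_sum[OF function_algebra_True, unfolded regular_up_to_True]

lemma differentiable_up_to_bounded_linear:
  fixes l :: "'a::real_normed_vector \<Rightarrow> real"
  assumes "bounded_linear l"
  shows "differentiable_up_to S l n"
proof (cases n)
  case 0
  then show ?thesis using assms by (simp add: linear_continuous_on)
next
  case (Suc m)
  have "dderiv l v = (\<lambda>x. l v)" for v
    using bounded_linear_imp_has_derivative[OF assms] by (intro ext dderiv_eqI)
  moreover have "differentiable_up_to S (\<lambda>x. c) m" for c :: real
    by (induction m arbitrary: c) simp_all
  ultimately show ?thesis
    using Suc assms by (simp add: bounded_linear_imp_differentiable)
qed

text \<open>The derivative of 1/f is a polynomial in 1/f and the derivative of f, so regularity of
  1/f of order n gives order n + 1.\<close>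

lemma differentiable_up_to_inverse:
  fixes f :: "'a::real_normed_vector \<Rightarrow> real"
  assumes "open S" "\<And>x. x \<in> S \<Longrightarrow> f x \<noteq> 0" "differentiable_up_to S f n"
  shows "differentiable_up_to S (\<lambda>x. inverse (f x)) n"
  using assms(3)
proof (induction n)
  case 0
  then show ?case using assms by (auto intro: continuous_on_inverse)
next
  case (Suc n)
  have hd: "((\<lambda>x. inverse (f x)) has_derivative
      (\<lambda>v. - (inverse (f x) * dderiv f v x * inverse (f x)))) (at x)" if "x \<in> S" for x
    using Suc.prems that assms(2)
    by (intro Deriv.has_derivative_inverse differentiable_imp_has_derivative) auto
  have IH: "differentiable_up_to S (\<lambda>x. inverse (f x)) n"
    by (rule Suc.IH[OF differentiable_up_to_SucD[OF Suc.prems]])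
  have step: "differentiable_up_to S (\<lambda>x. - (inverse (f x) * dderiv f v x * inverse (f x))) n" for v
    using Suc.prems IH by (intro differentiable_up_to_minus differentiable_up_to_mult assms(1)) auto
  have "differentiable_up_to S (dderiv (\<lambda>x. inverse (f x)) v) n" for v
    by (rule differentiable_up_to_cong[OF assms(1) dderiv_eqI[OF hd, symmetric] step])
  then show ?case using hd by (auto simp: differentiable_def)
qed

text \<open>The chain rule is expanded over the basis, since the product rule is available for
  real-valued factors. The induction has to range over all \<open>f\<close>: the partial derivatives
  of \<open>f\<close>, again composed with \<open>G\<close>, take its place.\<close>

lemma differentiable_up_to_compose:
  fixes f :: "'b::euclidean_space \<Rightarrow> real" and G :: "'a::real_normed_vector \<Rightarrow> 'b"
  assumes "open S" "G ` S \<subseteq> T"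
    "differentiable_up_to T f n" "\<And>b. b \<in> Basis \<Longrightarrow> differentiable_up_to S (\<lambda>x. G x \<bullet> b) n"
  shows "differentiable_up_to S (\<lambda>x. f (G x)) n"
  using assms(3,4)
proof (induction n arbitrary: f)
  case 0
  then have "continuous_on S G" by (auto intro: continuous_on_componentwise[THEN iffD2])
  then show ?case using 0 assms(2) by (auto intro: continuous_on_compose2)
next
  case (Suc n)
  have hd: "((\<lambda>x. f (G x)) has_derivative
      (\<lambda>v. \<Sum>b\<in>Basis. dderiv (\<lambda>x. G x \<bullet> b) v x * dderiv f b (G x))) (at x)" if "x \<in> S" for x
  proof -
    have "G differentiable (at x)"
      using Suc.prems(2) that by (subst differentiable_componentwise_within) auto
    then have G: "(G has_derivative (\<lambda>v. dderiv G v x)) (at x)"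
      by (rule differentiable_imp_has_derivative)
    have comp: "dderiv (\<lambda>x. G x \<bullet> b) v x = dderiv G v x \<bullet> b" for b v
      by (rule dderiv_eqI) (intro has_derivative_inner_left G)
    have f: "(f has_derivative (\<lambda>v. dderiv f v (G x))) (at (G x))"
      using Suc.prems(1) that assms(2) by (intro differentiable_imp_has_derivative) auto
    have "dderiv f (dderiv G v x) (G x)
        = (\<Sum>b\<in>Basis. dderiv (\<lambda>x. G x \<bullet> b) v x * dderiv f b (G x))" for v
    proof -
      interpret bounded_linear "\<lambda>v. dderiv f v (G x)" using f by (rule has_derivative_bounded_linear)
      have "dderiv f (dderiv G v x) (G x)
          = dderiv f (\<Sum>b\<in>Basis. (dderiv G v x \<bullet> b) *\<^sub>R b) (G x)"
        by (simp add: euclidean_representation)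
      also have "\<dots> = (\<Sum>b\<in>Basis. (dderiv G v x \<bullet> b) *\<^sub>R dderiv f b (G x))"
        by (simp only: sum scaleR)
      finally show ?thesis by (simp add: comp)
    qed
    then show ?thesis using has_derivative_compose[OF G f] by simp
  qed
  have step: "differentiable_up_to S (\<lambda>x. \<Sum>b\<in>Basis. dderiv (\<lambda>x. G x \<bullet> b) v x * dderiv f b (G x)) n" for v
    using Suc.prems
    by (intro differentiable_up_to_sum differentiable_up_to_mult assms(1)
        Suc.IH[OF _ differentiable_up_to_SucD[OF Suc.prems(2)]]) auto
  have "differentiable_up_to S (dderiv (\<lambda>x. f (G x)) v) n" for v
    by (rule differentiable_up_to_cong[OF assms(1) dderiv_eqI[OF hd, symmetric] step])
  then show ?case using hd by (auto simp: differentiable_def)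
qed

section \<open>Closure properties of smooth functions\<close>

lemma smooth_on_differentiable: "smooth_on S f \<Longrightarrow> x \<in> S \<Longrightarrow> f differentiable (at x)"
  unfolding smooth_on_def by (metis differentiable_up_to.simps(2))

lemma smooth_on_dderiv: "smooth_on S f \<Longrightarrow> smooth_on S (dderiv f v)"
  unfolding smooth_on_def by (metis differentiable_up_to.simps(2))

lemma smooth_on_continuous: "smooth_on S f \<Longrightarrow> continuous_on S f"
  unfolding smooth_on_def by (metis differentiable_up_to.simps(1))

lemma smooth_on_cong:
  fixes f :: "'a::real_normed_vector \<Rightarrow> real"
  shows "open S \<Longrightarrow> (\<And>x. x \<in> S \<Longrightarrow> f x = g x) \<Longrightarrow> smooth_on S f \<Longrightarrow> smooth_on S g"
  unfolding smooth_on_def using differentiable_up_to_cong by blast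

lemma smooth_on_const: "open S \<Longrightarrow> smooth_on S (\<lambda>_. c::real)"
  by (simp add: smooth_on_def differentiable_up_to_const)

lemma smooth_on_add:
  fixes f :: "'a::real_normed_vector \<Rightarrow> real"
  shows "open S \<Longrightarrow> smooth_on S f \<Longrightarrow> smooth_on S g \<Longrightarrow> smooth_on S (\<lambda>x. f x + g x)"
  by (simp add: smooth_on_def differentiable_up_to_add)

lemma smooth_on_mult:
  fixes f :: "'a::real_normed_vector \<Rightarrow> real"
  shows "open S \<Longrightarrow> smooth_on S f \<Longrightarrow> smooth_on S g \<Longrightarrow> smooth_on S (\<lambda>x. f x * g x)"
  by (simp add: smooth_on_def differentiable_up_to_mult)

lemma smooth_on_diff:
  fixes f :: "'a::real_normed_vector \<Rightarrow> real"
  shows "open S \<Longrightarrow> smooth_on S f \<Longrightarrow> smooth_on S g \<Longrightarrow> smooth_on S (\<lambda>x. f x - g x)"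
  by (simp add: smooth_on_def differentiable_up_to_diff)

lemma smooth_on_power:
  fixes f :: "'a::real_normed_vector \<Rightarrow> real"
  shows "open S \<Longrightarrow> smooth_on S f \<Longrightarrow> smooth_on S (\<lambda>x. f x ^ n)"
  by (induction n) (auto intro: smooth_on_const smooth_on_mult)

lemma smooth_on_inverse:
  fixes f :: "'a::real_normed_vector \<Rightarrow> real"
  shows "open S \<Longrightarrow> (\<And>x. x \<in> S \<Longrightarrow> f x \<noteq> 0) \<Longrightarrow> smooth_on S f \<Longrightarrow> smooth_on S (\<lambda>x. inverse (f x))"
  by (simp add: smooth_on_def differentiable_up_to_inverse)

lemma smooth_on_divide:
  fixes f :: "'a::real_normed_vector \<Rightarrow> real"
  shows "open S \<Longrightarrow> smooth_on S f \<Longrightarrow> (\<And>x. x \<in> S \<Longrightarrow> g x \<noteq> 0) \<Longrightarrow> smooth_on S g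
    \<Longrightarrow> smooth_on S (\<lambda>x. f x / g x)"
  by (simp add: divide_inverse smooth_on_mult smooth_on_inverse)

lemma smooth_on_compose:
  fixes f :: "'b::euclidean_space \<Rightarrow> real" and G :: "'a::real_normed_vector \<Rightarrow> 'b"
  assumes "open S" "G ` S \<subseteq> T" "smooth_on T f" "\<And>b. b \<in> Basis \<Longrightarrow> smooth_on S (\<lambda>x. G x \<bullet> b)"
  shows "smooth_on S (\<lambda>x. f (G x))"
  using assms unfolding smooth_on_def by (blast intro: differentiable_up_to_compose)

lemma smooth_on_bounded_linear:
  fixes l :: "'a::real_normed_vector \<Rightarrow> real"
  shows "bounded_linear l \<Longrightarrow> smooth_on S l"
  by (simp add: smooth_on_def differentiable_up_to_bounded_linear)

lemma smooth_on_compose_snd: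
  fixes f :: "'p::euclidean_space \<Rightarrow> real"
  assumes "open \<Omega>" "smooth_on \<Omega> f"
  shows "smooth_on ((UNIV::'y::real_normed_vector set) \<times> \<Omega>) (\<lambda>x. f (snd x))"
proof (rule smooth_on_compose[OF _ _ assms(2)])
  show "smooth_on (UNIV \<times> \<Omega>) (\<lambda>x. snd x \<bullet> b)" for b :: 'p
    by (intro smooth_on_bounded_linear bounded_linear_intros)
qed (use assms in \<open>auto intro: open_Times\<close>)

lemma smooth_on_slice:
  fixes f :: "real \<times> 'p::euclidean_space \<Rightarrow> real"
  assumes "smooth_on (UNIV \<times> \<Omega>) f" "p \<in> \<Omega>"
  shows "smooth_on UNIV (\<lambda>y. f (y, p))"
proof (rule smooth_on_compose[OF _ _ assms(1)])
  fix b :: "real \<times> 'p" assume "b \<in> Basis"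
  have "smooth_on UNIV (\<lambda>x. x * fst b + p \<bullet> snd b)"
    by (intro smooth_on_add smooth_on_const smooth_on_bounded_linear bounded_linear_intros) auto
  then show "smooth_on UNIV (\<lambda>x. (x, p) \<bullet> b)" by (simp add: inner_prod_def)
qed (use assms in auto)

section \<open>Smooth periodic functions of one variable\<close>

lemma smooth_on_has_real_derivative:
  assumes "smooth_on UNIV f"
  shows "(f has_real_derivative deriv f y) (at y)"
  using smooth_on_differentiable[OF assms, of y]
  by (simp add: field_differentiable_derivI real_differentiable_def field_differentiable_def)

lemma smooth_on_deriv:
  fixes f :: "real \<Rightarrow> real"
  assumes "smooth_on UNIV f" shows "smooth_on UNIV (deriv f)"
proof -
  have "dderiv f 1 = deriv f"
    using dderiv_eqI[OF smooth_on_has_real_derivative[OF assms, unfolded has_field_derivative_def]] by auto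
  then show ?thesis using smooth_on_dderiv[OF assms, of 1] by simp
qed

lemma smooth_periodicI: "smooth_on UNIV f \<Longrightarrow> (\<And>y. f (y + 1) = f y) \<Longrightarrow> f \<in> smooth_periodic"
  by (simp add: smooth_periodic_def)

lemma periodic_smooth: "f \<in> smooth_periodic \<Longrightarrow> smooth_on UNIV f"
  by (simp add: smooth_periodic_def)

lemma periodic_period: "f \<in> smooth_periodic \<Longrightarrow> f (y + 1) = f y"
  by (simp add: smooth_periodic_def)

lemma periodic_has_deriv:
  "f \<in> smooth_periodic \<Longrightarrow> (f has_real_derivative deriv f y) (at y)"
  by (simp add: periodic_smooth smooth_on_has_real_derivative)

text \<open>No differentiability is assumed: \<open>deriv\<close> depends only on the set of
  admissible derivatives, and by translation these sets agree at y and y + 1.\<close>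

lemma deriv_periodic:
  fixes f :: "real \<Rightarrow> real"
  assumes "\<And>y. f (y + 1) = f y" shows "deriv f (y + 1) = deriv f y"
proof -
  have "(f has_real_derivative D) (at (y + 1)) \<longleftrightarrow> (f has_real_derivative D) (at y)" for D
    using DERIV_shift[of f D y 1] assms by simp
  then show ?thesis by (simp add: deriv_def)
qed

lemma periodic_deriv: "f \<in> smooth_periodic \<Longrightarrow> deriv f \<in> smooth_periodic"
  by (auto intro!: smooth_periodicI smooth_on_deriv deriv_periodic simp: periodic_smooth periodic_period)

lemma periodic_higher_deriv: "f \<in> smooth_periodic \<Longrightarrow> (deriv ^^ j) f \<in> smooth_periodic"
  by (induction j) (auto intro: periodic_deriv)

lemma periodic_higher_has_deriv:
  "f \<in> smooth_periodic \<Longrightarrow> ((deriv ^^ j) f has_real_derivative (deriv ^^ Suc j) f y) (at y)"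
  using periodic_has_deriv[OF periodic_higher_deriv] by simp

lemma periodic_continuous: "f \<in> smooth_periodic \<Longrightarrow> continuous_on S f"
  using smooth_on_continuous[OF periodic_smooth] continuous_on_subset by blast

lemma periodic_const: "(\<lambda>_. c) \<in> smooth_periodic"
  by (auto intro!: smooth_periodicI smooth_on_const)

lemma periodic_add:
  "f \<in> smooth_periodic \<Longrightarrow> g \<in> smooth_periodic \<Longrightarrow> (\<lambda>y. f y + g y) \<in> smooth_periodic"
  by (auto intro!: smooth_periodicI smooth_on_add simp: periodic_smooth periodic_period)

lemma periodic_mult:
  "f \<in> smooth_periodic \<Longrightarrow> g \<in> smooth_periodic \<Longrightarrow> (\<lambda>y. f y * g y) \<in> smooth_periodic"
  by (auto intro!: smooth_periodicI smooth_on_mult simp: periodic_smooth periodic_period)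

lemma periodic_lincomb:
  "f \<in> smooth_periodic \<Longrightarrow> g \<in> smooth_periodic \<Longrightarrow> (\<lambda>y. f y + c * g y) \<in> smooth_periodic"
  by (intro periodic_add periodic_mult periodic_const)

lemma periodic_sum:
  "(\<And>i. i \<in> I \<Longrightarrow> f i \<in> smooth_periodic) \<Longrightarrow> (\<lambda>y. \<Sum>i\<in>I. f i y) \<in> smooth_periodic"
  by (induction I rule: infinite_finite_induct) (auto intro: periodic_const periodic_add)

lemma higher_deriv_lincomb:
  assumes "f \<in> smooth_periodic" "g \<in> smooth_periodic"
  shows "(deriv ^^ j) (\<lambda>y. f y + c * g y) = (\<lambda>y. (deriv ^^ j) f y + c * (deriv ^^ j) g y)"
proof (induction j)
  case (Suc j)
  have "deriv (\<lambda>y. (deriv ^^ j) f y + c * (deriv ^^ j) g y) y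
      = (deriv ^^ Suc j) f y + c * (deriv ^^ Suc j) g y" for y
    by (rule DERIV_imp_deriv)
      (intro DERIV_add DERIV_cmult periodic_higher_has_deriv assms)
  then show ?case using Suc by simp
qed simp

text \<open>Moves every argument into [0, 1], the compact set from which all estimates uniform in y
  are obtained.\<close>

lemma periodic_frac:
  fixes f :: "real \<Rightarrow> 'b"
  assumes "\<And>y. f (y + 1) = f y" shows "f (frac y) = f y"
proof -
  have n: "f (y + real n) = f y" for n y
  proof (induction n)
    case (Suc n)
    then show ?case using assms[of "y + real n"] by (simp add: add_ac)
  qed simp
  have "f (y + of_int k) = f y" for k y
  proof (cases "k \<ge> 0")
    case True
    then show ?thesis using n[of y "nat k"] by simp
  next
    case False
    then show ?thesis using n[of "y + of_int k" "nat (- k)"] by simp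
  qed
  from this[of y "- \<lfloor>y\<rfloor>"] show ?thesis by (simp add: frac_def)
qed

lemma frac_mem: "frac (y::real) \<in> {0..1}"
  by (simp add: frac_lt_1 less_imp_le)

section \<open>Means over one period and uniform limits\<close>

lemma mean_add:
  assumes "continuous_on {0..1} f" "continuous_on {0..1} g"
  shows "mean (\<lambda>y. f y + g y) = mean f + mean g"
  using assms unfolding mean_def
  by (intro Henstock_Kurzweil_Integration.integral_add integrable_continuous_interval)

lemma mean_diff:
  assumes "continuous_on {0..1} f" "continuous_on {0..1} g"
  shows "mean (\<lambda>y. f y - g y) = mean f - mean g"
  using assms unfolding mean_def
  by (intro Henstock_Kurzweil_Integration.integral_diff integrable_continuous_interval)

lemma mean_cmult: "mean (\<lambda>y. c * f y) = c * mean f"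
  unfolding mean_def by simp

lemma mean_const: "mean (\<lambda>y. c) = c"
  by (simp add: mean_def)

lemma mean_bound:
  assumes "continuous_on {0..1} f" "\<And>y. \<bar>f y\<bar> \<le> K"
  shows "\<bar>mean f\<bar> \<le> K"
proof -
  have "norm (integral {0..1} f) \<le> K * (1 - 0)"
    using assms by (intro integral_bound) auto
  then show ?thesis by (simp add: mean_def)
qed

lemma mean_deriv:
  assumes "f \<in> smooth_periodic" shows "mean (deriv f) = 0"
proof -
  have "(deriv f has_integral f 1 - f 0) {0..1}"
    by (intro fundamental_theorem_of_calculus)
      (auto intro!: has_field_derivative_at_within periodic_has_deriv assms
        simp flip: has_real_derivative_iff_has_vector_derivative)
  then show ?thesis using periodic_period[OF assms, of 0]
    by (simp add: mean_def integral_unique)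
qed

lemma mean_eq_0_imp_eq_0:
  assumes "f \<in> smooth_periodic" "\<And>y. f y \<ge> 0" "mean f = 0"
  shows "f y = 0"
proof -
  have "f x = 0" if "x \<in> {0..1}" for x
  proof -
    have "(f has_integral 0) (cbox 0 1)"
      using assms(3) integrable_integral[OF integrable_continuous_interval[OF periodic_continuous[OF assms(1)], of 0 1]]
      by (simp add: mean_def)
    then show ?thesis
      using has_integral_0_cbox_imp_0[of 0 1 f x] that assms(2) periodic_continuous[OF assms(1)]
      by auto
  qed
  then show ?thesis using periodic_frac[of f y] frac_mem periodic_period[OF assms(1)] by metis
qed

text \<open>Uniform continuity on the product of [0, 1] with a small closed ball gives uniformity
  over one period, and periodicity spreads it over the whole line.\<close>

lemma uniform_limit_periodic_parameter:
  fixes g :: "real \<times> 'p::euclidean_space \<Rightarrow> real"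
  assumes "open \<Omega>" "p0 \<in> \<Omega>" "continuous_on (UNIV \<times> \<Omega>) g"
    "\<And>y p. p \<in> \<Omega> \<Longrightarrow> g (y + 1, p) = g (y, p)"
  shows "uniform_limit UNIV (\<lambda>p y. g (y, p)) (\<lambda>y. g (y, p0)) (nhds p0)"
proof (rule uniform_limitI)
  fix e :: real assume "e > 0"
  obtain r where r: "r > 0" "cball p0 r \<subseteq> \<Omega>" using assms(1,2) open_contains_cball by blast
  have "uniformly_continuous_on ({0..1} \<times> cball p0 r) g"
    using r assms(3) by (intro compact_uniformly_continuous)
      (auto intro!: compact_Times intro: continuous_on_subset)
  then obtain d where d: "d > 0" "\<And>x x'. x \<in> {0..1} \<times> cball p0 r \<Longrightarrow> x' \<in> {0..1} \<times> cball p0 r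
      \<Longrightarrow> dist x' x < d \<Longrightarrow> dist (g x') (g x) < e"
    using \<open>e > 0\<close> unfolding uniformly_continuous_on_def by metis
  have "dist (g (y, p)) (g (y, p0)) < e" if "dist p p0 < min r d" for y p
  proof -
    have p: "p \<in> cball p0 r" using that by (auto simp: dist_commute)
    then have "g (frac y, p) = g (y, p)" "g (frac y, p0) = g (y, p0)"
      using periodic_frac[of "\<lambda>y. g (y, p)"] periodic_frac[of "\<lambda>y. g (y, p0)"] assms(2,4) r by auto
    moreover have "dist (g (frac y, p)) (g (frac y, p0)) < e"
      using p that frac_mem[of y] r(1) by (intro d(2)) (auto simp: dist_Pair_Pair)
    ultimately show ?thesis by simp
  qed
  then show "\<forall>\<^sub>F p in nhds p0. \<forall>y\<in>UNIV. dist (g (y, p)) (g (y, p0)) < e"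
    unfolding eventually_nhds_metric using r(1) d(1) by (intro exI[of _ "min r d"]) auto
qed

lemma uniform_limit_mean:
  assumes "uniform_limit UNIV f g F" "\<forall>\<^sub>F n in F. continuous_on {0..1} (f n)" "continuous_on {0..1} g"
  shows "((\<lambda>n. mean (f n)) \<longlongrightarrow> mean g) F"
proof (rule tendstoI)
  fix e :: real assume "e > 0"
  from uniform_limitD[OF assms(1), of "e/2"] \<open>e > 0\<close>
  have "\<forall>\<^sub>F n in F. \<forall>y. dist (f n y) (g y) < e/2" by simp
  with assms(2) show "\<forall>\<^sub>F n in F. dist (mean (f n)) (mean g) < e"
  proof eventually_elim
    case (elim n)
    have "\<bar>mean (\<lambda>y. f n y - g y)\<bar> \<le> e/2"
      using elim assms(3) by (intro mean_bound continuous_on_diff) (auto simp: dist_real_def less_imp_le)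
    then show ?case using \<open>e > 0\<close> elim assms(3) by (simp add: mean_diff dist_real_def)
  qed
qed

text \<open>Termwise differentiation. The theorem on sequences of derivatives yields some limit
  function, which uniqueness of pointwise limits identifies with \<open>g\<close>.\<close>

lemma uniform_limit_has_real_derivative:
  fixes f :: "nat \<Rightarrow> real \<Rightarrow> real"
  assumes "\<And>n y. (f n has_real_derivative f' n y) (at y)"
    "uniform_limit UNIV f g sequentially" "uniform_limit UNIV f' g' sequentially"
  shows "(g has_real_derivative g' y) (at y)"
proof -
  have lim: "(\<lambda>n. f n x) \<longlonglongrightarrow> g x" for x
    using tendsto_uniform_limitI[OF assms(2)] by simp
  have "\<exists>h. \<forall>x\<in>UNIV. (\<lambda>n. f n x) \<longlonglongrightarrow> h x \<and> (h has_derivative (\<lambda>t. g' x * t)) (at x within UNIV)"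
  proof (rule has_derivative_sequence[where ?x0.0 = 0 and l = "g 0"])
    show "(f n has_derivative (\<lambda>t. f' n x * t)) (at x within UNIV)" for n x
      using assms(1)[of n x] by (simp add: has_field_derivative_def)
    fix e :: real assume "e > 0"
    from uniform_limitD[OF assms(3) this]
    show "\<forall>\<^sub>F n in sequentially. \<forall>x\<in>UNIV. \<forall>h. norm (f' n x * h - g' x * h) \<le> e * norm h"
    proof eventually_elim
      case (elim n)
      then show ?case
        by (auto simp: dist_real_def abs_mult less_imp_le mult_right_mono simp flip: left_diff_distrib)
    qed
  qed (auto intro: lim)
  then obtain h where h: "\<And>x. (\<lambda>n. f n x) \<longlonglongrightarrow> h x" "\<And>x. (h has_derivative (\<lambda>t. g' x * t)) (at x)"
    by auto
  have "h = g" using LIMSEQ_unique[OF h(1) lim] by blast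
  then show ?thesis using h(2)[of y] by (simp add: has_field_derivative_def)
qed

text \<open>Bootstrap: the equation passes order n from the lower entries of the chain to the top
  entry \<open>h m\<close>, and then every \<open>h j\<close> gains one order as the primitive of
  the next entry. A limit obtained by compactness is at first only m times differentiable; this
  makes it smooth.\<close>

lemma linear_ode_smooth:
  fixes h \<alpha> :: "nat \<Rightarrow> real \<Rightarrow> real"
  assumes "\<And>j y. j < m \<Longrightarrow> (h j has_real_derivative h (Suc j) y) (at y)"
    and "\<And>y. h m y = r y - (\<Sum>j<m. \<alpha> j y * h j y)"
    and "\<And>j. j < m \<Longrightarrow> smooth_on UNIV (\<alpha> j)" and "smooth_on UNIV r"
  shows "j < m \<Longrightarrow> smooth_on UNIV (h j)"
proof -
  have "\<forall>j<m. differentiable_up_to UNIV (h j) n" for n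
  proof (induction n)
    case 0
    then show ?case
      using assms(1) by (auto intro!: continuous_at_imp_continuous_on DERIV_isCont)
  next
    case (Suc n)
    show ?case
    proof (intro allI impI)
      fix j assume j: "j < m"
      have hd: "(h j has_derivative (\<lambda>v. h (Suc j) y * v)) (at y)" for y
        using assms(1)[OF j] by (simp add: has_field_derivative_def)
      have "differentiable_up_to UNIV (h m) n"
        unfolding assms(2)[abs_def]
        using Suc assms(3,4) unfolding smooth_on_def
        by (intro differentiable_up_to_diff differentiable_up_to_sum differentiable_up_to_mult) auto
      then have "differentiable_up_to UNIV (h (Suc j)) n"
        using Suc j by (cases "Suc j = m") auto
      then have "differentiable_up_to UNIV (\<lambda>y. h (Suc j) y * v) n" for v
        by (intro differentiable_up_to_mult differentiable_up_to_const) auto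
      moreover have "dderiv (h j) v = (\<lambda>y. h (Suc j) y * v)" for v
        using dderiv_eqI[OF hd] by blast
      ultimately show "differentiable_up_to UNIV (h j) (Suc n)"
        using hd by (auto simp: differentiable_def)
    qed
  qed
  then show "j < m \<Longrightarrow> smooth_on UNIV (h j)" by (simp add: smooth_on_def)
qed

lemma higher_deriv_eq:
  fixes h :: "nat \<Rightarrow> real \<Rightarrow> real"
  assumes "\<And>j y. j < m \<Longrightarrow> (h j has_real_derivative h (Suc j) y) (at y)"
  shows "j \<le> m \<Longrightarrow> (deriv ^^ j) (h 0) = h j"
proof (induction j)
  case (Suc j)
  then show ?case using assms[of j] by (auto intro!: DERIV_imp_deriv)
qed simp

text \<open>That the C^n norm is attained matters: after normalization by it some derivative equals
  1 in absolute value at a point, which rules out uniform convergence to 0.\<close>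

lemma periodic_max:
  assumes "f \<in> smooth_periodic"
  obtains m where "\<And>j y. j \<le> n \<Longrightarrow> \<bar>(deriv ^^ j) f y\<bar> \<le> m" "\<exists>j\<le>n. \<exists>y. \<bar>(deriv ^^ j) f y\<bar> = m"
proof -
  have "\<exists>z. \<forall>y. \<bar>(deriv ^^ j) f y\<bar> \<le> \<bar>(deriv ^^ j) f z\<bar>" for j
  proof -
    have V: "(deriv ^^ j) f \<in> smooth_periodic" by (rule periodic_higher_deriv[OF assms])
    have "\<exists>z\<in>{0..1}. \<forall>y\<in>{0..1}. \<bar>(deriv ^^ j) f y\<bar> \<le> \<bar>(deriv ^^ j) f z\<bar>"
      by (intro continuous_attains_sup continuous_on_rabs periodic_continuous V) auto
    then show ?thesis
      using periodic_frac[of "(deriv ^^ j) f"] periodic_period[OF V] frac_mem by metis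
  qed
  then obtain z where z: "\<And>j y. \<bar>(deriv ^^ j) f y\<bar> \<le> \<bar>(deriv ^^ j) f (z j)\<bar>" by metis
  let ?A = "(\<lambda>j. \<bar>(deriv ^^ j) f (z j)\<bar>) ` {..n}"
  show ?thesis
  proof (rule that[of "Max ?A"])
    show "\<bar>(deriv ^^ j) f y\<bar> \<le> Max ?A" if "j \<le> n" for j y
      using z[of j y] that by (auto intro!: order.trans[OF _ Max_ge])
    have "Max ?A \<in> ?A" by (intro Max_in) auto
    then obtain j where "j \<le> n" "Max ?A = \<bar>(deriv ^^ j) f (z j)\<bar>" by blast
    then show "\<exists>j\<le>n. \<exists>y. \<bar>(deriv ^^ j) f y\<bar> = Max ?A" by metis
  qed
qed

section \<open>A locally uniform a-priori estimate\<close>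

lemma uniform_limit_sum:
  fixes f :: "'i \<Rightarrow> 'n \<Rightarrow> 'x \<Rightarrow> 'c::real_normed_vector"
  assumes "\<And>i. i \<in> I \<Longrightarrow> uniform_limit X (f i) (l i) F"
  shows "uniform_limit X (\<lambda>n x. \<Sum>i\<in>I. f i n x) (\<lambda>x. \<Sum>i\<in>I. l i x) F"
  using assms
  by (induction I rule: infinite_finite_induct) (auto intro!: uniform_limit_intros)

lemma uniform_limit_tendsto_const:
  "(c \<longlongrightarrow> d) F \<Longrightarrow> uniform_limit X (\<lambda>n x. c n) (\<lambda>x. d) F"
  by (rule uniform_limitI) (auto dest: tendstoD)

lemma uniform_limit_bounded_eventually:
  fixes f :: "'n \<Rightarrow> 'x \<Rightarrow> real"
  assumes "uniform_limit UNIV f l F" "bounded (range l)"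
  obtains B where "\<forall>\<^sub>F n in F. \<forall>x. \<bar>f n x\<bar> \<le> B"
proof -
  obtain C where C: "\<And>x. \<bar>l x\<bar> \<le> C" using assms(2) by (auto simp: bounded_iff)
  have "\<forall>\<^sub>F n in F. \<forall>x. \<bar>f n x\<bar> \<le> C + 1"
    using uniform_limitD[OF assms(1), of 1, simplified]
  proof eventually_elim
    case (elim n)
    have "\<bar>f n x\<bar> \<le> C + 1" for x using elim[rule_format, of x] C[of x] by (simp add: dist_real_def)
    then show ?case by blast
  qed
  then show ?thesis by (rule that)
qed

lemma periodic_bounded:
  assumes "f \<in> smooth_periodic" shows "bounded (range f)"
proof -
  obtain m where "\<And>j y. j \<le> 0 \<Longrightarrow> \<bar>(deriv ^^ j) f y\<bar> \<le> m" using periodic_max[OF assms] by blast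
  from this[of 0] show ?thesis by (auto simp: bounded_iff)
qed

lemma lipschitz_of_deriv_bound:
  fixes f :: "real \<Rightarrow> real"
  assumes "\<And>y. (f has_real_derivative f' y) (at y)" "\<And>y. \<bar>f' y\<bar> \<le> K"
  shows "\<bar>f x - f z\<bar> \<le> K * \<bar>x - z\<bar>"
  using field_differentiable_bound[of UNIV f f' K x z] assms by auto

text \<open>In the application this is the linearization divided by its leading coefficient, with
  \<open>b\<close> proportional to U'. The rank-one term has constant output and turns an operator
  with kernel and cokernel of dimension one into a bijection.\<close>

definition nonlocal_op ::
  "(nat \<Rightarrow> real \<times> 'p \<Rightarrow> real) \<Rightarrow> (real \<times> 'p \<Rightarrow> real) \<Rightarrow> 'p \<Rightarrow> (real \<Rightarrow> real) \<Rightarrow> real \<Rightarrow> real" where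
  "nonlocal_op a b p f y =
     (deriv ^^ 4) f y + (\<Sum>j<4. a j (y, p) * (deriv ^^ j) f y) + mean (\<lambda>s. b (s, p) * f s)"

text \<open>Bijectivity is required for each parameter separately. A bound for the inverse that is
  uniform near a given parameter is derived, not assumed.\<close>

locale periodic_operator_family =
  fixes \<Omega> :: "'p::euclidean_space set" and a :: "nat \<Rightarrow> real \<times> 'p \<Rightarrow> real" and b :: "real \<times> 'p \<Rightarrow> real"
  assumes open_param: "open \<Omega>"
    and smooth_a: "j < 4 \<Longrightarrow> smooth_on (UNIV \<times> \<Omega>) (a j)"
    and periodic_a: "j < 4 \<Longrightarrow> p \<in> \<Omega> \<Longrightarrow> a j (y + 1, p) = a j (y, p)"
    and smooth_b: "smooth_on (UNIV \<times> \<Omega>) b"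
    and periodic_b: "p \<in> \<Omega> \<Longrightarrow> b (y + 1, p) = b (y, p)"
    and op_injective: "p \<in> \<Omega> \<Longrightarrow> f \<in> smooth_periodic \<Longrightarrow> (\<And>y. nonlocal_op a b p f y = 0) \<Longrightarrow> f = (\<lambda>_. 0)"
    and op_surjective: "p \<in> \<Omega> \<Longrightarrow> g \<in> smooth_periodic \<Longrightarrow> \<exists>f\<in>smooth_periodic. \<forall>y. nonlocal_op a b p f y = g y"
begin

abbreviation "L \<equiv> nonlocal_op a b"

lemma slice_a: "j < 4 \<Longrightarrow> p \<in> \<Omega> \<Longrightarrow> (\<lambda>y. a j (y, p)) \<in> smooth_periodic"
  by (auto intro!: smooth_periodicI smooth_on_slice[of \<Omega>] smooth_a periodic_a)

lemma slice_b: "p \<in> \<Omega> \<Longrightarrow> (\<lambda>y. b (y, p)) \<in> smooth_periodic"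
  by (auto intro!: smooth_periodicI smooth_on_slice[of \<Omega>] smooth_b periodic_b)

lemma top_deriv_eq:
  "(deriv ^^ 4) f y = L p f y - (\<Sum>j<4. a j (y, p) * (deriv ^^ j) f y) - mean (\<lambda>s. b (s, p) * f s)"
  by (simp add: nonlocal_op_def)

lemma uniform_a: "j < 4 \<Longrightarrow> p0 \<in> \<Omega> \<Longrightarrow> uniform_limit UNIV (\<lambda>p y. a j (y, p)) (\<lambda>y. a j (y, p0)) (nhds p0)"
  by (intro uniform_limit_periodic_parameter[OF open_param]) (auto intro: smooth_on_continuous smooth_a periodic_a)

lemma uniform_b: "p0 \<in> \<Omega> \<Longrightarrow> uniform_limit UNIV (\<lambda>p y. b (y, p)) (\<lambda>y. b (y, p0)) (nhds p0)"
  by (intro uniform_limit_periodic_parameter[OF open_param]) (auto intro: smooth_on_continuous smooth_b periodic_b)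

lemma coefficients_bounded:
  assumes "p0 \<in> \<Omega>"
  obtains B where "B \<ge> 0" "\<forall>\<^sub>F p in nhds p0. p \<in> \<Omega> \<and> (\<forall>y. \<bar>b (y, p)\<bar> \<le> B) \<and> (\<forall>j<4. \<forall>y. \<bar>a j (y, p)\<bar> \<le> B)"
proof -
  have "\<exists>B. \<forall>\<^sub>F p in nhds p0. \<forall>y. \<bar>a j (y, p)\<bar> \<le> B" if "j < 4" for j
    using uniform_limit_bounded_eventually[OF uniform_a[OF that assms] periodic_bounded[OF slice_a[OF that assms]]]
    by blast
  then obtain A where A: "\<And>j. j < 4 \<Longrightarrow> \<forall>\<^sub>F p in nhds p0. \<forall>y. \<bar>a j (y, p)\<bar> \<le> A j" by metis
  obtain C where C: "\<forall>\<^sub>F p in nhds p0. \<forall>y. \<bar>b (y, p)\<bar> \<le> C"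
    using uniform_limit_bounded_eventually[OF uniform_b[OF assms] periodic_bounded[OF slice_b[OF assms]]]
    by blast
  define B where "B = \<bar>C\<bar> + (\<Sum>j<4. \<bar>A j\<bar>)"
  have AB: "A j \<le> B" if "j < 4" for j
    using member_le_sum[of j "{..<4}" "\<lambda>j. \<bar>A j\<bar>"] that by (auto simp: B_def)
  have CB: "C \<le> B" by (simp add: B_def add_increasing2 sum_nonneg)
  have "\<forall>\<^sub>F p in nhds p0. \<forall>j\<in>{..<4}. \<forall>y. \<bar>a j (y, p)\<bar> \<le> A j"
    using A by (intro eventually_ball_finite) auto
  then have "\<forall>\<^sub>F p in nhds p0. p \<in> \<Omega> \<and> (\<forall>y. \<bar>b (y, p)\<bar> \<le> B) \<and> (\<forall>j<4. \<forall>y. \<bar>a j (y, p)\<bar> \<le> B)"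
    using C eventually_nhds_in_open[OF open_param assms]
  proof eventually_elim
    case (elim p)
    then show ?case using AB CB by (meson lessThan_iff order_trans)
  qed
  moreover have "B \<ge> 0" by (auto simp: B_def intro!: add_nonneg_nonneg sum_nonneg)
  ultimately show ?thesis using that by blast
qed

text \<open>The equation expresses the fourth derivative through lower ones; the factor 5 counts the
  four local coefficients and the nonlocal term.\<close>

lemma top_deriv_bound:
  assumes "f \<in> smooth_periodic" "p \<in> \<Omega>"
    "\<And>y. \<bar>L p f y\<bar> \<le> K" "\<And>y. \<bar>b (y, p)\<bar> \<le> B" "\<And>j y. j < 4 \<Longrightarrow> \<bar>a j (y, p)\<bar> \<le> B"
    "\<And>j y. j < 4 \<Longrightarrow> \<bar>(deriv ^^ j) f y\<bar> \<le> M"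
  shows "\<bar>(deriv ^^ 4) f y\<bar> \<le> K + 5 * B * M"
proof -
  have B: "B \<ge> 0" using assms(4)[of 0] by linarith
  have "\<bar>mean (\<lambda>s. b (s, p) * f s)\<bar> \<le> B * M"
  proof (rule mean_bound)
    show "continuous_on {0..1} (\<lambda>s. b (s, p) * f s)"
      by (intro periodic_continuous periodic_mult slice_b assms)
    show "\<bar>b (s, p) * f s\<bar> \<le> B * M" for s
      unfolding abs_mult using assms(4)[of s] assms(6)[of 0 s] B by (intro mult_mono) auto
  qed
  moreover have "\<bar>\<Sum>j<4. a j (y, p) * (deriv ^^ j) f y\<bar> \<le> (\<Sum>j<(4::nat). B * M)"
    unfolding abs_mult using assms(5,6) B
    by (intro order_trans[OF sum_abs] sum_mono) (auto simp: abs_mult intro!: mult_mono)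
  ultimately show ?thesis
    using assms(3)[of y] by (simp add: top_deriv_eq[of f y p])
qed

text \<open>A subsequence converges together with its derivatives of order below four; its limit is
  a smooth periodic solution of the homogeneous equation at \<open>p0\<close>, and injectivity there
  forces this limit to be 0.\<close>

lemma null_sequence_compact:
  assumes f: "\<And>n::nat. f n \<in> smooth_periodic" and p: "\<And>n. p n \<in> \<Omega>" "p \<longlonglongrightarrow> p0" "p0 \<in> \<Omega>"
    and bound: "\<And>n j y. j < 4 \<Longrightarrow> \<bar>(deriv ^^ j) (f n) y\<bar> \<le> 1"
    and op0: "uniform_limit UNIV (\<lambda>n. L (p n) (f n)) (\<lambda>_. 0) sequentially"
  obtains r where "strict_mono (r :: nat \<Rightarrow> nat)"
    "\<And>j. j < 4 \<Longrightarrow> uniform_limit UNIV (\<lambda>n. (deriv ^^ j) (f (r n))) (\<lambda>_. 0) sequentially"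
proof -
  obtain B where B: "B \<ge> 0"
      "\<forall>\<^sub>F p in nhds p0. p \<in> \<Omega> \<and> (\<forall>y. \<bar>b (y, p)\<bar> \<le> B) \<and> (\<forall>j<4. \<forall>y. \<bar>a j (y, p)\<bar> \<le> B)"
    using coefficients_bounded[OF p(3)] by blast
  have "\<forall>\<^sub>F n in sequentially. (\<forall>y. \<bar>b (y, p n)\<bar> \<le> B) \<and> (\<forall>j<4. \<forall>y. \<bar>a j (y, p n)\<bar> \<le> B)"
    using eventually_compose_filterlim[OF B(2) p(2)] by (rule eventually_mono) auto
  moreover have "\<forall>\<^sub>F n in sequentially. \<forall>y. \<bar>L (p n) (f n) y\<bar> \<le> 1"
    using uniform_limitD[OF op0, of 1] by (rule eventually_mono) (auto simp: less_imp_le)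
  ultimately have "\<forall>\<^sub>F n in sequentially. \<forall>y. \<bar>(deriv ^^ 4) (f n) y\<bar> \<le> 1 + 5 * B * 1"
  proof eventually_elim
    case (elim n)
    then show ?case using top_deriv_bound[OF f p(1) _ _ _ bound] by blast
  qed
  \<comment> \<open>The bound holds eventually only, while Arzela-Ascoli asks for estimates valid
    for all members; the sequence is therefore shifted by this \<open>N\<close> below.\<close>
  then obtain N where N: "\<And>n y. n \<ge> N \<Longrightarrow> \<bar>(deriv ^^ 4) (f n) y\<bar> \<le> 1 + 5 * B"
    by (auto simp: eventually_sequentially)
  define K where "K = 1 + 5 * B"
  have K: "K \<ge> 1" using B(1) by (simp add: K_def)
  \<comment> \<open>Equicontinuity: each derivative of order below four is controlled by the next
    one, the last of them through the equation.\<close>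
  have lip: "\<bar>(deriv ^^ j) (f n) y - (deriv ^^ j) (f n) z\<bar> \<le> K * \<bar>y - z\<bar>" if "j < 4" "n \<ge> N" for j n y z
  proof (rule lipschitz_of_deriv_bound[OF periodic_higher_has_deriv[OF f]])
    show "\<bar>(deriv ^^ Suc j) (f n) y\<bar> \<le> K" for y
    proof (cases "Suc j < 4")
      case True
      then show ?thesis using bound[OF True, of n y] K by linarith
    next
      case False
      then have "Suc j = 4" using that by simp
      then show ?thesis using N[OF that(2)] K_def by metis
    qed
  qed

  \<comment> \<open>Encoding the order of differentiation as a discrete real coordinate makes one application of
    Arzela-Ascoli treat all derivatives at once.\<close>
  define S :: "(real \<times> real) set" where "S = (real ` {..<4}) \<times> {0..1}"
  define G where "G n x = (deriv ^^ nat \<lfloor>fst x\<rfloor>) (f (n + N)) (snd x)" for n and x :: "real \<times> real"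
  have G: "G n (real j, y) = (deriv ^^ j) (f (n + N)) y" for n j y by (simp add: G_def)
  obtain g k where g: "strict_mono (k :: nat \<Rightarrow> nat)"
      "\<And>e. 0 < e \<Longrightarrow> \<exists>N. \<forall>n x. n \<ge> N \<and> x \<in> S \<longrightarrow> norm (G (k n) x - g x) < e"
  proof (rule Arzela_Ascoli[of S G 1])
    show "compact S" unfolding S_def by (rule compact_Times) (auto intro: finite_imp_compact)
    show "norm (G n x) \<le> 1" if "x \<in> S" for n x
      using that bound by (auto simp: S_def G)
    show "\<exists>d>0. \<forall>n y. y \<in> S \<and> norm (x - y) < d \<longrightarrow> norm (G n x - G n y) < e"
      if "x \<in> S" "0 < e" for x e
    \<comment> \<open>A distance below 1 forces equal integer coordinates, so two different
      derivatives are never compared; e / K comes from the Lipschitz constant.\<close>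
    proof (intro exI[of _ "min 1 (e / K)"] conjI allI impI)
      show "0 < min 1 (e / K)" using K \<open>0 < e\<close> by simp
      fix n y assume y: "y \<in> S \<and> norm (x - y) < min 1 (e / K)"
      obtain i s where x: "x = (real i, s)" "i < 4" using \<open>x \<in> S\<close> by (auto simp: S_def)
      obtain j t where y': "y = (real j, t)" "j < 4" using y by (auto simp: S_def)
      have "norm (real i - real j) \<le> norm (x - y)" "norm (s - t) \<le> norm (x - y)"
        using norm_fst_le[of "real i - real j" "s - t"] norm_snd_le[of "s - t" "real i - real j"]
        unfolding x y' by simp_all
      then have "\<bar>real i - real j\<bar> < 1" and st: "\<bar>s - t\<bar> < e / K" using y by auto
      then have ij: "i = j" by linarith
      have "norm (G n x - G n y) \<le> K * \<bar>s - t\<bar>"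
        using lip[of j "n + N" s t] x y' ij by (simp add: G)
      also have "\<dots> < e" using st K by (simp add: field_simps)
      finally show "norm (G n x - G n y) < e" .
    qed
  qed blast
  define r where "r n = k n + N" for n
  have r: "strict_mono r" using g(1) by (simp add: strict_mono_def r_def)
  have fr: "f (r n) \<in> smooth_periodic" for n by (rule f)
  \<comment> \<open>The limit is known on [0, 1] only and \<open>frac\<close> extends it
    periodically. Convergence is uniform on the whole line because the approximants are periodic, so
    no separate matching at the integers is needed.\<close>
  define h0 where "h0 j y = g (real j, frac y)" for j y
  have lim: "uniform_limit UNIV (\<lambda>n. (deriv ^^ j) (f (r n))) (h0 j) sequentially" if "j < 4" for j
  proof (rule uniform_limitI)
    fix e :: real assume "e > 0"
    then obtain N' where N': "\<And>n x. n \<ge> N' \<Longrightarrow> x \<in> S \<Longrightarrow> norm (G (k n) x - g x) < e" using g(2) by blast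
    have "dist ((deriv ^^ j) (f (r n)) y) (h0 j y) < e" if "n \<ge> N'" for n y
    proof -
      have "(real j, frac y) \<in> S" using \<open>j < 4\<close> frac_mem by (auto simp: S_def)
      from N'[OF that this] show ?thesis
        using periodic_frac[of "(deriv ^^ j) (f (r n))" y] periodic_period[OF periodic_higher_deriv[OF fr]]
        by (simp add: G dist_real_def h0_def r_def)
    qed
    then show "\<forall>\<^sub>F n in sequentially. \<forall>y\<in>UNIV. dist ((deriv ^^ j) (f (r n)) y) (h0 j y) < e"
      by (auto simp: eventually_sequentially)
  qed
  have bdd: "bounded (range (h0 j))" if "j < 4" for j
    by (rule uniform_limit_bounded[OF lim[OF that]])
      (auto intro!: always_eventually periodic_bounded periodic_higher_deriv fr)
  have cont: "continuous_on {0..1} (h0 0)"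
    using uniform_limit_theorem[OF always_eventually lim[of 0]] periodic_continuous[OF fr]
    by (auto intro: continuous_on_subset)
  define c where "c = mean (\<lambda>s. b (s, p0) * h0 0 s)"
  \<comment> \<open>No compactness is available for the fourth derivatives. Their limit is instead
    read off from the equation, in which all other terms converge uniformly.\<close>
  define h where "h j = (if j < 4 then h0 j else (\<lambda>y. - c - (\<Sum>i<4. a i (y, p0) * h0 i y)))" for j
  have pr: "(\<lambda>n. p (r n)) \<longlonglongrightarrow> p0"
    using LIMSEQ_subseq_LIMSEQ[OF p(2) r] by (simp add: o_def)
  have lim_a: "uniform_limit UNIV (\<lambda>n y. a j (y, p (r n))) (\<lambda>y. a j (y, p0)) sequentially" if "j < 4" for j
    using filterlim_compose[OF uniform_a[OF that p(3)] pr] .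
  have lim_b: "uniform_limit UNIV (\<lambda>n y. b (y, p (r n))) (\<lambda>y. b (y, p0)) sequentially"
    using filterlim_compose[OF uniform_b[OF p(3)] pr] .
  have "uniform_limit UNIV (\<lambda>n y. b (y, p (r n)) * f (r n) y) (\<lambda>y. b (y, p0) * h0 0 y) sequentially"
    using lim[of 0] bdd[of 0]
    by (intro uniform_lim_mult lim_b periodic_bounded[OF slice_b] p) auto
  then have "(\<lambda>n. mean (\<lambda>y. b (y, p (r n)) * f (r n) y)) \<longlonglongrightarrow> c"
    unfolding c_def
  proof (rule uniform_limit_mean)
    show "continuous_on {0..1} (\<lambda>y. b (y, p0) * h0 0 y)"
      by (intro continuous_on_mult cont periodic_continuous[OF slice_b] p)
  qed (auto intro!: always_eventually periodic_continuous periodic_mult slice_b p fr)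
  then have lim_c: "uniform_limit UNIV (\<lambda>n y. mean (\<lambda>y. b (y, p (r n)) * f (r n) y)) (\<lambda>y. c) sequentially"
    by (rule uniform_limit_tendsto_const)
  have lim_L: "uniform_limit UNIV (\<lambda>n. L (p (r n)) (f (r n))) (\<lambda>_. 0) sequentially"
    using filterlim_compose[OF op0 filterlim_subseq[OF r]] by simp
  have "(\<lambda>n. (deriv ^^ 4) (f (r n))) = (\<lambda>n y. L (p (r n)) (f (r n)) y
      - (\<Sum>j<4. a j (y, p (r n)) * (deriv ^^ j) (f (r n)) y) - mean (\<lambda>s. b (s, p (r n)) * f (r n) s))"
    by (intro ext top_deriv_eq)
  moreover have "h 4 = (\<lambda>y. 0 - (\<Sum>j<4. a j (y, p0) * h0 j y) - c)"
    by (simp add: h_def fun_eq_iff)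
  moreover have "uniform_limit UNIV (\<lambda>n y. L (p (r n)) (f (r n)) y
      - (\<Sum>j<4. a j (y, p (r n)) * (deriv ^^ j) (f (r n)) y) - mean (\<lambda>s. b (s, p (r n)) * f (r n) s))
      (\<lambda>y. 0 - (\<Sum>j<4. a j (y, p0) * h0 j y) - c) sequentially"
    using lim bdd
    by (intro uniform_limit_minus uniform_limit_sum uniform_lim_mult lim_L lim_c lim_a
        periodic_bounded[OF slice_a] p) auto
  ultimately have lim4: "uniform_limit UNIV (\<lambda>n. (deriv ^^ 4) (f (r n))) (h 4) sequentially"
    by (simp only:)
  have lim_h: "uniform_limit UNIV (\<lambda>n. (deriv ^^ j) (f (r n))) (h j) sequentially" if "j \<le> 4" for j
    using lim lim4 that by (cases "j = 4") (auto simp: h_def)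
  have der: "(h j has_real_derivative h (Suc j) y) (at y)" if "j < 4" for j y
  proof (rule uniform_limit_has_real_derivative)
    show "((deriv ^^ j) (f (r n)) has_real_derivative (deriv ^^ Suc j) (f (r n)) y) (at y)" for n y
      by (rule periodic_higher_has_deriv[OF fr])
    show "uniform_limit UNIV (\<lambda>n. (deriv ^^ j) (f (r n))) (h j) sequentially"
      using that by (intro lim_h) simp
    show "uniform_limit UNIV (\<lambda>n. (deriv ^^ Suc j) (f (r n))) (h (Suc j)) sequentially"
      using that by (intro lim_h) simp
  qed
  \<comment> \<open>In the limit the nonlocal term is the constant \<open>c\<close>, so the limit
    solves a local linear equation with smooth coefficients, to which the bootstrap applies.\<close>
  have h4: "h 4 y = (\<lambda>_. - c) y - (\<Sum>j<4. a j (y, p0) * h j y)" for y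
    by (simp add: h_def)
  have "smooth_on UNIV (h 0)"
    by (rule linear_ode_smooth[OF der h4])
      (auto intro: smooth_on_const periodic_smooth slice_a p)
  moreover have "h 0 (y + 1) = h 0 y" for y
    by (simp add: h_def h0_def frac_def)
  ultimately have h0V: "h 0 \<in> smooth_periodic" by (rule smooth_periodicI)
  have hj: "(deriv ^^ j) (h 0) = h j" if "j \<le> 4" for j
    using higher_deriv_eq[of 4 h j] der that by blast
  have "L p0 (h 0) y = 0" for y
    unfolding nonlocal_op_def using h4[of y] hj by (simp add: c_def h_def[of 0])
  then have "h 0 = (\<lambda>_. 0)" by (rule op_injective[OF p(3) h0V])
  moreover have "(deriv ^^ j) (\<lambda>_. 0) = (\<lambda>_. 0::real)" for j by (induction j) auto
  ultimately have "h j = (\<lambda>_. 0)" if "j \<le> 4" for j using hj[OF that] by simp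
  then show ?thesis using lim_h r by (intro that[of r]) auto
qed

end

section \<open>Smooth dependence on parameters\<close>

text \<open>A little-o of \<open>w\<close>, uniform in y. Weight 1 serves continuity in the
  parameter, weight \<open>norm (p - p0)\<close> serves differentiability. The inequality is not
  strict because the filter \<open>nhds p0\<close> sees \<open>p0\<close> itself, where the second
  weight is 0.\<close>

definition uniformly_small ::
  "('p \<Rightarrow> real) \<Rightarrow> ('p \<Rightarrow> real \<Rightarrow> real) \<Rightarrow> 'p filter \<Rightarrow> bool" where
  "uniformly_small w \<psi> F \<longleftrightarrow> (\<forall>e>0. \<forall>\<^sub>F p in F. \<forall>y. \<bar>\<psi> p y\<bar> \<le> e * w p)"

lemma uniformly_smallD: "uniformly_small w \<psi> F \<Longrightarrow> e > 0 \<Longrightarrow> \<forall>\<^sub>F p in F. \<forall>y. \<bar>\<psi> p y\<bar> \<le> e * w p"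
  by (simp add: uniformly_small_def)

lemma uniformly_small_add:
  assumes "uniformly_small w \<psi> F" "uniformly_small w \<xi> F"
  shows "uniformly_small w (\<lambda>p y. \<psi> p y + \<xi> p y) F"
  unfolding uniformly_small_def
proof (intro allI impI)
  fix e :: real assume "e > 0"
  then have "e/2 > 0" by simp
  from uniformly_smallD[OF assms(1) this] uniformly_smallD[OF assms(2) this]
  show "\<forall>\<^sub>F p in F. \<forall>y. \<bar>\<psi> p y + \<xi> p y\<bar> \<le> e * w p"
  proof eventually_elim
    case (elim p)
    show ?case
    proof
      fix y
      have "\<bar>\<psi> p y\<bar> \<le> e/2 * w p" "\<bar>\<xi> p y\<bar> \<le> e/2 * w p" using elim by auto
      then show "\<bar>\<psi> p y + \<xi> p y\<bar> \<le> e * w p" by linarith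
    qed
  qed
qed

text \<open>The product rule o(v) O(w) = o(v w). It pairs the variation of a coefficient, of weight
  1, with a function whose size is that of the increment.\<close>

lemma uniformly_small_mult:
  assumes "uniformly_small v \<psi> F" "C > 0" "\<forall>\<^sub>F p in F. \<forall>y. \<bar>\<beta> p y\<bar> \<le> C * w p"
  shows "uniformly_small (\<lambda>p. v p * w p) (\<lambda>p y. \<psi> p y * \<beta> p y) F"
  unfolding uniformly_small_def
proof (intro allI impI)
  fix e :: real assume "e > 0"
  then have "e/C > 0" using assms(2) by simp
  from uniformly_smallD[OF assms(1) this] assms(3)
  show "\<forall>\<^sub>F p in F. \<forall>y. \<bar>\<psi> p y * \<beta> p y\<bar> \<le> e * (v p * w p)"
  proof eventually_elim
    case (elim p)
    show ?case
    proof
      fix y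
      have 1: "\<bar>\<psi> p y\<bar> \<le> e/C * v p" "\<bar>\<beta> p y\<bar> \<le> C * w p" using elim by auto
      have "\<bar>\<psi> p y * \<beta> p y\<bar> \<le> (e/C * v p) * (C * w p)"
        unfolding abs_mult using 1 by (intro mult_mono) (auto intro: order_trans[OF abs_ge_zero])
      then show "\<bar>\<psi> p y * \<beta> p y\<bar> \<le> e * (v p * w p)" using assms(2) by (simp add: field_simps)
    qed
  qed
qed

lemma uniformly_small_mult_bounded:
  assumes "uniformly_small w \<psi> F" "bounded (range \<beta>)"
  shows "uniformly_small w (\<lambda>p y. \<psi> p y * \<beta> y) F"
proof -
  obtain C where "C > 0" "\<And>y. \<bar>\<beta> y\<bar> \<le> C" using assms(2) by (auto simp: bounded_pos)
  then show ?thesis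
    using uniformly_small_mult[OF assms(1), of C "\<lambda>_. \<beta>" "\<lambda>_. 1"] by simp
qed

lemma uniformly_small_zero: "(\<And>p. w p \<ge> 0) \<Longrightarrow> uniformly_small w (\<lambda>p y. 0) F"
  by (simp add: uniformly_small_def)

lemma uniformly_small_sum:
  assumes "\<And>p. w p \<ge> 0" "\<And>i. i \<in> I \<Longrightarrow> uniformly_small w (\<psi> i) F"
  shows "uniformly_small w (\<lambda>p y. \<Sum>i\<in>I. \<psi> i p y) F"
  using assms(2)
  by (induction I rule: infinite_finite_induct)
    (auto intro: uniformly_small_zero uniformly_small_add assms(1))

lemma uniformly_small_mean:
  assumes "uniformly_small w \<psi> F" "\<forall>\<^sub>F p in F. continuous_on {0..1} (\<psi> p)"
  shows "uniformly_small w (\<lambda>p y. mean (\<psi> p)) F"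
  unfolding uniformly_small_def
proof (intro allI impI)
  fix e :: real assume "e > 0"
  from uniformly_smallD[OF assms(1) this] assms(2)
  show "\<forall>\<^sub>F p in F. \<forall>y::real. \<bar>mean (\<psi> p)\<bar> \<le> e * w p"
    by eventually_elim (auto intro: mean_bound)
qed

lemma uniformly_small_minus:
  "uniformly_small w \<psi> F \<Longrightarrow> uniformly_small w (\<lambda>p y. - \<psi> p y) F"
  by (simp add: uniformly_small_def)

lemma uniformly_small_diff:
  "uniformly_small w \<psi> F \<Longrightarrow> uniformly_small w \<xi> F \<Longrightarrow> uniformly_small w (\<lambda>p y. \<psi> p y - \<xi> p y) F"
  using uniformly_small_add[OF _ uniformly_small_minus, of w \<psi> F \<xi>] by simp

lemma uniformly_small_cong:
  assumes "\<forall>\<^sub>F p in F. \<forall>y. \<psi> p y = \<xi> p y" "uniformly_small w \<psi> F"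
  shows "uniformly_small w \<xi> F"
  unfolding uniformly_small_def
proof (intro allI impI)
  fix e :: real assume "e > 0"
  from uniformly_smallD[OF assms(2) this] assms(1)
  show "\<forall>\<^sub>F p in F. \<forall>y. \<bar>\<xi> p y\<bar> \<le> e * w p" by eventually_elim auto
qed

lemma uniform_limit_imp_uniformly_small:
  assumes "uniform_limit UNIV f l F"
  shows "uniformly_small (\<lambda>_. 1) (\<lambda>p y. f p y - l y) F"
  unfolding uniformly_small_def
proof (intro allI impI)
  fix e :: real assume "e > 0"
  from uniform_limitD[OF assms this]
  show "\<forall>\<^sub>F p in F. \<forall>y. \<bar>f p y - l y\<bar> \<le> e * 1" 
    by eventually_elim (auto simp: dist_real_def less_imp_le)
qed

section \<open>Regular families of smooth periodic functions\<close>

definition leafwise_smooth_periodic :: "'p set \<Rightarrow> (real \<times> 'p \<Rightarrow> real) \<Rightarrow> bool" where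
  "leafwise_smooth_periodic \<Omega> g \<longleftrightarrow> (\<forall>p\<in>\<Omega>. (\<lambda>y. g (y, p)) \<in> smooth_periodic)"

lemma leafwiseD: "leafwise_smooth_periodic \<Omega> g \<Longrightarrow> p \<in> \<Omega> \<Longrightarrow> (\<lambda>y. g (y, p)) \<in> smooth_periodic"
  by (simp add: leafwise_smooth_periodic_def)

lemma function_algebra_leafwise:
  fixes \<Omega> :: "'p::euclidean_space set"
  assumes "open \<Omega>"
  shows "function_algebra (UNIV \<times> \<Omega>) (leafwise_smooth_periodic \<Omega>)"
proof
  show "open ((UNIV :: real set) \<times> \<Omega>)" using assms by (intro open_Times) auto
next
  fix f g :: "real \<times> 'p \<Rightarrow> real"
  assume fg: "\<And>x. x \<in> UNIV \<times> \<Omega> \<Longrightarrow> f x = g x" and f: "leafwise_smooth_periodic \<Omega> f"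
  have "(\<lambda>y. g (y, p)) = (\<lambda>y. f (y, p))" if "p \<in> \<Omega>" for p using fg that by auto
  then show "leafwise_smooth_periodic \<Omega> g" using f by (simp add: leafwise_smooth_periodic_def)
qed (simp_all add: leafwise_smooth_periodic_def periodic_const periodic_add periodic_mult)

abbreviation leafwise_regular :: "'p::euclidean_space set \<Rightarrow> nat \<Rightarrow> (real \<times> 'p \<Rightarrow> real) \<Rightarrow> bool" where
  "leafwise_regular \<Omega> n g \<equiv> regular_up_to (leafwise_smooth_periodic \<Omega>) (UNIV \<times> \<Omega>) g n"

lemma leafwise_regular_slice:
  "leafwise_regular \<Omega> n g \<Longrightarrow> p \<in> \<Omega> \<Longrightarrow> (\<lambda>y. g (y, p)) \<in> smooth_periodic"
  by (rule leafwiseD[OF regular_up_to_imp])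

lemma leafwise_regular_dderiv: "leafwise_regular \<Omega> (Suc n) g \<Longrightarrow> leafwise_regular \<Omega> n (dderiv g v)"
  by (simp only: regular_up_to.simps)

lemma leafwise_regular_differentiable:
  "leafwise_regular \<Omega> (Suc n) g \<Longrightarrow> p \<in> \<Omega> \<Longrightarrow> g differentiable (at (y, p))"
  by simp

lemma dderiv_periodic:
  fixes g :: "real \<times> 'p::euclidean_space \<Rightarrow> real"
  assumes "open \<Omega>" "p \<in> \<Omega>" "\<And>y p. p \<in> \<Omega> \<Longrightarrow> g (y + 1, p) = g (y, p)"
    "\<And>x. x \<in> UNIV \<times> \<Omega> \<Longrightarrow> g differentiable (at x)"
  shows "dderiv g v (y + 1, p) = dderiv g v (y, p)"
proof -
  have op: "open ((UNIV :: real set) \<times> \<Omega>)" using assms(1) by (intro open_Times) auto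
  have 1: "((\<lambda>x. x + (1, 0)) has_derivative (\<lambda>v. v)) (at (y, p))"
    by (auto intro!: derivative_eq_intros)
  have 2: "(g has_derivative (\<lambda>v. dderiv g v (y + 1, p))) (at ((y, p) + (1, 0)))"
    using assms(2,4) by (auto intro!: differentiable_imp_has_derivative)
  have "((\<lambda>x. g (x + (1, 0))) has_derivative (\<lambda>v. dderiv g v (y + 1, p))) (at (y, p))"
    by (rule has_derivative_compose[OF 1 2])
  then have "(g has_derivative (\<lambda>v. dderiv g v (y + 1, p))) (at (y, p))"
    by (rule has_derivative_transform_within_open[OF _ op]) (use assms(2,3) in auto)
  then show ?thesis using dderiv_eqI by metis
qed

lemma smooth_imp_leafwise_regular:
  fixes g :: "real \<times> 'p::euclidean_space \<Rightarrow> real"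
  assumes "open \<Omega>" "smooth_on (UNIV \<times> \<Omega>) g" "\<And>y p. p \<in> \<Omega> \<Longrightarrow> g (y + 1, p) = g (y, p)"
  shows "leafwise_regular \<Omega> n g"
  using assms(2,3)
proof (induction n arbitrary: g)
  case 0
  then show ?case
    by (auto simp: leafwise_smooth_periodic_def intro!: smooth_periodicI
        intro: smooth_on_slice smooth_on_continuous)
next
  case (Suc n)
  have "leafwise_smooth_periodic \<Omega> g"
    using Suc.prems by (auto simp: leafwise_smooth_periodic_def intro!: smooth_periodicI intro: smooth_on_slice)
  moreover have "leafwise_regular \<Omega> n (dderiv g v)" for v
  proof (rule Suc.IH)
    show "smooth_on (UNIV \<times> \<Omega>) (dderiv g v)" by (rule smooth_on_dderiv[OF Suc.prems(1)])
    show "dderiv g v (y + 1, p) = dderiv g v (y, p)" if "p \<in> \<Omega>" for y p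
      by (rule dderiv_periodic[OF assms(1) that Suc.prems(2) smooth_on_differentiable[OF Suc.prems(1)]])
  qed
  ultimately show ?case using smooth_on_differentiable[OF Suc.prems(1)] by simp
qed

lemma leafwise_regular_uniform_limit:
  assumes "open \<Omega>" "p0 \<in> \<Omega>" "leafwise_regular \<Omega> n g"
  shows "uniform_limit UNIV (\<lambda>p y. g (y, p)) (\<lambda>y. g (y, p0)) (nhds p0)"
  using assms
  by (intro uniform_limit_periodic_parameter[of \<Omega>])
    (auto intro: regular_up_to_continuous dest: leafwise_regular_slice periodic_period)

lemma dderiv_linear:
  assumes "g differentiable (at x)" shows "linear (\<lambda>v. dderiv g v x)"
  using has_derivative_linear[OF differentiable_imp_has_derivative[OF assms]] .

text \<open>Estimates uniform over all directions \<open>h\<close> reduce in this way to the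
  finitely many basis directions.\<close>

lemma dderiv_parameter_sum:
  fixes g :: "real \<times> 'p::euclidean_space \<Rightarrow> real"
  assumes "g differentiable (at x)"
  shows "dderiv g (0, h) x = (\<Sum>i\<in>Basis. (h \<bullet> i) * dderiv g (0, i) x)"
proof -
  note L = dderiv_linear[OF assms]
  have lin: "linear (\<lambda>h. dderiv g (0, h) x)"
    using linear_add[OF L, of "(0, _)" "(0, _)"] linear_cmul[OF L, of _ "(0, _)"]
    by (intro linearI) simp_all
  have "dderiv g (0, h) x = dderiv g (0, \<Sum>i\<in>Basis. (h \<bullet> i) *\<^sub>R i) x"
    by (simp add: euclidean_representation)
  also have "\<dots> = (\<Sum>i\<in>Basis. (h \<bullet> i) *\<^sub>R dderiv g (0, i) x)"
    by (simp only: linear_sum[OF lin] linear_cmul[OF lin])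
  finally show ?thesis by simp
qed

text \<open>Taylor expansion in the parameter with remainder uniform in y: the mean value theorem on
  the segment from \<open>p0\<close> to \<open>p\<close> moves the increment into the derivative,
  and the derivatives in basis directions converge uniformly in y as \<open>p\<close> tends to
  \<open>p0\<close>.\<close>

lemma parameter_expansion:
  fixes g :: "real \<times> 'p::euclidean_space \<Rightarrow> real"
  assumes "open \<Omega>" "p0 \<in> \<Omega>" "leafwise_regular \<Omega> (Suc n) g"
  shows "uniformly_small (\<lambda>p. norm (p - p0))
    (\<lambda>p y. g (y, p) - g (y, p0) - dderiv g (0, p - p0) (y, p0)) (nhds p0)"
  unfolding uniformly_small_def
proof (intro allI impI)
  fix e :: real assume "e > 0"
  \<comment> \<open>Each of the \<open>DIM('p)\<close> basis directions contributes at most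
    \<open>norm h * e'\<close>.\<close>
  define e' where "e' = e / DIM('p)"
  have e': "e' > 0" using \<open>e > 0\<close> by (simp add: e'_def)
  have diff: "g differentiable (at (y, p))" if "p \<in> \<Omega>" for y p using assms(3) that by auto
  have "\<forall>\<^sub>F p in nhds p0. \<forall>y. \<bar>dderiv g (0, i) (y, p) - dderiv g (0, i) (y, p0)\<bar> < e'" for i
  proof -
    have "leafwise_regular \<Omega> n (dderiv g (0, i))" using assms(3) by auto
    from uniform_limitD[OF leafwise_regular_uniform_limit[OF assms(1,2) this] e'] show ?thesis
      by (simp add: dist_real_def)
  qed
  then have "\<forall>\<^sub>F p in nhds p0. p \<in> \<Omega> \<and>
      (\<forall>i\<in>Basis. \<forall>y. \<bar>dderiv g (0, i) (y, p) - dderiv g (0, i) (y, p0)\<bar> < e')"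
    by (intro eventually_conj eventually_nhds_in_open[OF assms(1,2)] eventually_ball_finite) auto
  then obtain d where d: "d > 0" "\<And>p. dist p p0 < d \<Longrightarrow> p \<in> \<Omega>"
      "\<And>p i y. dist p p0 < d \<Longrightarrow> i \<in> Basis \<Longrightarrow> \<bar>dderiv g (0, i) (y, p) - dderiv g (0, i) (y, p0)\<bar> < e'"
    unfolding eventually_nhds_metric by blast
  have "\<bar>g (y, p) - g (y, p0) - dderiv g (0, p - p0) (y, p0)\<bar> \<le> e * norm (p - p0)"
    if "dist p p0 < d" for p y
  proof -
    define h where "h = p - p0"
    have seg: "dist (p0 + t *\<^sub>R h) p0 < d" if "0 \<le> t" "t \<le> 1" for t
      using \<open>dist p p0 < d\<close> that mult_right_mono[of t 1 "norm h"] by (simp add: dist_norm h_def)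
    have der: "((\<lambda>t. g (y, p0 + t *\<^sub>R h)) has_real_derivative dderiv g (0, h) (y, p0 + t *\<^sub>R h)) (at t)"
      if "0 \<le> t" "t \<le> 1" for t
    proof -
      have "((\<lambda>t. (y, p0 + t *\<^sub>R h)) has_derivative (\<lambda>s. (0, s *\<^sub>R h))) (at t)"
        by (auto intro!: derivative_eq_intros)
      moreover have g: "g differentiable (at (y, p0 + t *\<^sub>R h))" using d(2) seg that by (intro diff) auto
      ultimately have "((\<lambda>t. g (y, p0 + t *\<^sub>R h)) has_derivative
          (\<lambda>s. dderiv g (0, s *\<^sub>R h) (y, p0 + t *\<^sub>R h))) (at t)"
        by (rule has_derivative_compose[OF _ differentiable_imp_has_derivative])
      moreover have "dderiv g (0, s *\<^sub>R h) (y, p0 + t *\<^sub>R h) = dderiv g (0, h) (y, p0 + t *\<^sub>R h) * s" for s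
        using linear_cmul[OF dderiv_linear[OF g], of s "(0, h)"] by simp
      ultimately show ?thesis by (simp add: has_field_derivative_def)
    qed
    obtain t where t: "0 < t" "t < 1" "g (y, p0 + 1 *\<^sub>R h) - g (y, p0 + 0 *\<^sub>R h) = (1 - 0) * dderiv g (0, h) (y, p0 + t *\<^sub>R h)"
      using MVT2[of 0 1 "\<lambda>t. g (y, p0 + t *\<^sub>R h)" "\<lambda>t. dderiv g (0, h) (y, p0 + t *\<^sub>R h)"] der by auto
    have "g (y, p) - g (y, p0) - dderiv g (0, h) (y, p0)
        = dderiv g (0, h) (y, p0 + t *\<^sub>R h) - dderiv g (0, h) (y, p0)"
      using t(3) by (simp add: h_def)
    also have "\<dots> = (\<Sum>i\<in>Basis. (h \<bullet> i) * (dderiv g (0, i) (y, p0 + t *\<^sub>R h) - dderiv g (0, i) (y, p0)))"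
      using d(2)[OF seg[of t]] t assms(2)
      by (simp add: dderiv_parameter_sum diff right_diff_distrib sum_subtractf)
    also have "\<bar>\<dots>\<bar> \<le> (\<Sum>i\<in>(Basis::'p set). norm h * e')"
    proof (intro order_trans[OF sum_abs] sum_mono)
      fix i :: 'p assume "i \<in> Basis"
      then show "\<bar>(h \<bullet> i) * (dderiv g (0, i) (y, p0 + t *\<^sub>R h) - dderiv g (0, i) (y, p0))\<bar> \<le> norm h * e'"
        unfolding abs_mult using d(3)[OF seg[of t], of i y] t Basis_le_norm[of i h]
        by (intro mult_mono) auto
    qed
    also have "\<dots> = e * norm h" by (simp add: e'_def)
    finally show ?thesis by (simp add: h_def)
  qed
  then show "\<forall>\<^sub>F p in nhds p0. \<forall>y. \<bar>g (y, p) - g (y, p0) - dderiv g (0, p - p0) (y, p0)\<bar> \<le> e * norm (p - p0)"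
    unfolding eventually_nhds_metric using d(1) by blast
qed

lemma parameter_dderiv_bound:
  fixes g :: "real \<times> 'p::euclidean_space \<Rightarrow> real"
  assumes "p0 \<in> \<Omega>" "leafwise_regular \<Omega> (Suc n) g"
  obtains C where "C > 0" "\<And>h y. \<bar>dderiv g (0, h) (y, p0)\<bar> \<le> C * norm h"
proof -
  have "\<exists>C. \<forall>y. \<bar>dderiv g (0, i) (y, p0)\<bar> \<le> C" for i
  proof -
    have "leafwise_regular \<Omega> n (dderiv g (0, i))" using assms(2) by auto
    from periodic_bounded[OF leafwise_regular_slice[OF this assms(1)]] show ?thesis
      by (auto simp: bounded_iff)
  qed
  then obtain B where B: "\<And>i y. \<bar>dderiv g (0, i) (y, p0)\<bar> \<le> B i" by metis
  have B0: "B i \<ge> 0" for i using B[of 0 i] by linarith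
  show ?thesis
  \<comment> \<open>The summand 1 only ensures that the constant is positive.\<close>
  proof (rule that[of "1 + (\<Sum>i\<in>Basis. B i)"])
    show "0 < 1 + (\<Sum>i\<in>Basis. B i)" using sum_nonneg[of Basis B] B0 by (simp add: add_pos_nonneg)
    fix h :: 'p and y :: real
    have "g differentiable (at (y, p0))" using assms by auto
    then have "\<bar>dderiv g (0, h) (y, p0)\<bar> = \<bar>\<Sum>i\<in>Basis. (h \<bullet> i) * dderiv g (0, i) (y, p0)\<bar>"
      by (simp add: dderiv_parameter_sum)
    also have "\<dots> \<le> (\<Sum>i\<in>Basis. norm h * B i)"
      unfolding abs_mult
      by (intro order_trans[OF sum_abs] sum_mono)
        (auto simp: abs_mult intro!: mult_mono B Basis_le_norm)
    also have "\<dots> = norm h * (\<Sum>i\<in>Basis. B i)" by (simp add: sum_distrib_left)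
    also have "\<dots> \<le> (1 + (\<Sum>i\<in>Basis. B i)) * norm h" by (simp add: algebra_simps)
    finally show "\<bar>dderiv g (0, h) (y, p0)\<bar> \<le> (1 + (\<Sum>i\<in>Basis. B i)) * norm h" .
  qed
qed

text \<open>Differentiation under the integral: the remainder of the expansion is small uniformly in
  y, and so is its mean.\<close>

lemma has_derivative_mean:
  fixes g :: "real \<times> 'p::euclidean_space \<Rightarrow> real"
  assumes "open \<Omega>" "p0 \<in> \<Omega>" "leafwise_regular \<Omega> (Suc n) g"
  shows "((\<lambda>p. mean (\<lambda>s. g (s, p))) has_derivative (\<lambda>h. mean (\<lambda>s. dderiv g (0, h) (s, p0)))) (at p0)"
proof -
  have diff: "g differentiable (at (y, p0))" for y using assms(2,3) by auto
  have V: "(\<lambda>s. dderiv g v (s, p)) \<in> smooth_periodic" if "p \<in> \<Omega>" for v p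
    using leafwise_regular_slice[OF leafwise_regular_dderiv[OF assms(3)] that] .
  have gV: "(\<lambda>s. g (s, p)) \<in> smooth_periodic" if "p \<in> \<Omega>" for p
    using leafwise_regular_slice[OF assms(3) that] .
  have "linear (\<lambda>h. mean (\<lambda>s. dderiv g (0, h) (s, p0)))"
  proof (rule linearI)
    fix h h' :: 'p and r :: real
    have "dderiv g (0, h + h') (s, p0) = dderiv g (0, h) (s, p0) + dderiv g (0, h') (s, p0)" for s
      using linear_add[OF dderiv_linear[OF diff[of s]], of "(0, h)" "(0, h')"] by simp
    then show "mean (\<lambda>s. dderiv g (0, h + h') (s, p0))
        = mean (\<lambda>s. dderiv g (0, h) (s, p0)) + mean (\<lambda>s. dderiv g (0, h') (s, p0))"
      by (simp add: mean_add periodic_continuous V assms(2))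
    have "dderiv g (0, r *\<^sub>R h) (s, p0) = r * dderiv g (0, h) (s, p0)" for s
      using linear_cmul[OF dderiv_linear[OF diff[of s]], of r "(0, h)"] by simp
    then show "mean (\<lambda>s. dderiv g (0, r *\<^sub>R h) (s, p0)) = r *\<^sub>R mean (\<lambda>s. dderiv g (0, h) (s, p0))"
      by (simp add: mean_cmult)
  qed
  moreover have "\<forall>\<^sub>F p in nhds p0. norm (mean (\<lambda>s. g (s, p)) - mean (\<lambda>s. g (s, p0))
      - mean (\<lambda>s. dderiv g (0, p - p0) (s, p0))) \<le> e * norm (p - p0)" if "e > 0" for e
    using uniformly_smallD[OF parameter_expansion[OF assms] that] eventually_nhds_in_open[OF assms(1,2)]
  proof eventually_elim
    case (elim p)
    have "mean (\<lambda>s. g (s, p)) - mean (\<lambda>s. g (s, p0)) - mean (\<lambda>s. dderiv g (0, p - p0) (s, p0))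
        = mean (\<lambda>s. g (s, p) - g (s, p0) - dderiv g (0, p - p0) (s, p0))"
      using elim assms(2)
      by (simp add: mean_diff continuous_on_diff periodic_continuous V gV)
    also have "\<bar>\<dots>\<bar> \<le> e * norm (p - p0)"
      using elim assms(2) by (intro mean_bound continuous_on_diff periodic_continuous V gV) auto
    finally show ?case by simp
  qed
  ultimately show ?thesis
    unfolding has_derivative_at_alt
    by (simp add: linear_conv_bounded_linear eventually_nhds_metric dist_norm)
qed

text \<open>The mean is treated as a function of (y, p) that is constant in y, which keeps the
  nonlocal term in the same class as the local ones.\<close>

lemma leafwise_regular_mean:
  fixes g :: "real \<times> 'p::euclidean_space \<Rightarrow> real"
  assumes "open \<Omega>"
  shows "leafwise_regular \<Omega> n g \<Longrightarrow> leafwise_regular \<Omega> n (\<lambda>x. mean (\<lambda>s. g (s, snd x)))"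
proof (induction n arbitrary: g)
  case 0
  have "isCont (\<lambda>p. mean (\<lambda>s. g (s, p))) p" if "p \<in> \<Omega>" for p
  proof -
    have "((\<lambda>p. mean (\<lambda>s. g (s, p))) \<longlongrightarrow> mean (\<lambda>s. g (s, p))) (nhds p)"
    proof (rule uniform_limit_mean[OF leafwise_regular_uniform_limit[OF assms that 0]])
      show "\<forall>\<^sub>F p in nhds p. continuous_on {0..1} (\<lambda>s. g (s, p))"
        using eventually_nhds_in_open[OF assms that]
        by eventually_elim (intro periodic_continuous leafwise_regular_slice[OF 0])
    qed (intro periodic_continuous leafwise_regular_slice[OF 0] that)
    then show ?thesis unfolding isCont_def by (rule tendsto_mono[OF at_within_le_nhds])
  qed
  then have "continuous_on \<Omega> (\<lambda>p. mean (\<lambda>s. g (s, p)))" by (auto intro: continuous_at_imp_continuous_on)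
  then have "continuous_on (UNIV \<times> \<Omega>) (\<lambda>x. mean (\<lambda>s. g (s, snd x)))"
    by (rule continuous_on_compose2) (auto intro: continuous_intros)
  then show ?case by (simp add: leafwise_smooth_periodic_def periodic_const)
next
  case (Suc n)
  have hd: "((\<lambda>x. mean (\<lambda>s. g (s, snd x))) has_derivative
      (\<lambda>v. mean (\<lambda>s. dderiv g (0, snd v) (s, snd x)))) (at x)" if "x \<in> UNIV \<times> \<Omega>" for x
    using that
    by (intro has_derivative_compose[OF has_derivative_snd[OF has_derivative_ident]
          has_derivative_mean[OF assms _ Suc.prems]]) auto
  have "leafwise_regular \<Omega> n (dderiv (\<lambda>x. mean (\<lambda>s. g (s, snd x))) v)" for v
  proof (rule function_algebra.regular_cong[OF function_algebra_leafwise[OF assms]])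
    show "leafwise_regular \<Omega> n (\<lambda>x. mean (\<lambda>s. dderiv g (0, snd v) (s, snd x)))"
      using Suc.prems by (intro Suc.IH) auto
    show "mean (\<lambda>s. dderiv g (0, snd v) (s, snd x)) = dderiv (\<lambda>x. mean (\<lambda>s. g (s, snd x))) v x"
      if "x \<in> UNIV \<times> \<Omega>" for x using dderiv_eqI[OF hd[OF that]] by simp
  qed
  moreover have "leafwise_smooth_periodic \<Omega> (\<lambda>x. mean (\<lambda>s. g (s, snd x)))"
    by (simp add: leafwise_smooth_periodic_def periodic_const)
  moreover have "(\<lambda>x. mean (\<lambda>s. g (s, snd x))) differentiable (at x)" if "x \<in> UNIV \<times> \<Omega>" for x
    using hd[OF that] by (rule differentiableI)
  ultimately show ?case by (simp only: regular_up_to.simps) blast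
qed

lemma isCont_of_uniform_limit:
  fixes g :: "real \<times> 'p::metric_space \<Rightarrow> real"
  assumes "uniform_limit UNIV (\<lambda>p y. g (y, p)) (\<lambda>y. g (y, p0)) (nhds p0)" "isCont (\<lambda>y. g (y, p0)) y0"
  shows "isCont g (y0, p0)"
  unfolding continuous_at_eps_delta
proof (intro allI impI)
  fix e :: real assume "e > 0"
  then have "e/2 > 0" by simp
  from uniform_limitD[OF assms(1) this] obtain d1 where d1: "d1 > 0"
      "\<And>p y. dist p p0 < d1 \<Longrightarrow> dist (g (y, p)) (g (y, p0)) < e/2"
    unfolding eventually_nhds_metric by auto
  obtain d2 where d2: "d2 > 0" "\<And>y. dist y y0 < d2 \<Longrightarrow> dist (g (y, p0)) (g (y0, p0)) < e/2"
    using assms(2) \<open>e/2 > 0\<close> unfolding continuous_at_eps_delta by blast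
  show "\<exists>d>0. \<forall>x. dist x (y0, p0) < d \<longrightarrow> dist (g x) (g (y0, p0)) < e"
  proof (intro exI[of _ "min d1 d2"] conjI allI impI)
    fix x assume x: "dist x (y0, p0) < min d1 d2"
    obtain y p where [simp]: "x = (y, p)" by (cases x)
    have "dist p p0 < d1" "dist y y0 < d2"
      using x dist_fst_le[of x "(y0, p0)"] dist_snd_le[of x "(y0, p0)"] by auto
    from d1(2)[OF this(1), of y] d2(2)[OF this(2)]
    have "\<bar>g (y, p) - g (y0, p0)\<bar> < e" unfolding dist_real_def by linarith
    then show "dist (g x) (g (y0, p0)) < e" by (simp add: dist_real_def)
  qed (use d1 d2 in auto)
qed

section \<open>The a priori estimate and the solution operator\<close>

context periodic_operator_family
begin

lemma op_lincomb:
  assumes "p \<in> \<Omega>" "f \<in> smooth_periodic" "g \<in> smooth_periodic"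
  shows "L p (\<lambda>y. f y + c * g y) y = L p f y + c * L p g y"
proof -
  have "mean (\<lambda>s. b (s, p) * (f s + c * g s)) = mean (\<lambda>s. b (s, p) * f s + c * (b (s, p) * g s))"
    by (simp add: algebra_simps)
  also have "\<dots> = mean (\<lambda>s. b (s, p) * f s) + c * mean (\<lambda>s. b (s, p) * g s)"
    using assms
    by (subst mean_add)
      (auto simp: mean_cmult intro!: periodic_continuous periodic_mult periodic_const slice_b)
  finally show ?thesis
    by (simp add: nonlocal_op_def higher_deriv_lincomb assms algebra_simps sum.distrib sum_distrib_left)
qed

lemma op_zero: "L p (\<lambda>_. 0) y = 0"
proof -
  have "(deriv ^^ j) (\<lambda>_. 0) = (\<lambda>_. 0::real)" for j by (induction j) auto
  then show ?thesis by (simp add: nonlocal_op_def mean_def)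
qed

lemma op_cmult: "p \<in> \<Omega> \<Longrightarrow> g \<in> smooth_periodic \<Longrightarrow> L p (\<lambda>y. c * g y) y = c * L p g y"
  using op_lincomb[of p "\<lambda>_. 0" g c y] periodic_const by (simp add: op_zero)

lemma higher_deriv_cmult:
  fixes g :: "real \<Rightarrow> real"
  shows "g \<in> smooth_periodic \<Longrightarrow> (deriv ^^ j) (\<lambda>y. c * g y) y = c * (deriv ^^ j) g y"
proof -
  have "(deriv ^^ j) (\<lambda>_. 0) = (\<lambda>_. 0::real)" by (induction j) auto
  then show "g \<in> smooth_periodic \<Longrightarrow> (deriv ^^ j) (\<lambda>y. c * g y) y = c * (deriv ^^ j) g y"
    using higher_deriv_lincomb[of "\<lambda>_. 0" g j c] periodic_const by simp
qed

text \<open>By contradiction and normalization: if no constant works near \<open>p0\<close>, there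
  are functions with C^3 norm exactly 1, at parameters tending to \<open>p0\<close>, whose images
  tend to 0 uniformly. Compactness makes a subsequence tend to 0 in C^3, which the norm
  excludes.\<close>

lemma lower_order_estimate:
  assumes "p0 \<in> \<Omega>"
  shows "\<exists>C>0. \<forall>\<^sub>F p in nhds p0. p \<in> \<Omega> \<longrightarrow> (\<forall>f\<in>smooth_periodic. \<forall>K.
    (\<forall>y. \<bar>L p f y\<bar> \<le> K) \<longrightarrow> (\<forall>j<4. \<forall>y. \<bar>(deriv ^^ j) f y\<bar> \<le> C * K))"
proof (rule ccontr)
  assume neg: "\<not> ?thesis"
  have "\<exists>p f. p \<in> \<Omega> \<and> dist p p0 < inverse (real (Suc n)) \<and> f \<in> smooth_periodic \<and>
      (\<forall>j<4. \<forall>y. \<bar>(deriv ^^ j) f y\<bar> \<le> 1) \<and> (\<exists>j<4. \<exists>y. \<bar>(deriv ^^ j) f y\<bar> = 1) \<and>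
      (\<forall>y. \<bar>L p f y\<bar> \<le> inverse (real (Suc n)))" for n
  proof -
    have n: "real (Suc n) > 0" "inverse (real (Suc n)) > 0" by auto
    \<comment> \<open>The negated claim is used with the constant \<open>Suc n\<close> on the ball
      of radius 1 / \<open>Suc n\<close>.\<close>
    obtain p f K j y where p: "p \<in> \<Omega>" "dist p p0 < inverse (real (Suc n))" and f: "f \<in> smooth_periodic"
      and K: "\<And>y. \<bar>L p f y\<bar> \<le> K" and j: "j < 4" and y: "\<not> \<bar>(deriv ^^ j) f y\<bar> \<le> real (Suc n) * K"
      using neg n unfolding eventually_nhds_metric by meson
    obtain m where m: "\<And>j y. j \<le> 3 \<Longrightarrow> \<bar>(deriv ^^ j) f y\<bar> \<le> m" "\<exists>j\<le>3. \<exists>y. \<bar>(deriv ^^ j) f y\<bar> = m"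
      using periodic_max[OF f] by blast
    have K0: "K \<ge> 0" using K[of 0] by linarith
    have mK: "m > real (Suc n) * K" using m(1)[of j y] j y by linarith
    then have m0: "m > 0" using K0 n by (meson le_less_trans mult_nonneg_nonneg less_imp_le)
    \<comment> \<open>Since \<open>m\<close> exceeds \<open>Suc n\<close> times \<open>K\<close>,
      division by \<open>m\<close> gives norm 1 and makes the image at most 1 /
      \<open>Suc n\<close>.\<close>
    define g where "g y = (1/m) * f y" for y
    have der: "(deriv ^^ j) g y = (deriv ^^ j) f y / m" for j y
      using higher_deriv_cmult[OF f, of j "1/m" y] by (simp add: g_def[abs_def])
    have "L p g y = L p f y / m" for y
      using op_cmult[OF p(1) f, of "1/m" y] by (simp add: g_def[abs_def])
    then have "\<bar>L p g y\<bar> \<le> K / m" for y using K[of y] m0 by (simp add: divide_right_mono)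
    moreover have "K / m \<le> inverse (real (Suc n))" using mK m0 by (simp add: field_simps)
    ultimately have "\<bar>L p g y\<bar> \<le> inverse (real (Suc n))" for y by (meson order_trans)
    moreover have "g \<in> smooth_periodic"
      unfolding g_def by (intro periodic_mult periodic_const f)
    moreover have "\<bar>(deriv ^^ j) g y\<bar> \<le> 1" if "j < 4" for j y
      using m(1)[of j y] that m0 by (simp add: der)
    moreover have "\<exists>j<4. \<exists>y. \<bar>(deriv ^^ j) g y\<bar> = 1"
    proof -
      obtain j y where "j \<le> 3" "\<bar>(deriv ^^ j) f y\<bar> = m" using m(2) by blast
      then have "j < 4" "\<bar>(deriv ^^ j) g y\<bar> = 1" using m0 by (simp_all add: der)
      then show ?thesis by blast
    qed
    ultimately show ?thesis using p by blast
  qed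
  then obtain p f where p: "\<And>n. p n \<in> \<Omega>" "\<And>n. dist (p n) p0 < inverse (real (Suc n))"
    and f: "\<And>n. f n \<in> smooth_periodic" "\<And>n j y. j < 4 \<Longrightarrow> \<bar>(deriv ^^ j) (f n) y\<bar> \<le> 1"
      "\<And>n. \<exists>j<4. \<exists>y. \<bar>(deriv ^^ j) (f n) y\<bar> = 1" "\<And>n y. \<bar>L (p n) (f n) y\<bar> \<le> inverse (real (Suc n))"
    by metis
  have "(\<lambda>n. dist (p n) p0) \<longlonglongrightarrow> 0"
    by (rule real_tendsto_sandwich[OF _ _ tendsto_const LIMSEQ_inverse_real_of_nat])
      (use p(2) in \<open>auto intro!: always_eventually less_imp_le\<close>)
  then have plim: "p \<longlonglongrightarrow> p0" by (rule tendsto_dist_iff[THEN iffD2])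
  have op0: "uniform_limit UNIV (\<lambda>n. L (p n) (f n)) (\<lambda>_. 0) sequentially"
  proof (rule uniform_limitI)
    fix e :: real assume "e > 0"
    from order_tendstoD(2)[OF LIMSEQ_inverse_real_of_nat this]
    show "\<forall>\<^sub>F n in sequentially. \<forall>y\<in>UNIV. dist (L (p n) (f n) y) 0 < e"
    proof eventually_elim
      case (elim n)
      have "\<bar>L (p n) (f n) y\<bar> < e" for y using f(4)[of n y] elim by linarith
      then show ?case by simp
    qed
  qed
  obtain r where r: "\<And>j. j < 4 \<Longrightarrow> uniform_limit UNIV (\<lambda>n. (deriv ^^ j) (f (r n))) (\<lambda>_. 0) sequentially"
    using null_sequence_compact[OF f(1) p(1) plim assms f(2) op0] by metis
  have "\<forall>\<^sub>F n in sequentially. \<forall>j\<in>{..<4}. \<forall>y. \<bar>(deriv ^^ j) (f (r n)) y\<bar> < 1"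
    using uniform_limitD[OF r, of _ 1] by (intro eventually_ball_finite) auto
  then obtain n where n: "\<And>j y. j < 4 \<Longrightarrow> \<bar>(deriv ^^ j) (f (r n)) y\<bar> < 1"
    by (auto simp: eventually_sequentially)
  obtain j y where "j < 4" "\<bar>(deriv ^^ j) (f (r n)) y\<bar> = 1" using f(3) by blast
  then show False using n[of j y] by simp
qed

lemma a_priori_estimate:
  assumes "p0 \<in> \<Omega>"
  obtains C where "C > 0" "\<forall>\<^sub>F p in nhds p0. p \<in> \<Omega> \<and> (\<forall>f\<in>smooth_periodic. \<forall>K.
    (\<forall>y. \<bar>L p f y\<bar> \<le> K) \<longrightarrow> (\<forall>j\<le>4. \<forall>y. \<bar>(deriv ^^ j) f y\<bar> \<le> C * K))"
proof -
  obtain B where B: "B \<ge> 0"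
      "\<forall>\<^sub>F p in nhds p0. p \<in> \<Omega> \<and> (\<forall>y. \<bar>b (y, p)\<bar> \<le> B) \<and> (\<forall>j<4. \<forall>y. \<bar>a j (y, p)\<bar> \<le> B)"
    using coefficients_bounded[OF assms] by blast
  obtain C where C: "C > 0" "\<forall>\<^sub>F p in nhds p0. p \<in> \<Omega> \<longrightarrow> (\<forall>f\<in>smooth_periodic. \<forall>K.
      (\<forall>y. \<bar>L p f y\<bar> \<le> K) \<longrightarrow> (\<forall>j<4. \<forall>y. \<bar>(deriv ^^ j) f y\<bar> \<le> C * K))"
    using lower_order_estimate[OF assms] by blast
  have BC: "B * C \<ge> 0" using B(1) C(1) by simp
  show ?thesis
  \<comment> \<open>The summand \<open>C\<close> covers the orders below four;
    \<open>1 + 5 * (B * C)\<close> is what \<open>top_deriv_bound\<close> gives when the lower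
    derivatives are bounded by \<open>C * K\<close>.\<close>
  proof (rule that[of "C + 1 + 5 * (B * C)"])
    show "0 < C + 1 + 5 * (B * C)" using BC C(1) by linarith
    from B(2) C(2) show "\<forall>\<^sub>F p in nhds p0. p \<in> \<Omega> \<and> (\<forall>f\<in>smooth_periodic. \<forall>K.
      (\<forall>y. \<bar>L p f y\<bar> \<le> K) \<longrightarrow> (\<forall>j\<le>4. \<forall>y. \<bar>(deriv ^^ j) f y\<bar> \<le> (C + 1 + 5 * (B * C)) * K))"
    proof eventually_elim
      case (elim p)
      have "\<bar>(deriv ^^ j) f y\<bar> \<le> (C + 1 + 5 * (B * C)) * K"
        if f: "f \<in> smooth_periodic" and K: "\<forall>y. \<bar>L p f y\<bar> \<le> K" and j: "j \<le> 4" for f K j y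
      proof -
        have K0: "K \<ge> 0" using K[rule_format, of 0] by linarith
        have low: "\<bar>(deriv ^^ i) f y\<bar> \<le> C * K" if "i < 4" for i y
          using elim f K that by blast
        have CK: "C * K \<ge> 0" "5 * (B * C) * K \<ge> 0" using C(1) K0 BC by simp_all
        show ?thesis
        proof (cases "j = 4")
          case True
          have "\<bar>(deriv ^^ 4) f y\<bar> \<le> K + 5 * B * (C * K)"
            using elim K low f by (intro top_deriv_bound[of f p]) auto
          then show ?thesis using True CK by (simp add: algebra_simps)
        next
          case False
          then have "\<bar>(deriv ^^ j) f y\<bar> \<le> C * K" using low j by simp
          then show ?thesis using CK K0 by (simp add: algebra_simps)
        qed
      qed
      then show ?case using elim by blast
    qed
  qed
qed

definition sol :: "'p \<Rightarrow> (real \<Rightarrow> real) \<Rightarrow> real \<Rightarrow> real" where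
  "sol p g = (SOME f. f \<in> smooth_periodic \<and> (\<forall>y. L p f y = g y))"

lemma sol:
  assumes "p \<in> \<Omega>" "g \<in> smooth_periodic"
  shows "sol p g \<in> smooth_periodic" "L p (sol p g) y = g y"
proof -
  have "sol p g \<in> smooth_periodic \<and> (\<forall>y. L p (sol p g) y = g y)"
    unfolding sol_def
    by (rule someI_ex[of "\<lambda>f. f \<in> smooth_periodic \<and> (\<forall>y. L p f y = g y)"])
      (use op_surjective[OF assms] in blast)
  then show "sol p g \<in> smooth_periodic" "L p (sol p g) y = g y" by auto
qed

lemma sol_unique:
  assumes "p \<in> \<Omega>" "f \<in> smooth_periodic" "g \<in> smooth_periodic" "\<And>y. L p f y = g y"
  shows "sol p g = f"
proof -
  have "L p (\<lambda>y. sol p g y + (-1) * f y) y = 0" for y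
    by (subst op_lincomb[OF assms(1) sol(1)[OF assms(1,3)] assms(2)]) (simp add: assms sol)
  then have "(\<lambda>y. sol p g y + (-1) * f y) = (\<lambda>_. 0)"
    by (intro op_injective[OF assms(1)] periodic_lincomb sol assms)
  then show ?thesis by (simp add: fun_eq_iff)
qed

lemma sol_lincomb:
  assumes "p \<in> \<Omega>" "f \<in> smooth_periodic" "g \<in> smooth_periodic"
  shows "sol p (\<lambda>y. f y + c * g y) = (\<lambda>y. sol p f y + c * sol p g y)"
proof (rule sol_unique[OF assms(1)])
  show "L p (\<lambda>y. sol p f y + c * sol p g y) y = f y + c * g y" for y
    by (subst op_lincomb[OF assms(1) sol(1)[OF assms(1,2)] sol(1)[OF assms(1,3)]]) (simp add: sol assms)
qed (intro periodic_lincomb sol assms)+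

text \<open>The constant of the a priori estimate is the same for all parameters near
  \<open>p0\<close>, so smallness of the images passes to the functions with the same
  weight.\<close>

lemma small_solution:
  assumes "p0 \<in> \<Omega>" "\<And>p. p \<in> \<Omega> \<Longrightarrow> d p \<in> smooth_periodic"
    "uniformly_small w (\<lambda>p. L p (d p)) (nhds p0)" "j \<le> 4"
  shows "uniformly_small w (\<lambda>p. (deriv ^^ j) (d p)) (nhds p0)"
  unfolding uniformly_small_def
proof (intro allI impI)
  fix e :: real assume "e > 0"
  obtain C where C: "C > 0" "\<forall>\<^sub>F p in nhds p0. p \<in> \<Omega> \<and> (\<forall>f\<in>smooth_periodic. \<forall>K.
    (\<forall>y. \<bar>L p f y\<bar> \<le> K) \<longrightarrow> (\<forall>j\<le>4. \<forall>y. \<bar>(deriv ^^ j) f y\<bar> \<le> C * K))"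
    using a_priori_estimate[OF assms(1)] by blast
  have "e / C > 0" using \<open>e > 0\<close> C(1) by simp
  from uniformly_smallD[OF assms(3) this] C(2)
  show "\<forall>\<^sub>F p in nhds p0. \<forall>y. \<bar>(deriv ^^ j) (d p) y\<bar> \<le> e * w p"
  proof eventually_elim
    case (elim p)
    then have "\<forall>y. \<bar>(deriv ^^ j) (d p) y\<bar> \<le> C * (e / C * w p)" using assms(2,4) by blast
    then show ?case using C(1) by simp
  qed
qed

text \<open>The fourth-order term has the coefficient 1 at every parameter and cancels in the
  difference; hence bounds on the derivatives of order below four suffice.\<close>

lemma op_perturbation_small:
  assumes "p0 \<in> \<Omega>" "\<And>p. F p \<in> smooth_periodic" "C > 0" "\<And>p. w p \<ge> 0"
    "\<And>p j y. j < 4 \<Longrightarrow> \<bar>(deriv ^^ j) (F p) y\<bar> \<le> C * w p"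
  shows "uniformly_small w (\<lambda>p y. L p (F p) y - L p0 (F p) y) (nhds p0)"
proof (rule uniformly_small_cong)
  have w: "(\<lambda>p. 1 * w p) = w" by simp
  show "uniformly_small w (\<lambda>p y. (\<Sum>j<4. (a j (y, p) - a j (y, p0)) * (deriv ^^ j) (F p) y)
      + mean (\<lambda>s. (b (s, p) - b (s, p0)) * F p s)) (nhds p0)"
  proof (intro uniformly_small_add uniformly_small_sum uniformly_small_mean)
    show "uniformly_small w (\<lambda>p y. (a j (y, p) - a j (y, p0)) * (deriv ^^ j) (F p) y) (nhds p0)"
      if "j \<in> {..<4}" for j
      using uniformly_small_mult[OF uniform_limit_imp_uniformly_small[OF uniform_a] assms(3), of j p0
          "\<lambda>p. (deriv ^^ j) (F p)" w] that assms by (simp add: w)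
    show "uniformly_small w (\<lambda>p s. (b (s, p) - b (s, p0)) * F p s) (nhds p0)"
      using uniformly_small_mult[OF uniform_limit_imp_uniformly_small[OF uniform_b] assms(3), of p0 F w]
        assms(1) assms(5)[of 0] by (simp add: w)
    show "\<forall>\<^sub>F p in nhds p0. continuous_on {0..1} (\<lambda>s. (b (s, p) - b (s, p0)) * F p s)"
      using eventually_nhds_in_open[OF open_param assms(1)]
      by eventually_elim (intro continuous_on_mult continuous_on_diff periodic_continuous slice_b assms)
  qed (rule assms)
  show "\<forall>\<^sub>F p in nhds p0. \<forall>y. (\<Sum>j<4. (a j (y, p) - a j (y, p0)) * (deriv ^^ j) (F p) y)
      + mean (\<lambda>s. (b (s, p) - b (s, p0)) * F p s) = L p (F p) y - L p0 (F p) y"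
    using eventually_nhds_in_open[OF open_param assms(1)]
  proof eventually_elim
    case (elim p)
    have "mean (\<lambda>s. (b (s, p) - b (s, p0)) * F p s) = mean (\<lambda>s. b (s, p) * F p s) - mean (\<lambda>s. b (s, p0) * F p s)"
      using elim assms(1,2)
      by (subst mean_diff[symmetric])
        (auto simp: algebra_simps intro!: periodic_continuous periodic_mult slice_b)
    then show ?case by (simp add: nonlocal_op_def left_diff_distrib sum_subtractf)
  qed
qed

text \<open>The y-derivatives of the solution are kept as separate fields. Each is the y-derivative
  of its predecessor, and the induction over the order of regularity treats those of index below
  four simultaneously.\<close>

definition sol_field :: "(real \<times> 'p \<Rightarrow> real) \<Rightarrow> nat \<Rightarrow> real \<times> 'p \<Rightarrow> real" where
  "sol_field g j x = (deriv ^^ j) (sol (snd x) (\<lambda>s. g (s, snd x))) (fst x)"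

lemma sol_field_slice:
  assumes "leafwise_smooth_periodic \<Omega> g" "p \<in> \<Omega>"
  shows "(\<lambda>y. sol_field g j (y, p)) \<in> smooth_periodic"
  using periodic_higher_deriv[OF sol(1)[OF assms(2) leafwiseD[OF assms]]] by (simp add: sol_field_def)

lemma sol_field_has_deriv:
  assumes "leafwise_smooth_periodic \<Omega> g" "p \<in> \<Omega>"
  shows "((\<lambda>y. sol_field g j (y, p)) has_real_derivative sol_field g (Suc j) (y, p)) (at y)"
  using periodic_higher_has_deriv[OF sol(1)[OF assms(2) leafwiseD[OF assms]]]
  by (simp add: sol_field_def)

lemma sol_field_equation:
  assumes "leafwise_smooth_periodic \<Omega> g" "p \<in> \<Omega>"
  shows "sol_field g 4 (y, p) = g (y, p) - (\<Sum>j<4. a j (y, p) * sol_field g j (y, p))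
    - mean (\<lambda>s. b (s, p) * sol_field g 0 (s, p))"
  using sol(2)[OF assms(2) leafwiseD[OF assms], of y] by (simp add: sol_field_def nonlocal_op_def)

lemma sol_field_uniform_limit:
  assumes g: "leafwise_regular \<Omega> n g" and p0: "p0 \<in> \<Omega>" and j: "j \<le> 4"
  shows "uniform_limit UNIV (\<lambda>p y. sol_field g j (y, p)) (\<lambda>y. sol_field g j (y, p0)) (nhds p0)"
proof -
  note gV = leafwise_regular_slice[OF g]
  define f0 where "f0 = sol p0 (\<lambda>s. g (s, p0))"
  have f0: "f0 \<in> smooth_periodic" "\<And>y. L p0 f0 y = g (y, p0)"
    using sol[OF p0 gV[OF p0]] by (auto simp: f0_def)
  obtain m where m: "\<And>j y. j \<le> 3 \<Longrightarrow> \<bar>(deriv ^^ j) f0 y\<bar> \<le> m" using periodic_max[OF f0(1)] by blast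
  have bnd: "\<bar>(deriv ^^ j) f0 y\<bar> \<le> (\<bar>m\<bar> + 1) * 1" if "j < 4" for j y
    using m[of j y] that by simp
  define d where "d p y = sol p (\<lambda>s. g (s, p)) y + (-1) * f0 y" for p y
  have dV: "d p \<in> smooth_periodic" if "p \<in> \<Omega>" for p
    unfolding d_def using sol(1)[OF that gV[OF that]] f0(1) by (rule periodic_lincomb)
  have "uniformly_small (\<lambda>_. 1) (\<lambda>p. L p (d p)) (nhds p0)"
  proof (rule uniformly_small_cong)
    show "uniformly_small (\<lambda>_. 1) (\<lambda>p y. (g (y, p) - g (y, p0)) - (L p f0 y - L p0 f0 y)) (nhds p0)"
      by (intro uniformly_small_diff uniform_limit_imp_uniformly_small
          leafwise_regular_uniform_limit[OF open_param p0 g]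
          op_perturbation_small[OF p0 f0(1), of "\<bar>m\<bar> + 1"] bnd) auto
    show "\<forall>\<^sub>F p in nhds p0. \<forall>y. (g (y, p) - g (y, p0)) - (L p f0 y - L p0 f0 y) = L p (d p) y"
      using eventually_nhds_in_open[OF open_param p0]
    proof eventually_elim
      case (elim p)
      show ?case
        unfolding d_def op_lincomb[OF elim sol(1)[OF elim gV[OF elim]] f0(1)] sol(2)[OF elim gV[OF elim]]
        by (simp add: f0)
    qed
  qed
  from small_solution[OF p0 dV this j]
  have small: "uniformly_small (\<lambda>_. 1) (\<lambda>p. (deriv ^^ j) (d p)) (nhds p0)" .
  show ?thesis
  proof (rule uniform_limitI)
    fix e :: real assume "e > 0"
    then have "e/2 > 0" by simp
    from uniformly_smallD[OF small this] eventually_nhds_in_open[OF open_param p0]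
    show "\<forall>\<^sub>F p in nhds p0. \<forall>y\<in>UNIV. dist (sol_field g j (y, p)) (sol_field g j (y, p0)) < e"
    proof eventually_elim
      case (elim p)
      have "(deriv ^^ j) (d p) y = sol_field g j (y, p) - sol_field g j (y, p0)" for y
        unfolding d_def higher_deriv_lincomb[OF sol(1)[OF elim(2) gV[OF elim(2)]] f0(1)]
        by (simp add: sol_field_def f0_def)
      then have half: "\<bar>sol_field g j (y, p) - sol_field g j (y, p0)\<bar> \<le> e/2" for y using elim by simp
      have "\<bar>sol_field g j (y, p) - sol_field g j (y, p0)\<bar> < e" for y
        using \<open>e > 0\<close> half[of y] by linarith
      then show ?case by (simp add: dist_real_def)
    qed
  qed
qed

lemma sol_field_continuous:
  assumes g: "leafwise_regular \<Omega> n g" and j: "j \<le> 4"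
  shows "continuous_on (UNIV \<times> \<Omega>) (sol_field g j)"
proof (rule continuous_at_imp_continuous_on, clarify)
  fix y p assume p: "p \<in> \<Omega>"
  have "isCont (\<lambda>y. sol_field g j (y, p)) y"
    by (rule DERIV_isCont[OF sol_field_has_deriv[OF regular_up_to_imp[OF g] p]])
  then show "isCont (sol_field g j) (y, p)"
    by (rule isCont_of_uniform_limit[OF sol_field_uniform_limit[OF g p j]])
qed

end

lemma periodic_diff:
  "f \<in> smooth_periodic \<Longrightarrow> g \<in> smooth_periodic \<Longrightarrow> (\<lambda>y. f y - g y) \<in> smooth_periodic"
  using periodic_lincomb[of f g "-1"] by simp

section \<open>Differentiability of the solution in the parameters\<close>

context periodic_operator_family
begin

lemma regular_a: "j < 4 \<Longrightarrow> leafwise_regular \<Omega> n (a j)"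
  by (intro smooth_imp_leafwise_regular open_param smooth_a periodic_a)

lemma regular_b: "leafwise_regular \<Omega> n b"
  by (intro smooth_imp_leafwise_regular open_param smooth_b periodic_b)

text \<open>The derivative in the parameter direction \<open>h\<close> of the solution with right-hand side \<open>g\<close> is the
  solution with right-hand side \<open>linearized_rhs g h\<close>.\<close>

definition linearized_rhs :: "(real \<times> 'p \<Rightarrow> real) \<Rightarrow> 'p \<Rightarrow> real \<times> 'p \<Rightarrow> real" where
  "linearized_rhs g h x = dderiv g (0, h) x - (\<Sum>j<4. dderiv (a j) (0, h) x * sol_field g j x)
     - mean (\<lambda>s. dderiv b (0, h) (s, snd x) * sol_field g 0 (s, snd x))"

lemma linearized_rhs_leafwise:
  assumes g: "leafwise_regular \<Omega> (Suc n) g"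
  shows "leafwise_smooth_periodic \<Omega> (linearized_rhs g h)"
  unfolding leafwise_smooth_periodic_def linearized_rhs_def
  using leafwise_regular_slice[OF leafwise_regular_dderiv[OF g]]
    leafwise_regular_slice[OF leafwise_regular_dderiv[OF regular_a]]
    sol_field_slice[OF regular_up_to_imp[OF g]]
  by (auto intro!: periodic_diff periodic_sum periodic_mult periodic_const)

text \<open>Let \<open>W h\<close> solve the formally differentiated equation at \<open>p0\<close>.
  What remains of the solution at \<open>p\<close> after subtracting \<open>f0\<close> and
  \<open>W (p - p0)\<close> is mapped by the operator at \<open>p\<close> to o(norm (p - p0)), so by
  the estimate it is of that size itself. This settles the parameter directions uniformly in y; the
  y-direction comes from smoothness at fixed \<open>p0\<close>.\<close>

lemma sol_field_has_derivative:
  assumes g: "leafwise_regular \<Omega> (Suc n) g" and p0: "p0 \<in> \<Omega>" and j: "j < 4"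
  shows "(sol_field g j has_derivative
    (\<lambda>v. fst v * sol_field g (Suc j) (y0, p0) + sol_field (linearized_rhs g (snd v)) j (y0, p0))) (at (y0, p0))"
proof -
  note gV = leafwise_regular_slice[OF g]
  define f0 where "f0 = sol p0 (\<lambda>s. g (s, p0))"
  have f0: "f0 \<in> smooth_periodic" "\<And>y. L p0 f0 y = g (y, p0)"
    using sol[OF p0 gV[OF p0]] by (auto simp: f0_def)
  have f0_field: "sol_field g i (y, p0) = (deriv ^^ i) f0 y" for i y
    by (simp add: sol_field_def f0_def)
  obtain m where m: "\<And>j y. j \<le> 3 \<Longrightarrow> \<bar>(deriv ^^ j) f0 y\<bar> \<le> m" using periodic_max[OF f0(1)] by blast
  have m0: "m \<ge> 0" using m[of 0 0] by simp
  have rV: "(\<lambda>s. linearized_rhs g h (s, p0)) \<in> smooth_periodic" for h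
    using leafwiseD[OF linearized_rhs_leafwise[OF g] p0] .
  define W where "W h = sol p0 (\<lambda>s. linearized_rhs g h (s, p0))" for h
  have W: "W h \<in> smooth_periodic" "L p0 (W h) y = linearized_rhs g h (y, p0)" for h y
    using sol[OF p0 rV] by (auto simp: W_def)
  have rhs: "linearized_rhs g h (y, p0) = dderiv g (0, h) (y, p0)
      - (\<Sum>j<4. dderiv (a j) (0, h) (y, p0) * (deriv ^^ j) f0 y)
      - mean (\<lambda>s. dderiv b (0, h) (s, p0) * f0 s)" for h y
    by (simp add: linearized_rhs_def f0_field)
  have diff: "g differentiable (at (y, p0))" "b differentiable (at (y, p0))" for y
    using leafwise_regular_differentiable[OF g p0] leafwise_regular_differentiable[OF regular_b p0] by auto
  have diff_a: "a j differentiable (at (y, p0))" if "j < 4" for j y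
    using leafwise_regular_differentiable[OF regular_a[OF that] p0] .

  \<comment> \<open>Linear growth in \<open>h\<close>, uniform in y, makes \<open>W h\<close> of
    size O(norm h). Without it the variation of the operator on \<open>W (p - p0)\<close> could not
    be shown to be of higher order.\<close>
  have "\<exists>K>0. \<forall>h y. \<bar>linearized_rhs g h (y, p0)\<bar> \<le> K * norm h"
  proof -
    obtain Cg where Cg: "Cg > 0" "\<And>h y. \<bar>dderiv g (0, h) (y, p0)\<bar> \<le> Cg * norm h"
      using parameter_dderiv_bound[OF p0 g] by blast
    obtain Cb where Cb: "Cb > 0" "\<And>h y. \<bar>dderiv b (0, h) (y, p0)\<bar> \<le> Cb * norm h"
      using parameter_dderiv_bound[OF p0 regular_b] by blast
    have "\<exists>C>0. \<forall>h y. \<bar>dderiv (a j) (0, h) (y, p0)\<bar> \<le> C * norm h" if "j < 4" for j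
      using parameter_dderiv_bound[OF p0 regular_a[OF that]] by metis
    then obtain Ca where Ca: "\<And>j. j < 4 \<Longrightarrow> Ca j > 0"
        "\<And>j h y. j < 4 \<Longrightarrow> \<bar>dderiv (a j) (0, h) (y, p0)\<bar> \<le> Ca j * norm h"
      by metis
    have "\<bar>linearized_rhs g h (y, p0)\<bar> \<le> (Cg + (\<Sum>j<4. Ca j * m) + Cb * m) * norm h" for h y
    proof -
      have "\<bar>\<Sum>j<4. dderiv (a j) (0, h) (y, p0) * (deriv ^^ j) f0 y\<bar> \<le> (\<Sum>j<4. (Ca j * norm h) * m)"
      proof (intro order_trans[OF sum_abs] sum_mono)
        fix j :: nat assume "j \<in> {..<4}"
        then show "\<bar>dderiv (a j) (0, h) (y, p0) * (deriv ^^ j) f0 y\<bar> \<le> (Ca j * norm h) * m"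
          unfolding abs_mult using Ca(1)[of j] by (intro mult_mono Ca m) auto
      qed
      moreover have "\<bar>mean (\<lambda>s. dderiv b (0, h) (s, p0) * f0 s)\<bar> \<le> (Cb * norm h) * m"
      proof (rule mean_bound)
        show "continuous_on {0..1} (\<lambda>s. dderiv b (0, h) (s, p0) * f0 s)"
          by (intro periodic_continuous periodic_mult f0
              leafwise_regular_slice[OF leafwise_regular_dderiv[OF regular_b[of "Suc 0"]] p0])
        show "\<bar>dderiv b (0, h) (s, p0) * f0 s\<bar> \<le> (Cb * norm h) * m" for s
          unfolding abs_mult using Cb(1) m[of 0 s] by (intro mult_mono Cb) auto
      qed
      ultimately have "\<bar>linearized_rhs g h (y, p0)\<bar>
          \<le> Cg * norm h + (\<Sum>j<4. (Ca j * norm h) * m) + (Cb * norm h) * m"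
        unfolding rhs using Cg(2)[of y h] by linarith
      also have "\<dots> = (Cg + (\<Sum>j<4. Ca j * m) + Cb * m) * norm h"
        by (simp add: algebra_simps sum_distrib_left)
      finally show ?thesis .
    qed
    moreover have "Cg + (\<Sum>j<4. Ca j * m) + Cb * m > 0"
      using Cg(1) Cb(1) Ca(1) m0
      by (intro add_pos_nonneg sum_nonneg mult_nonneg_nonneg) (auto intro: less_imp_le)
    ultimately show ?thesis by blast
  qed
  then obtain K where K: "K > 0" "\<And>h y. \<bar>linearized_rhs g h (y, p0)\<bar> \<le> K * norm h" by blast
  obtain C where C: "C > 0" "\<forall>\<^sub>F p in nhds p0. p \<in> \<Omega> \<and> (\<forall>f\<in>smooth_periodic. \<forall>K.
      (\<forall>y. \<bar>L p f y\<bar> \<le> K) \<longrightarrow> (\<forall>j\<le>4. \<forall>y. \<bar>(deriv ^^ j) f y\<bar> \<le> C * K))"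
    using a_priori_estimate[OF p0] by blast
  \<comment> \<open>A property that holds eventually in \<open>nhds p0\<close> holds at
    \<open>p0\<close>, so the estimate may be used there without a limit.\<close>
  note estimate = eventually_nhds_x_imp_x[OF C(2), THEN conjunct2, rule_format]
  define CK where "CK = C * K"
  have CK: "CK > 0" using C(1) K(1) by (simp add: CK_def mult.assoc)
  have W_bound: "\<bar>(deriv ^^ i) (W h) y\<bar> \<le> CK * norm h" if "i \<le> 4" for i h y
  proof -
    have "\<bar>L p0 (W h) y\<bar> \<le> K * norm h" for y by (simp add: W K)
    from estimate[OF W(1) this that] show ?thesis by (simp add: CK_def mult.assoc)
  qed

  have rhs_lincomb: "linearized_rhs g (h + c *\<^sub>R h') (y, p0)
      = linearized_rhs g h (y, p0) + c * linearized_rhs g h' (y, p0)" for h h' c y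
  proof -
    have lin: "dderiv G (0, h + c *\<^sub>R h') (s, p0) = dderiv G (0, h) (s, p0) + c * dderiv G (0, h') (s, p0)"
      if "G differentiable (at (s, p0))" for G s
      using linear_add[OF dderiv_linear[OF that], of "(0, h)" "c *\<^sub>R (0, h')"]
        linear_cmul[OF dderiv_linear[OF that], of c "(0, h')"] by simp
    have Vb: "(\<lambda>s. dderiv b (0, h) (s, p0) * f0 s) \<in> smooth_periodic" for h
      by (intro periodic_mult f0 leafwise_regular_slice[OF leafwise_regular_dderiv[OF regular_b[of "Suc 0"]] p0])
    have "mean (\<lambda>s. dderiv b (0, h + c *\<^sub>R h') (s, p0) * f0 s)
        = mean (\<lambda>s. dderiv b (0, h) (s, p0) * f0 s + c * (dderiv b (0, h') (s, p0) * f0 s))"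
      by (simp add: lin diff algebra_simps)
    also have "\<dots> = mean (\<lambda>s. dderiv b (0, h) (s, p0) * f0 s) + c * mean (\<lambda>s. dderiv b (0, h') (s, p0) * f0 s)"
      by (subst mean_add)
        (auto simp: mean_cmult intro!: periodic_continuous periodic_mult periodic_const Vb)
    finally show ?thesis
      by (simp add: rhs lin diff diff_a algebra_simps sum.distrib sum_distrib_left)
  qed
  have W_lincomb: "(deriv ^^ i) (W (h + c *\<^sub>R h')) y = (deriv ^^ i) (W h) y + c * (deriv ^^ i) (W h') y" for i h h' c y
  proof -
    have "W (h + c *\<^sub>R h') = (\<lambda>y. W h y + c * W h' y)"
      unfolding W_def rhs_lincomb by (rule sol_lincomb[OF p0 rV rV])
    then show ?thesis using higher_deriv_lincomb[OF W(1) W(1)] by simp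
  qed
  have W_linear: "linear (\<lambda>h. (deriv ^^ j) (W h) y0)"
  proof (rule linearI)
    show "(deriv ^^ j) (W (h + h')) y0 = (deriv ^^ j) (W h) y0 + (deriv ^^ j) (W h') y0" for h h'
      using W_lincomb[of j h 1 h' y0] by simp
    \<comment> \<open>\<open>W_lincomb\<close> gives homogeneity only once the value at
      \<open>h = 0\<close> is known to be 0, and the bound provides that.\<close>
    have "(deriv ^^ j) (W 0) y0 = 0" using W_bound[of j 0 y0] j by simp
    then show "(deriv ^^ j) (W (r *\<^sub>R h)) y0 = r *\<^sub>R (deriv ^^ j) (W h) y0" for r h
      using W_lincomb[of j 0 r h y0] by simp
  qed

  \<comment> \<open>The nested form with factors -1 and 1 fits the rules for linear combinations; it
    is the solution at \<open>p\<close> minus its first-order approximation.\<close>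
  define d where "d p y = sol p (\<lambda>s. g (s, p)) y + (-1) * (f0 y + 1 * W (p - p0) y)" for p y
  have dV: "d p \<in> smooth_periodic" if "p \<in> \<Omega>" for p
    unfolding d_def by (intro periodic_lincomb sol(1)[OF that gV[OF that]] f0 W)
  have small_f0: "uniformly_small (\<lambda>p. norm (p - p0)) (\<lambda>p y.
      (\<Sum>j<4. (a j (y, p) - a j (y, p0) - dderiv (a j) (0, p - p0) (y, p0)) * (deriv ^^ j) f0 y)
      + mean (\<lambda>s. (b (s, p) - b (s, p0) - dderiv b (0, p - p0) (s, p0)) * f0 s)) (nhds p0)"
  proof (intro uniformly_small_add uniformly_small_sum uniformly_small_mean uniformly_small_mult_bounded)
    show "uniformly_small (\<lambda>p. norm (p - p0))
        (\<lambda>p y. a j (y, p) - a j (y, p0) - dderiv (a j) (0, p - p0) (y, p0)) (nhds p0)" if "j \<in> {..<4}" for j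
      using parameter_expansion[OF open_param p0 regular_a] that by blast
    show "uniformly_small (\<lambda>p. norm (p - p0))
        (\<lambda>p y. b (y, p) - b (y, p0) - dderiv b (0, p - p0) (y, p0)) (nhds p0)"
      using parameter_expansion[OF open_param p0 regular_b] .
    show "\<forall>\<^sub>F p in nhds p0. continuous_on {0..1} (\<lambda>s. (b (s, p) - b (s, p0) - dderiv b (0, p - p0) (s, p0)) * f0 s)"
      using eventually_nhds_in_open[OF open_param p0]
      by eventually_elim (intro continuous_on_mult continuous_on_diff periodic_continuous slice_b f0 p0
          leafwise_regular_slice[OF leafwise_regular_dderiv[OF regular_b[of "Suc 0"]] p0])
  qed (auto intro: periodic_bounded periodic_higher_deriv f0)
  have "uniformly_small (\<lambda>p. norm (p - p0)) (\<lambda>p. L p (d p)) (nhds p0)"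
  proof (rule uniformly_small_cong)
    \<comment> \<open>This is \<open>L p (d p)\<close> rearranged. By the choice of
      \<open>linearized_rhs\<close> all first-order terms cancel; the Taylor remainder of
      \<open>g\<close>, those of the coefficients tested on \<open>f0\<close>, and the change of the
      operator on \<open>W (p - p0)\<close> are left.\<close>
    show "uniformly_small (\<lambda>p. norm (p - p0)) (\<lambda>p y.
        (g (y, p) - g (y, p0) - dderiv g (0, p - p0) (y, p0))
        - ((\<Sum>j<4. (a j (y, p) - a j (y, p0) - dderiv (a j) (0, p - p0) (y, p0)) * (deriv ^^ j) f0 y)
          + mean (\<lambda>s. (b (s, p) - b (s, p0) - dderiv b (0, p - p0) (s, p0)) * f0 s))
        - (L p (W (p - p0)) y - L p0 (W (p - p0)) y)) (nhds p0)"
      by (intro uniformly_small_diff small_f0 parameter_expansion[OF open_param p0 g]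
          op_perturbation_small[OF p0 W(1) CK] W_bound) auto
    show "\<forall>\<^sub>F p in nhds p0. \<forall>y. (g (y, p) - g (y, p0) - dderiv g (0, p - p0) (y, p0))
        - ((\<Sum>j<4. (a j (y, p) - a j (y, p0) - dderiv (a j) (0, p - p0) (y, p0)) * (deriv ^^ j) f0 y)
          + mean (\<lambda>s. (b (s, p) - b (s, p0) - dderiv b (0, p - p0) (s, p0)) * f0 s))
        - (L p (W (p - p0)) y - L p0 (W (p - p0)) y) = L p (d p) y"
      using eventually_nhds_in_open[OF open_param p0]
    proof eventually_elim
      case (elim p)
      have bV: "continuous_on {0..1} (\<lambda>s. b (s, p) * f0 s)" "continuous_on {0..1} (\<lambda>s. b (s, p0) * f0 s)"
          "continuous_on {0..1} (\<lambda>s. dderiv b (0, p - p0) (s, p0) * f0 s)"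
        by (intro continuous_on_mult periodic_continuous slice_b f0 p0 elim
            leafwise_regular_slice[OF leafwise_regular_dderiv[OF regular_b[of "Suc 0"]] p0])+
      have e1: "mean (\<lambda>s. (b (s, p) - b (s, p0) - dderiv b (0, p - p0) (s, p0)) * f0 s)
          = mean (\<lambda>s. b (s, p) * f0 s) - mean (\<lambda>s. b (s, p0) * f0 s)
            - mean (\<lambda>s. dderiv b (0, p - p0) (s, p0) * f0 s)"
        using bV by (simp add: left_diff_distrib mean_diff continuous_on_diff)
      have e2: "L p (d p) y = g (y, p) - (L p f0 y + L p (W (p - p0)) y)" for y
      proof -
        have "L p (d p) y = L p (sol p (\<lambda>s. g (s, p))) y + (-1) * L p (\<lambda>y. f0 y + 1 * W (p - p0) y) y"
          unfolding d_def
          by (rule op_lincomb[OF elim sol(1)[OF elim gV[OF elim]] periodic_lincomb[OF f0(1) W(1)]])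
        then show ?thesis
          unfolding op_lincomb[OF elim f0(1) W(1)] sol(2)[OF elim gV[OF elim]] by simp
      qed
      have e3: "L p f0 y - g (y, p0) = (\<Sum>j<4. (a j (y, p) - a j (y, p0)) * (deriv ^^ j) f0 y)
          + (mean (\<lambda>s. b (s, p) * f0 s) - mean (\<lambda>s. b (s, p0) * f0 s))" for y
        unfolding f0(2)[symmetric] nonlocal_op_def by (simp add: left_diff_distrib sum_subtractf)
      have e4: "(\<Sum>j<4. (a j (y, p) - a j (y, p0) - dderiv (a j) (0, p - p0) (y, p0)) * (deriv ^^ j) f0 y)
          = (\<Sum>j<4. (a j (y, p) - a j (y, p0)) * (deriv ^^ j) f0 y)
            - (\<Sum>j<4. dderiv (a j) (0, p - p0) (y, p0) * (deriv ^^ j) f0 y)" for y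
        by (simp only: left_diff_distrib sum_subtractf)
      show ?case
      proof
        fix y
        show "(g (y, p) - g (y, p0) - dderiv g (0, p - p0) (y, p0))
          - ((\<Sum>j<4. (a j (y, p) - a j (y, p0) - dderiv (a j) (0, p - p0) (y, p0)) * (deriv ^^ j) f0 y)
            + mean (\<lambda>s. (b (s, p) - b (s, p0) - dderiv b (0, p - p0) (s, p0)) * f0 s))
          - (L p (W (p - p0)) y - L p0 (W (p - p0)) y) = L p (d p) y"
          unfolding e1 e2 e4 W(2) rhs using e3[of y] by (simp only: algebra_simps)
      qed
    qed
  qed
  from small_solution[OF p0 dV this, of j] j
  have small: "uniformly_small (\<lambda>p. norm (p - p0)) (\<lambda>p. (deriv ^^ j) (d p)) (nhds p0)" by simp

  have "sol_field (linearized_rhs g h) j (y0, p0) = (deriv ^^ j) (W h) y0" for h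
    by (simp add: sol_field_def W_def)
  moreover have "(sol_field g j has_derivative
      (\<lambda>v. fst v * sol_field g (Suc j) (y0, p0) + (deriv ^^ j) (W (snd v)) y0)) (at (y0, p0))"
    unfolding has_derivative_at_alt
  proof (intro conjI allI impI)
    have "linear (\<lambda>v. fst v * sol_field g (Suc j) (y0, p0) + (deriv ^^ j) (W (snd v)) y0)"
      using linear_add[OF W_linear] linear_cmul[OF W_linear]
      by (intro linearI) (auto simp: algebra_simps)
    then show "bounded_linear (\<lambda>v. fst v * sol_field g (Suc j) (y0, p0) + (deriv ^^ j) (W (snd v)) y0)"
      by (simp add: linear_conv_bounded_linear)
    fix e :: real assume "e > 0"
    then have e3: "e/3 > 0" by simp
    from uniformly_smallD[OF small e3] eventually_nhds_in_open[OF open_param p0]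
    have "\<forall>\<^sub>F p in nhds p0. \<forall>y. \<bar>sol_field g j (y, p) - sol_field g j (y, p0) - (deriv ^^ j) (W (p - p0)) y\<bar>
        \<le> e/3 * norm (p - p0)"
    proof eventually_elim
      case (elim p)
      have "(deriv ^^ j) (d p) y = sol_field g j (y, p) - sol_field g j (y, p0) - (deriv ^^ j) (W (p - p0)) y" for y
        unfolding d_def f0_field
          higher_deriv_lincomb[OF sol(1)[OF elim(2) gV[OF elim(2)]] periodic_lincomb[OF f0(1) W(1)]]
          higher_deriv_lincomb[OF f0(1) W(1)]
        by (simp add: sol_field_def)
      then show ?case using elim by simp
    qed
    then obtain d1 where d1: "d1 > 0" "\<And>p y. dist p p0 < d1 \<Longrightarrow>
        \<bar>sol_field g j (y, p) - sol_field g j (y, p0) - (deriv ^^ j) (W (p - p0)) y\<bar> \<le> e/3 * norm (p - p0)"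
      unfolding eventually_nhds_metric by blast
    have "((\<lambda>y. sol_field g j (y, p0)) has_derivative (\<lambda>t. sol_field g (Suc j) (y0, p0) * t)) (at y0)"
      using sol_field_has_deriv[OF regular_up_to_imp[OF g] p0] by (simp add: has_field_derivative_def)
    then obtain d2 where d2: "d2 > 0" "\<And>y. norm (y - y0) < d2 \<Longrightarrow>
        norm (sol_field g j (y, p0) - sol_field g j (y0, p0) - sol_field g (Suc j) (y0, p0) * (y - y0)) \<le> e/3 * norm (y - y0)"
      unfolding has_derivative_at_alt using e3 by blast
    \<comment> \<open>Chosen so that \<open>CK * norm (p - p0)\<close>, a Lipschitz constant in y
      for the derivative of \<open>W (p - p0)\<close>, stays below e / 3.\<close>
    define d3 where "d3 = e / (3 * CK)"
    have d3: "d3 > 0" using \<open>e > 0\<close> CK by (simp add: d3_def)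
    show "\<exists>\<delta>>0. \<forall>x. norm (x - (y0, p0)) < \<delta> \<longrightarrow> norm (sol_field g j x - sol_field g j (y0, p0)
        - (fst (x - (y0, p0)) * sol_field g (Suc j) (y0, p0) + (deriv ^^ j) (W (snd (x - (y0, p0)))) y0))
        \<le> e * norm (x - (y0, p0))"
    proof (intro exI[of _ "min d1 (min d2 d3)"] conjI allI impI)
      fix x assume x: "norm (x - (y0, p0)) < min d1 (min d2 d3)"
      obtain y p where xe[simp]: "x = (y, p)" by (cases x)
      define N where "N = norm (x - (y0, p0))"
      have N: "\<bar>y - y0\<bar> \<le> N" "norm (p - p0) \<le> N"
        using norm_fst_le[of "y - y0" "p - p0"] norm_snd_le[of "p - p0" "y - y0"] by (simp_all add: N_def)
      then have small_yp: "dist p p0 < d1" "norm (y - y0) < d2" "norm (p - p0) < d3"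
        using x by (auto simp: N_def dist_norm)
      have t1: "\<bar>sol_field g j (y, p) - sol_field g j (y, p0) - (deriv ^^ j) (W (p - p0)) y\<bar> \<le> e/3 * N"
        using d1(2)[OF small_yp(1), of y] mult_left_mono[OF N(2), of "e/3"] e3 by linarith
      have t2: "\<bar>sol_field g j (y, p0) - sol_field g j (y0, p0) - sol_field g (Suc j) (y0, p0) * (y - y0)\<bar> \<le> e/3 * N"
        using d2(2)[OF small_yp(2)] mult_left_mono[OF N(1), of "e/3"] e3 unfolding real_norm_def by linarith
      \<comment> \<open>As \<open>j < 4\<close>, the bound on \<open>W\<close> up to order four also
        covers the next derivative.\<close>
      have "\<bar>(deriv ^^ j) (W (p - p0)) y - (deriv ^^ j) (W (p - p0)) y0\<bar> \<le> (CK * norm (p - p0)) * \<bar>y - y0\<bar>"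
        using j by (intro lipschitz_of_deriv_bound[OF periodic_higher_has_deriv[OF W(1)]] W_bound) simp
      also have "\<dots> \<le> e/3 * N"
      proof (intro mult_mono N)
        show "CK * norm (p - p0) \<le> e / 3" using small_yp(3) CK by (simp add: d3_def field_simps)
      qed (use e3 in auto)
      finally have t3: "\<bar>(deriv ^^ j) (W (p - p0)) y - (deriv ^^ j) (W (p - p0)) y0\<bar> \<le> e/3 * N" .
      \<comment> \<open>Three errors of e / 3: the parameter moves at fixed y, then y moves at fixed
        \<open>p0\<close>, and finally the parameter derivative is carried from y back to
        \<open>y0\<close>.\<close>
      have "sol_field g j (y, p) - sol_field g j (y0, p0)
          - ((y - y0) * sol_field g (Suc j) (y0, p0) + (deriv ^^ j) (W (p - p0)) y0)
        = (sol_field g j (y, p) - sol_field g j (y, p0) - (deriv ^^ j) (W (p - p0)) y)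
          + (sol_field g j (y, p0) - sol_field g j (y0, p0) - sol_field g (Suc j) (y0, p0) * (y - y0))
          + ((deriv ^^ j) (W (p - p0)) y - (deriv ^^ j) (W (p - p0)) y0)"
        by (simp only: algebra_simps)
      also have "\<bar>\<dots>\<bar> \<le> e/3 * N + e/3 * N + e/3 * N"
        by (intro order_trans[OF abs_triangle_ineq] add_mono t1 t2 t3)
      finally show "norm (sol_field g j x - sol_field g j (y0, p0)
        - (fst (x - (y0, p0)) * sol_field g (Suc j) (y0, p0) + (deriv ^^ j) (W (snd (x - (y0, p0)))) y0))
        \<le> e * norm (x - (y0, p0))" by (simp add: N_def)
    qed (use d1 d2 d3 in auto)
  qed
  ultimately show ?thesis by simp
qed

text \<open>Differentiation of the field of index j produces the field of index j + 1 and a field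
  with right-hand side \<open>linearized_rhs\<close>. That right-hand side contains the original
  solution and is regular to order n only, one less than \<open>g\<close>; hence the induction runs
  over all right-hand sides and all indices below four at once.\<close>

lemma sol_field_regular:
  assumes "leafwise_regular \<Omega> n g" "j < 4"
  shows "leafwise_regular \<Omega> n (sol_field g j)"
  using assms
proof (induction n arbitrary: g j)
  case 0
  have "leafwise_smooth_periodic \<Omega> (sol_field g j)"
    using sol_field_slice[OF regular_up_to_imp[OF 0(1)]] by (simp add: leafwise_smooth_periodic_def)
  then show ?case using sol_field_continuous[OF 0(1), of j] 0 by simp
next
  case (Suc n)
  interpret alg: function_algebra "UNIV \<times> \<Omega>" "leafwise_smooth_periodic \<Omega>"
    by (rule function_algebra_leafwise[OF open_param])
  have gn: "leafwise_regular \<Omega> n g" by (rule regular_up_to_SucD[OF Suc.prems(1)])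
  \<comment> \<open>For j = 3 the derivative in y has order four, outside the induction hypothesis;
    the equation reduces it to lower fields.\<close>
  have top: "leafwise_regular \<Omega> n (sol_field g 4)"
  proof (rule alg.regular_cong)
    show "leafwise_regular \<Omega> n (\<lambda>x. g x - (\<Sum>j<4. a j x * sol_field g j x)
        - mean (\<lambda>s. b (s, snd x) * sol_field g 0 (s, snd x)))"
      using Suc.IH[OF gn]
      by (intro alg.regular_diff alg.regular_sum alg.regular_mult gn regular_a
          leafwise_regular_mean[OF open_param, of "\<lambda>x. b x * sol_field g 0 x" n] regular_b) auto
    show "g x - (\<Sum>j<4. a j x * sol_field g j x) - mean (\<lambda>s. b (s, snd x) * sol_field g 0 (s, snd x))
        = sol_field g 4 x" if "x \<in> UNIV \<times> \<Omega>" for x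
      using sol_field_equation[OF regular_up_to_imp[OF gn], of "snd x" "fst x"] that by auto
  qed
  have hd: "(sol_field g j has_derivative
      (\<lambda>v. fst v * sol_field g (Suc j) x + sol_field (linearized_rhs g (snd v)) j x)) (at x)" if "x \<in> UNIV \<times> \<Omega>" for x
    using sol_field_has_derivative[OF Suc.prems(1) _ Suc.prems(2), of "snd x" "fst x"] that by auto
  have "leafwise_regular \<Omega> n (dderiv (sol_field g j) v)" for v
  proof (rule alg.regular_cong)
    have rhs: "leafwise_regular \<Omega> n (linearized_rhs g (snd v))"
      unfolding linearized_rhs_def[abs_def] using Suc.IH[OF gn]
      by (intro alg.regular_diff alg.regular_sum alg.regular_mult leafwise_regular_dderiv[OF Suc.prems(1)]
          leafwise_regular_dderiv[OF regular_a]
          leafwise_regular_mean[OF open_param, of "\<lambda>x. dderiv b (0, snd v) x * sol_field g 0 x" n]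
          leafwise_regular_dderiv[OF regular_b]) auto
    have "leafwise_regular \<Omega> n (sol_field g (Suc j))"
      using Suc.IH[OF gn, of "Suc j"] top Suc.prems(2) by (cases "Suc j = 4") auto
    then show "leafwise_regular \<Omega> n
        (\<lambda>x. fst v * sol_field g (Suc j) x + sol_field (linearized_rhs g (snd v)) j x)"
      by (intro alg.regular_add alg.regular_mult alg.regular_const Suc.IH[OF rhs Suc.prems(2)])
    show "fst v * sol_field g (Suc j) x + sol_field (linearized_rhs g (snd v)) j x = dderiv (sol_field g j) v x"
      if "x \<in> UNIV \<times> \<Omega>" for x using dderiv_eqI[OF hd[OF that]] by simp
  qed
  moreover have "leafwise_smooth_periodic \<Omega> (sol_field g j)"
    using sol_field_slice[OF regular_up_to_imp[OF gn]] by (simp add: leafwise_smooth_periodic_def)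
  moreover have "sol_field g j differentiable (at x)" if "x \<in> UNIV \<times> \<Omega>" for x
    using hd[OF that] by (rule differentiableI)
  ultimately show ?case by (simp only: regular_up_to.simps) blast
qed

theorem smooth_solution:
  assumes "smooth_on (UNIV \<times> \<Omega>) g" "\<And>y p. p \<in> \<Omega> \<Longrightarrow> g (y + 1, p) = g (y, p)"
  obtains f where "smooth_on (UNIV \<times> \<Omega>) f" "\<And>p. p \<in> \<Omega> \<Longrightarrow> (\<lambda>y. f (y, p)) \<in> smooth_periodic"
    "\<And>y p. p \<in> \<Omega> \<Longrightarrow> L p (\<lambda>y. f (y, p)) y = g (y, p)"
proof (rule that[of "sol_field g 0"])
  have g: "leafwise_regular \<Omega> n g" for n
    by (rule smooth_imp_leafwise_regular[OF open_param assms])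
  show "smooth_on (UNIV \<times> \<Omega>) (sol_field g 0)"
    unfolding smooth_on_def by (intro allI regular_up_to_differentiable[OF sol_field_regular[OF g]]) simp
  show "(\<lambda>y. sol_field g 0 (y, p)) \<in> smooth_periodic" if "p \<in> \<Omega>" for p
    by (rule sol_field_slice[OF regular_up_to_imp[OF g[of 0]] that])
  show "L p (\<lambda>y. sol_field g 0 (y, p)) y = g (y, p)" if "p \<in> \<Omega>" for y p
    using sol(2)[OF that leafwise_regular_slice[OF g[of 0] that]] by (simp add: sol_field_def)
qed

end

section \<open>Formal expansion\<close>

notation fls_nth (infixl "$$" 75)

text \<open>Known lower bounds replace the exact \<open>fls_subdegree\<close>, because the
  coefficients at the expected lowest order may vanish.\<close>

lemma fls_times_nth_lower_bounds:
  fixes f g :: "'a::comm_ring_1 fls"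
  assumes "\<And>i. i < a \<Longrightarrow> f $$ i = 0" "\<And>i. i < b \<Longrightarrow> g $$ i = 0"
  shows "(f * g) $$ n = (\<Sum>i=a..n - b. f $$ i * g $$ (n - i))"
proof (cases "f = 0 \<or> g = 0")
  case False
  then have "a \<le> fls_subdegree f" "b \<le> fls_subdegree g"
    using assms by (auto intro: fls_subdegree_geI)
  then show ?thesis
    unfolding fls_times_nth(2) by (intro sum.mono_neutral_left) auto
qed auto

text \<open>The powers of \<epsilon> in the equation balance the derivatives so that every term
  starts at order -1. Two coefficients of each product therefore reach order 0.\<close>

lemma fls_times_nth_lowest:
  fixes f g :: "'a::comm_ring_1 fls"
  assumes "\<And>i. i < a \<Longrightarrow> f $$ i = 0" "\<And>i. i < b \<Longrightarrow> g $$ i = 0"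
  shows "n < a + b \<Longrightarrow> (f * g) $$ n = 0"
    and "(f * g) $$ (a + b) = f $$ a * g $$ b"
    and "(f * g) $$ (a + b + 1) = f $$ a * g $$ (b + 1) + f $$ (a + 1) * g $$ b"
proof -
  note eq = fls_times_nth_lower_bounds[of a f b g, OF assms]
  show "n < a + b \<Longrightarrow> (f * g) $$ n = 0" by (subst eq) auto
  show "(f * g) $$ (a + b) = f $$ a * g $$ b" by (subst eq) auto
  have "{a..a + b + 1 - b} = {a, a + 1}" by auto
  then show "(f * g) $$ (a + b + 1) = f $$ a * g $$ (b + 1) + f $$ (a + 1) * g $$ b"
    by (subst eq) simp_all
qed

lemma profile_series_nth: "profile_series u $$ n = (if n < 0 then 0 else u (nat n))"
  by (simp add: profile_series_def)

lemma phase_series_nth: "phase_series \<phi> $$ n = (if n < 0 then 0 else (\<lambda>(y, p). \<phi> (nat n) p))"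
  by (simp add: phase_series_def)

definition phase_dX :: "(nat \<Rightarrow> real \<times> real \<Rightarrow> real) \<Rightarrow> nat \<Rightarrow> field" where
  "phase_dX \<phi> j = (\<lambda>(y, p). slow_dX (\<phi> j) p)"

definition phase_dT :: "(nat \<Rightarrow> real \<times> real \<Rightarrow> real) \<Rightarrow> nat \<Rightarrow> field" where
  "phase_dT \<phi> j = (\<lambda>(y, p). slow_dT (\<phi> j) p)"

text \<open>The factor 1/\<epsilon> in front of the phase lowers the order by one. At the next order
  the slow derivative joins in, as does the phase correction of index 1. Leaving \<open>D\<close>
  open treats the derivatives in X and T together.\<close>

lemma twisted_derivation_nth:
  fixes D :: "field \<Rightarrow> field" and \<phi> :: "nat \<Rightarrow> real \<times> real \<Rightarrow> real"
  assumes D0: "D 0 = 0" and F0: "\<And>i. i < m \<Longrightarrow> F $$ i = 0"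
  defines "G \<equiv> fls_map D F + fls_X_inv * fls_map D (phase_series \<phi>) * fls_map field_dy F"
    and "\<kappa> \<equiv> \<lambda>j. D (\<lambda>(y, p). \<phi> j p)"
  shows "n < m - 1 \<Longrightarrow> G $$ n = 0"
    and "G $$ (m - 1) = \<kappa> 0 * field_dy (F $$ m)"
    and "G $$ m = D (F $$ m) + \<kappa> 0 * field_dy (F $$ (m + 1)) + \<kappa> 1 * field_dy (F $$ m)"
proof -
  let ?K = "fls_map D (phase_series \<phi>)" and ?F = "fls_map field_dy F"
  have K: "?K $$ n = (if n < 0 then 0 else \<kappa> (nat n))" for n
    by (simp add: fls_nth_map D0 phase_series_nth \<kappa>_def)
  have F: "?F $$ n = field_dy (F $$ n)" for n
    by (simp add: fls_nth_map)
  have G: "G $$ n = D (F $$ n) + (?K * ?F) $$ (n + 1)" for n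
  proof -
    have "G = fls_map D F + fls_shift 1 (?K * ?F)"
      unfolding G_def mult.assoc by (simp only: fls_X_inv_times_conv_shift)
    then show ?thesis by (simp add: fls_nth_map D0)
  qed
  have z: "\<And>i. i < 0 \<Longrightarrow> ?K $$ i = 0" "\<And>i. i < m \<Longrightarrow> ?F $$ i = 0"
    by (simp_all add: K F F0)
  note low = fls_times_nth_lowest[of 0 ?K m ?F, OF z]
  show "n < m - 1 \<Longrightarrow> G $$ n = 0"
    using low(1)[of "n + 1"] by (simp add: G D0 F0)
  show "G $$ (m - 1) = \<kappa> 0 * field_dy (F $$ m)"
    using low(2) by (simp add: G D0 F0 K F)
  show "G $$ m = D (F $$ m) + \<kappa> 0 * field_dy (F $$ (m + 1)) + \<kappa> 1 * field_dy (F $$ m)"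
    using low(3) by (simp add: G K F add.assoc)
qed

lemma field_dX_phase: "field_dX (\<lambda>(y, p). \<phi> j p) = phase_dX \<phi> j"
  by (simp add: field_dX_def phase_dX_def fun_eq_iff)

lemma field_dT_phase: "field_dT (\<lambda>(y, p). \<phi> j p) = phase_dT \<phi> j"
  by (simp add: field_dT_def phase_dT_def fun_eq_iff)

lemmas formal_dX_nth =
  twisted_derivation_nth[of field_dX, OF field_d_zero(2), folded formal_dX_def, unfolded field_dX_phase]

lemmas formal_dT_nth =
  twisted_derivation_nth[of field_dT, OF field_d_zero(3), folded formal_dT_def, unfolded field_dT_phase]

text \<open>The coefficients of \<open>\<epsilon>\<^bsup>-k\<^esup>\<close> and \<open>\<epsilon>\<^bsup>-k+1\<^esup>\<close> in the \<open>k\<close>-th formal derivative of \<open>u\<close>.\<close>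

primrec leading :: "(nat \<Rightarrow> real \<times> real \<Rightarrow> real) \<Rightarrow> field \<Rightarrow> nat \<Rightarrow> field" where
  "leading \<phi> u0 0 = u0"
| "leading \<phi> u0 (Suc k) = phase_dX \<phi> 0 * field_dy (leading \<phi> u0 k)"

primrec subleading :: "(nat \<Rightarrow> real \<times> real \<Rightarrow> real) \<Rightarrow> field \<Rightarrow> field \<Rightarrow> nat \<Rightarrow> field" where
  "subleading \<phi> u0 u1 0 = u1"
| "subleading \<phi> u0 u1 (Suc k) = field_dX (leading \<phi> u0 k)
     + phase_dX \<phi> 0 * field_dy (subleading \<phi> u0 u1 k) + phase_dX \<phi> 1 * field_dy (leading \<phi> u0 k)"

lemma formal_dX_power_nth:
  "(n < - int k \<longrightarrow> (formal_dX \<phi> ^^ k) (profile_series u) $$ n = 0) \<and>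
   (formal_dX \<phi> ^^ k) (profile_series u) $$ (- int k) = leading \<phi> (u 0) k \<and>
   (formal_dX \<phi> ^^ k) (profile_series u) $$ (- int k + 1) = subleading \<phi> (u 0) (u 1) k"
proof (induction k arbitrary: n)
  case 0
  then show ?case by (simp add: profile_series_nth)
next
  case (Suc k)
  let ?F = "(formal_dX \<phi> ^^ k) (profile_series u)"
  have z: "\<And>i. i < - int k \<Longrightarrow> ?F $$ i = 0" using Suc by blast
  have m: "- int (Suc k) = - int k - 1" "- int k - 1 + 1 = - int k" by simp_all
  show ?case
    using formal_dX_nth[of "- int k" ?F, OF z] Suc unfolding m by simp
qed

text \<open>Only two profiles and two phases reach this order. This makes \<open>u1\<close> a free
  unknown in its own right, which can also be set to 0 to isolate the inhomogeneous part.\<close>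

definition order_zero :: "real \<Rightarrow> (nat \<Rightarrow> real \<times> real \<Rightarrow> real) \<Rightarrow> field \<Rightarrow> field \<Rightarrow> field" where
  "order_zero \<delta> \<phi> u0 u1 =
     field_dT u0 + phase_dT \<phi> 0 * field_dy u1 + phase_dT \<phi> 1 * field_dy u0
     + 6 * (u0 * subleading \<phi> u0 u1 1 + u1 * leading \<phi> u0 1) + subleading \<phi> u0 u1 3
     + (\<lambda>_. \<delta>) * (subleading \<phi> u0 u1 2 + subleading \<phi> u0 u1 4)"

lemma residual_nth:
  shows "residual \<delta> u \<phi> $$ (-1) = phase_dT \<phi> 0 * field_dy (u 0) + 6 * (u 0 * leading \<phi> (u 0) 1)
      + leading \<phi> (u 0) 3 + (\<lambda>_. \<delta>) * (leading \<phi> (u 0) 2 + leading \<phi> (u 0) 4)"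
    and "residual \<delta> u \<phi> $$ 0 = order_zero \<delta> \<phi> (u 0) (u 1)"
proof -
  let ?F = "profile_series u"
  let ?D = "formal_dX \<phi>"
  have eq: "residual \<delta> u \<phi> $$ n = formal_dT \<phi> ?F $$ n + 6 * (?F * ?D ?F) $$ n + (?D ^^ 3) ?F $$ (n - 2)
      + (\<lambda>_. \<delta>) * ((?D ^^ 2) ?F $$ (n - 1) + (?D ^^ 4) ?F $$ (n - 3))" for n
    unfolding residual_def Let_def
    by (simp add: fls_X_power_times_conv_shift fls_X_times_conv_shift mult.assoc)
  have zF: "\<And>i. i < 0 \<Longrightarrow> ?F $$ i = 0" by (simp add: profile_series_nth)
  have zD: "\<And>i. i < -1 \<Longrightarrow> ?D ?F $$ i = 0"
    using formal_dX_power_nth[of _ 1 \<phi> u] by simp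
  note T = formal_dT_nth[of 0 ?F, OF zF]
  note P = fls_times_nth_lowest[of 0 ?F "-1" "?D ?F", OF zF zD]
  note D1 = formal_dX_power_nth[of 0 1 \<phi> u] and D2 = formal_dX_power_nth[of 0 2 \<phi> u]
    and D3 = formal_dX_power_nth[of 0 3 \<phi> u] and D4 = formal_dX_power_nth[of 0 4 \<phi> u]
  show "residual \<delta> u \<phi> $$ (-1) = phase_dT \<phi> 0 * field_dy (u 0) + 6 * (u 0 * leading \<phi> (u 0) 1)
      + leading \<phi> (u 0) 3 + (\<lambda>_. \<delta>) * (leading \<phi> (u 0) 2 + leading \<phi> (u 0) 4)"
    using T(2) P(2) D1 D2 D3 D4 unfolding eq by (simp add: profile_series_nth)
  show "residual \<delta> u \<phi> $$ 0 = order_zero \<delta> \<phi> (u 0) (u 1)"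
    using T(3) P(3) D1 D2 D3 D4 unfolding eq order_zero_def by (simp add: profile_series_nth)
qed

section \<open>Calculus on profiles\<close>

lemma slow_dX_dderiv:
  assumes "f differentiable (at p)" shows "slow_dX f p = dderiv f (1, 0) p"
proof -
  obtain X T where p: "p = (X, T)" by (cases p)
  have "((\<lambda>x. (x, T)) has_derivative (\<lambda>s. (s, 0))) (at X)" by (intro has_derivative_Pair has_derivative_ident has_derivative_const)
  then have "((\<lambda>x. f (x, T)) has_derivative (\<lambda>s. dderiv f (s, 0) (X, T))) (at X)"
    using differentiable_imp_has_derivative[OF assms] unfolding p by (rule has_derivative_compose)
  moreover have "(\<lambda>s. dderiv f (s, 0) (X, T)) = (*) (dderiv f (1, 0) (X, T))"
  proof
    show "dderiv f (s, 0) (X, T) = dderiv f (1, 0) (X, T) * s" for s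
      using linear_cmul[OF dderiv_linear[OF assms], of s "(1, 0)"] by (simp add: p)
  qed
  ultimately have "((\<lambda>x. f (x, T)) has_real_derivative dderiv f (1, 0) (X, T)) (at X)"
    by (simp only: has_field_derivative_def)
  then show ?thesis by (simp add: p slow_dX_def DERIV_imp_deriv)
qed

lemma slow_dT_dderiv:
  assumes "f differentiable (at p)" shows "slow_dT f p = dderiv f (0, 1) p"
proof -
  obtain X T where p: "p = (X, T)" by (cases p)
  have "((\<lambda>t. (X, t)) has_derivative (\<lambda>s. (0, s))) (at T)" by (intro has_derivative_Pair has_derivative_ident has_derivative_const)
  then have "((\<lambda>t. f (X, t)) has_derivative (\<lambda>s. dderiv f (0, s) (X, T))) (at T)"
    using differentiable_imp_has_derivative[OF assms] unfolding p by (rule has_derivative_compose)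
  moreover have "(\<lambda>s. dderiv f (0, s) (X, T)) = (*) (dderiv f (0, 1) (X, T))"
  proof
    show "dderiv f (0, s) (X, T) = dderiv f (0, 1) (X, T) * s" for s
      using linear_cmul[OF dderiv_linear[OF assms], of s "(0, 1)"] by (simp add: p)
  qed
  ultimately have "((\<lambda>t. f (X, t)) has_real_derivative dderiv f (0, 1) (X, T)) (at T)"
    by (simp only: has_field_derivative_def)
  then show ?thesis by (simp add: p slow_dT_def DERIV_imp_deriv)
qed

lemma slow_dX_cong:
  assumes "open \<Omega>" "p \<in> \<Omega>" "\<And>q. q \<in> \<Omega> \<Longrightarrow> f q = g q" shows "slow_dX f p = slow_dX g p"
proof -
  obtain X T where p: "p = (X, T)" by (cases p)
  have "open ((\<lambda>x. (x, T)) -` \<Omega>)" using assms(1) by (intro open_vimage continuous_intros) auto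
  then have "\<forall>\<^sub>F x in nhds X. x \<in> (\<lambda>x. (x, T)) -` \<Omega>"
    by (rule eventually_nhds_in_open) (use assms(2) p in simp)
  then have "\<forall>\<^sub>F x in nhds X. f (x, T) = g (x, T)"
    by eventually_elim (simp add: assms(3))
  then show ?thesis by (simp add: p slow_dX_def deriv_cong_ev)
qed

lemma slow_dT_cong:
  assumes "open \<Omega>" "p \<in> \<Omega>" "\<And>q. q \<in> \<Omega> \<Longrightarrow> f q = g q" shows "slow_dT f p = slow_dT g p"
proof -
  obtain X T where p: "p = (X, T)" by (cases p)
  have "open ((\<lambda>t. (X, t)) -` \<Omega>)" using assms(1) by (intro open_vimage continuous_intros) auto
  then have "\<forall>\<^sub>F t in nhds T. t \<in> (\<lambda>t. (X, t)) -` \<Omega>"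
    by (rule eventually_nhds_in_open) (use assms(2) p in simp)
  then have "\<forall>\<^sub>F t in nhds T. f (X, t) = g (X, t)"
    by eventually_elim (simp add: assms(3))
  then show ?thesis by (simp add: p slow_dT_def deriv_cong_ev)
qed

lemma smooth_slow_dX:
  assumes "open \<Omega>" "smooth_on \<Omega> f" shows "smooth_on \<Omega> (slow_dX f)"
  by (rule smooth_on_cong[OF assms(1) slow_dX_dderiv[symmetric] smooth_on_dderiv[OF assms(2)]])
    (rule smooth_on_differentiable[OF assms(2)])

lemma smooth_slow_dT:
  assumes "open \<Omega>" "smooth_on \<Omega> f" shows "smooth_on \<Omega> (slow_dT f)"
  by (rule smooth_on_cong[OF assms(1) slow_dT_dderiv[symmetric] smooth_on_dderiv[OF assms(2)]])
    (rule smooth_on_differentiable[OF assms(2)])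

text \<open>Schwarz' theorem. The second difference over a square of side h equals h^2 times either
  mixed derivative at some point of the square, by two applications of the mean value theorem in
  either order. If the mixed derivatives differed at \<open>p\<close>, continuity would keep them
  apart on a small square.\<close>

lemma mixed_slow_derivatives:
  assumes "open \<Omega>" "smooth_on \<Omega> f" "p \<in> \<Omega>"
  shows "slow_dT (slow_dX f) p = slow_dX (slow_dT f) p"
proof (rule ccontr)
  assume neq: "slow_dT (slow_dX f) p \<noteq> slow_dX (slow_dT f) p"
  obtain X T where p: "p = (X, T)" by (cases p)
  define e where "e = \<bar>slow_dT (slow_dX f) p - slow_dX (slow_dT f) p\<bar> / 2"
  have e: "e > 0" using neq by (simp add: e_def)
  note sX = smooth_slow_dX[OF assms(1,2)] and sT = smooth_slow_dT[OF assms(1,2)]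
  have cont: "isCont g p" if "smooth_on \<Omega> g" for g :: "real \<times> real \<Rightarrow> real"
    using smooth_on_continuous[OF that] assms(1,3) by (simp add: continuous_on_eq_continuous_at)
  obtain d0 where d0: "d0 > 0" "ball p d0 \<subseteq> \<Omega>" using assms(1,3) open_contains_ball by blast
  obtain d1 where d1: "d1 > 0" "\<And>q. dist q p < d1 \<Longrightarrow> dist (slow_dT (slow_dX f) q) (slow_dT (slow_dX f) p) < e"
    using cont[OF smooth_slow_dT[OF assms(1) sX]] e unfolding continuous_at_eps_delta by blast
  obtain d2 where d2: "d2 > 0" "\<And>q. dist q p < d2 \<Longrightarrow> dist (slow_dX (slow_dT f) q) (slow_dX (slow_dT f) p) < e"
    using cont[OF smooth_slow_dX[OF assms(1) sT]] e unfolding continuous_at_eps_delta by blast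
  define r where "r = min d0 (min d1 d2)"
  \<comment> \<open>Points of the square are at distance at most 2 h from its corner
    \<open>p\<close>, which is less than r.\<close>
  define h where "h = r / 3"
  have "r > 0" using d0 d1 d2 by (simp add: r_def)
  then have h: "h > 0" by (simp add: h_def)
  have near: "dist (x, t) p < r" if "X \<le> x" "x \<le> X + h" "T \<le> t" "t \<le> T + h" for x t
  proof -
    have "dist (x, t) p \<le> dist x X + dist t T"
      unfolding p dist_Pair_Pair by (rule sqrt_sum_squares_le_sum) auto
    also have "\<dots> \<le> h + h" using that by (simp add: dist_real_def)
    also have "\<dots> < r" using \<open>r > 0\<close> by (simp add: h_def)
    finally show ?thesis .
  qed
  have inside: "(x, t) \<in> \<Omega>" if "X \<le> x" "x \<le> X + h" "T \<le> t" "t \<le> T + h" for x t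
    using near[OF that] d0(2) by (auto simp: dist_commute r_def)
  have dX: "((\<lambda>x. g (x, t)) has_real_derivative slow_dX g (x, t)) (at x)"
    if "smooth_on \<Omega> g" "(x, t) \<in> \<Omega>" for g x t
  proof -
    have "((\<lambda>x. (x, t)) has_derivative (\<lambda>s. (s, 0))) (at x)" by (intro has_derivative_Pair has_derivative_ident has_derivative_const)
    from has_derivative_compose[OF this differentiable_imp_has_derivative[OF smooth_on_differentiable[OF that]]]
    have "(\<lambda>x. g (x, t)) differentiable (at x)" by (rule differentiableI)
    then show ?thesis
      by (simp add: slow_dX_def DERIV_deriv_iff_real_differentiable)
  qed
  have dT: "((\<lambda>t. g (x, t)) has_real_derivative slow_dT g (x, t)) (at t)"
    if "smooth_on \<Omega> g" "(x, t) \<in> \<Omega>" for g x t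
  proof -
    have "((\<lambda>t. (x, t)) has_derivative (\<lambda>s. (0, s))) (at t)" by (intro has_derivative_Pair has_derivative_ident has_derivative_const)
    from has_derivative_compose[OF this differentiable_imp_has_derivative[OF smooth_on_differentiable[OF that]]]
    have "(\<lambda>t. g (x, t)) differentiable (at t)" by (rule differentiableI)
    then show ?thesis
      by (simp add: slow_dT_def DERIV_deriv_iff_real_differentiable)
  qed
  define \<Delta> where "\<Delta> = (f (X + h, T + h) - f (X, T + h)) - (f (X + h, T) - f (X, T))"
  obtain x t where xt: "X < x" "x < X + h" "T < t" "t < T + h" "\<Delta> = h * (h * slow_dT (slow_dX f) (x, t))"
  proof -
    have "((\<lambda>x. f (x, T + h) - f (x, T)) has_real_derivative slow_dX f (x, T + h) - slow_dX f (x, T)) (at x)"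
      if "X \<le> x" "x \<le> X + h" for x
      using that h by (intro DERIV_diff dX[OF assms(2)] inside) auto
    from MVT2[OF _ this, of X "X + h"] h obtain x where x: "X < x" "x < X + h"
      "(f (X + h, T + h) - f (X + h, T)) - (f (X, T + h) - f (X, T)) = h * (slow_dX f (x, T + h) - slow_dX f (x, T))"
      by auto
    have "((\<lambda>t. slow_dX f (x, t)) has_real_derivative slow_dT (slow_dX f) (x, t)) (at t)"
      if "T \<le> t" "t \<le> T + h" for t
      using that x h by (intro dT[OF sX] inside) auto
    from MVT2[OF _ this, of T "T + h"] h obtain t where t: "T < t" "t < T + h"
      "slow_dX f (x, T + h) - slow_dX f (x, T) = h * slow_dT (slow_dX f) (x, t)"
      by auto
    have "\<Delta> = h * (h * slow_dT (slow_dX f) (x, t))" using x(3) t(3) by (simp add: \<Delta>_def)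
    with x(1,2) t(1,2) show ?thesis by (rule that)
  qed
  obtain x' t' where xt': "X < x'" "x' < X + h" "T < t'" "t' < T + h" "\<Delta> = h * (h * slow_dX (slow_dT f) (x', t'))"
  proof -
    have "((\<lambda>t. f (X + h, t) - f (X, t)) has_real_derivative slow_dT f (X + h, t) - slow_dT f (X, t)) (at t)"
      if "T \<le> t" "t \<le> T + h" for t
      using that h by (intro DERIV_diff dT[OF assms(2)] inside) auto
    from MVT2[OF _ this, of T "T + h"] h obtain t where t: "T < t" "t < T + h"
      "(f (X + h, T + h) - f (X, T + h)) - (f (X + h, T) - f (X, T)) = h * (slow_dT f (X + h, t) - slow_dT f (X, t))"
      by auto
    have "((\<lambda>x. slow_dT f (x, t)) has_real_derivative slow_dX (slow_dT f) (x, t)) (at x)"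
      if "X \<le> x" "x \<le> X + h" for x
      using that t h by (intro dX[OF sT] inside) auto
    from MVT2[OF _ this, of X "X + h"] h obtain x where x: "X < x" "x < X + h"
      "slow_dT f (X + h, t) - slow_dT f (X, t) = h * slow_dX (slow_dT f) (x, t)"
      by auto
    have "\<Delta> = h * (h * slow_dX (slow_dT f) (x, t))" using x(3) t(3) by (simp add: \<Delta>_def)
    with x(1,2) t(1,2) show ?thesis by (rule that)
  qed
  have eq: "slow_dT (slow_dX f) (x, t) = slow_dX (slow_dT f) (x', t')" using xt(5) xt'(5) h by simp
  have "dist (slow_dT (slow_dX f) (x, t)) (slow_dT (slow_dX f) p) < e"
    using near[of x t] xt by (intro d1(2)) (auto simp: r_def)
  moreover have "dist (slow_dX (slow_dT f) (x', t')) (slow_dX (slow_dT f) p) < e"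
    using near[of x' t'] xt' by (intro d2(2)) (auto simp: r_def)
  ultimately have "dist (slow_dT (slow_dX f) p) (slow_dX (slow_dT f) p) < e + e"
    unfolding eq by (metis dist_commute dist_triangle_less_add)
  then show False by (simp add: dist_real_def e_def)
qed

section \<open>Smooth profiles, their derivatives and their means\<close>

lemma open_fast_slow: "open \<Omega> \<Longrightarrow> open ((UNIV :: real set) \<times> \<Omega>)"
  by (intro open_Times) auto

lemma smooth_profile_differentiable:
  "smooth_profile \<Omega> f \<Longrightarrow> p \<in> \<Omega> \<Longrightarrow> f differentiable (at (y, p))"
  unfolding smooth_profile_def by (auto intro: smooth_on_differentiable)

lemma smooth_profile_slice:
  "smooth_profile \<Omega> f \<Longrightarrow> p \<in> \<Omega> \<Longrightarrow> (\<lambda>y. f (y, p)) \<in> smooth_periodic"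
  unfolding smooth_profile_def by (auto intro!: smooth_periodicI smooth_on_slice[of \<Omega>])

lemma field_dy_slice: "field_dy f (y, p) = deriv (\<lambda>s. f (s, p)) y"
  by (simp add: field_dy_def)

lemma field_dy_dderiv:
  assumes "f differentiable (at (y, p))" shows "field_dy f (y, p) = dderiv f (1, 0) (y, p)"
proof -
  have "((\<lambda>s. (s, p)) has_derivative (\<lambda>s. (s, 0))) (at y)" by (intro has_derivative_Pair has_derivative_ident has_derivative_const)
  then have "((\<lambda>s. f (s, p)) has_derivative (\<lambda>s. dderiv f (s, 0) (y, p))) (at y)"
    using differentiable_imp_has_derivative[OF assms] by (rule has_derivative_compose)
  moreover have "(\<lambda>s. dderiv f (s, 0) (y, p)) = (*) (dderiv f (1, 0) (y, p))"
  proof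
    show "dderiv f (s, 0) (y, p) = dderiv f (1, 0) (y, p) * s" for s
      using linear_cmul[OF dderiv_linear[OF assms], of s "(1, 0)"] by simp
  qed
  ultimately have "((\<lambda>s. f (s, p)) has_real_derivative dderiv f (1, 0) (y, p)) (at y)"
    by (simp only: has_field_derivative_def)
  then show ?thesis by (simp add: field_dy_slice DERIV_imp_deriv)
qed

lemma slice_has_derivative:
  assumes "f differentiable (at (y, p))"
  shows "((\<lambda>q. f (y, q)) has_derivative (\<lambda>v. dderiv f (0, v) (y, p))) (at p)"
proof -
  have "((\<lambda>q. (y, q)) has_derivative (\<lambda>v. (0, v))) (at p)" by (intro has_derivative_Pair has_derivative_ident has_derivative_const)
  then show ?thesis
    using differentiable_imp_has_derivative[OF assms] by (rule has_derivative_compose)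
qed

lemma field_dX_dderiv:
  assumes "f differentiable (at (y, p))" shows "field_dX f (y, p) = dderiv f (0, 1, 0) (y, p)"
  using slow_dX_dderiv[OF differentiableI[OF slice_has_derivative[OF assms]]]
    dderiv_eqI[OF slice_has_derivative[OF assms], of "(1, 0)"]
  by (simp add: field_dX_def)

lemma field_dT_dderiv:
  assumes "f differentiable (at (y, p))" shows "field_dT f (y, p) = dderiv f (0, 0, 1) (y, p)"
  using slow_dT_dderiv[OF differentiableI[OF slice_has_derivative[OF assms]]]
    dderiv_eqI[OF slice_has_derivative[OF assms], of "(0, 1)"]
  by (simp add: field_dT_def)

lemma smooth_profile_dderiv:
  assumes "open \<Omega>" "smooth_profile \<Omega> f" "\<And>y p. p \<in> \<Omega> \<Longrightarrow> g (y, p) = dderiv f v (y, p)"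
  shows "smooth_profile \<Omega> g"
  unfolding smooth_profile_def
proof (intro conjI allI ballI)
  have f: "smooth_on (UNIV \<times> \<Omega>) f" using assms(2) by (simp add: smooth_profile_def)
  show "smooth_on (UNIV \<times> \<Omega>) g"
    by (rule smooth_on_cong[OF open_fast_slow[OF assms(1)] _ smooth_on_dderiv[OF f, of v]])
      (use assms(3) in auto)
  show "g (y + 1, p) = g (y, p)" if "p \<in> \<Omega>" for y p
    using dderiv_periodic[OF assms(1) that _ smooth_on_differentiable[OF f], of y v] assms(2,3) that
    by (simp add: smooth_profile_def)
qed

lemma smooth_profile_dy: "open \<Omega> \<Longrightarrow> smooth_profile \<Omega> f \<Longrightarrow> smooth_profile \<Omega> (field_dy f)"
  by (rule smooth_profile_dderiv) (auto intro: field_dy_dderiv smooth_profile_differentiable)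

lemma smooth_profile_dX: "open \<Omega> \<Longrightarrow> smooth_profile \<Omega> f \<Longrightarrow> smooth_profile \<Omega> (field_dX f)"
  by (rule smooth_profile_dderiv) (auto intro: field_dX_dderiv smooth_profile_differentiable)

lemma smooth_profile_dT: "open \<Omega> \<Longrightarrow> smooth_profile \<Omega> f \<Longrightarrow> smooth_profile \<Omega> (field_dT f)"
  by (rule smooth_profile_dderiv) (auto intro: field_dT_dderiv smooth_profile_differentiable)

lemma smooth_profile_add:
  "open \<Omega> \<Longrightarrow> smooth_profile \<Omega> f \<Longrightarrow> smooth_profile \<Omega> g \<Longrightarrow> smooth_profile \<Omega> (f + g)"
  unfolding smooth_profile_def plus_fun_def by (auto intro: smooth_on_add open_fast_slow)

lemma smooth_profile_mult:
  "open \<Omega> \<Longrightarrow> smooth_profile \<Omega> f \<Longrightarrow> smooth_profile \<Omega> g \<Longrightarrow> smooth_profile \<Omega> (f * g)"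
  unfolding smooth_profile_def times_fun_def by (auto intro: smooth_on_mult open_fast_slow)

lemma smooth_profile_const: "open \<Omega> \<Longrightarrow> smooth_profile \<Omega> (\<lambda>_. c)"
  unfolding smooth_profile_def by (auto intro: smooth_on_const open_fast_slow)

lemma smooth_profile_slow:
  assumes "open \<Omega>" "smooth_on \<Omega> \<psi>" shows "smooth_profile \<Omega> (\<lambda>(y, p). \<psi> p)"
  unfolding smooth_profile_def case_prod_beta
  using smooth_on_compose_snd[OF assms, where 'y = real] by simp

lemma smooth_profile_phase:
  assumes "open \<Omega>" "smooth_on \<Omega> (\<phi> j)"
  shows "smooth_profile \<Omega> (phase_dX \<phi> j)" "smooth_profile \<Omega> (phase_dT \<phi> j)"
  using assms unfolding phase_dX_def phase_dT_def
  by (auto intro!: smooth_profile_slow smooth_slow_dX smooth_slow_dT)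

lemma smooth_profile_leading:
  "open \<Omega> \<Longrightarrow> smooth_on \<Omega> (\<phi> 0) \<Longrightarrow> smooth_profile \<Omega> u0 \<Longrightarrow> smooth_profile \<Omega> (leading \<phi> u0 k)"
  by (induction k) (auto intro!: smooth_profile_mult smooth_profile_dy smooth_profile_phase)

lemma smooth_profile_subleading:
  "open \<Omega> \<Longrightarrow> smooth_on \<Omega> (\<phi> 0) \<Longrightarrow> smooth_on \<Omega> (\<phi> 1) \<Longrightarrow> smooth_profile \<Omega> u0 \<Longrightarrow> smooth_profile \<Omega> u1
    \<Longrightarrow> smooth_profile \<Omega> (subleading \<phi> u0 u1 k)"
  by (induction k)
    (auto intro!: smooth_profile_add smooth_profile_mult smooth_profile_dX smooth_profile_dy
      smooth_profile_phase smooth_profile_leading simp del: One_nat_def)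

text \<open>The factor 6 of the residual is an element of the ring of functions; this exposes it as
  a constant function.\<close>

lemma numeral_field: "(numeral n :: field) = (\<lambda>_. numeral n)"
  by (metis fun_eq_iff of_nat_fun_apply of_nat_numeral)

lemma smooth_profile_order_zero:
  assumes "open \<Omega>" "smooth_on \<Omega> (\<phi> 0)" "smooth_on \<Omega> (\<phi> 1)" "smooth_profile \<Omega> u0" "smooth_profile \<Omega> u1"
  shows "smooth_profile \<Omega> (order_zero \<delta> \<phi> u0 u1)"
  unfolding order_zero_def numeral_field
  by (intro smooth_profile_add smooth_profile_mult smooth_profile_const smooth_profile_dT smooth_profile_dy
      smooth_profile_phase smooth_profile_subleading smooth_profile_leading assms)

lemma mean_field_dy:
  "smooth_profile \<Omega> f \<Longrightarrow> p \<in> \<Omega> \<Longrightarrow> mean (\<lambda>y. field_dy f (y, p)) = 0"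
  unfolding field_dy_slice by (intro mean_deriv smooth_profile_slice)

lemma smooth_profile_regular:
  assumes "open \<Omega>" "smooth_profile \<Omega> f" shows "leafwise_regular \<Omega> n f"
  using assms(2) unfolding smooth_profile_def by (auto intro: smooth_imp_leafwise_regular assms(1))

lemma mean_field_dX:
  assumes "open \<Omega>" "smooth_profile \<Omega> f" "p \<in> \<Omega>"
  shows "mean (\<lambda>y. field_dX f (y, p)) = slow_dX (\<lambda>q. mean (\<lambda>y. f (y, q))) p"
proof -
  note hd = has_derivative_mean[OF assms(1,3) smooth_profile_regular[OF assms(1,2)]]
  have "slow_dX (\<lambda>q. mean (\<lambda>y. f (y, q))) p = mean (\<lambda>s. dderiv f (0, 1, 0) (s, p))"
    using slow_dX_dderiv[OF differentiableI[OF hd]] dderiv_eqI[OF hd] by simp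
  then show ?thesis
    by (simp add: field_dX_dderiv smooth_profile_differentiable[OF assms(2,3)])
qed

lemma mean_field_dT:
  assumes "open \<Omega>" "smooth_profile \<Omega> f" "p \<in> \<Omega>"
  shows "mean (\<lambda>y. field_dT f (y, p)) = slow_dT (\<lambda>q. mean (\<lambda>y. f (y, q))) p"
proof -
  note hd = has_derivative_mean[OF assms(1,3) smooth_profile_regular[OF assms(1,2)]]
  have "slow_dT (\<lambda>q. mean (\<lambda>y. f (y, q))) p = mean (\<lambda>s. dderiv f (0, 0, 1) (s, p))"
    using slow_dT_dderiv[OF differentiableI[OF hd]] dderiv_eqI[OF hd] by simp
  then show ?thesis
    by (simp add: field_dT_dderiv smooth_profile_differentiable[OF assms(2,3)])
qed

lemma dderiv_mult:
  fixes f g :: "'a::real_normed_vector \<Rightarrow> real"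
  assumes "f differentiable (at x)" "g differentiable (at x)"
  shows "dderiv (f * g) v x = f x * dderiv g v x + dderiv f v x * g x"
  unfolding times_fun_def
  by (intro dderiv_eqI has_derivative_mult differentiable_imp_has_derivative assms)

lemma field_d_mult:
  assumes "open \<Omega>" "smooth_profile \<Omega> f" "smooth_profile \<Omega> g" "p \<in> \<Omega>"
  shows "field_dy (f * g) (y, p) = f (y, p) * field_dy g (y, p) + field_dy f (y, p) * g (y, p)"
    "field_dX (f * g) (y, p) = f (y, p) * field_dX g (y, p) + field_dX f (y, p) * g (y, p)"
  using smooth_profile_mult[OF assms(1-3)] assms
  by (simp_all add: field_dy_dderiv field_dX_dderiv smooth_profile_differentiable dderiv_mult)

section \<open>The equation at order zero\<close>

context
  fixes \<Omega> :: "(real \<times> real) set" and \<phi> :: "nat \<Rightarrow> real \<times> real \<Rightarrow> real" and u0 u1 :: field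
  assumes open_slow: "open \<Omega>" and smooth_phase: "smooth_on \<Omega> (\<phi> 0)" "smooth_on \<Omega> (\<phi> 1)"
    and u0: "smooth_profile \<Omega> u0" and u1: "smooth_profile \<Omega> u1"
begin

lemma mean_leading:
  assumes "p \<in> \<Omega>" shows "mean (\<lambda>y. leading \<phi> u0 (Suc k) (y, p)) = 0"
  using mean_field_dy[OF smooth_profile_leading[where \<phi> = \<phi>, OF open_slow smooth_phase(1) u0] assms]
  by (simp add: phase_dX_def mean_cmult)

text \<open>The terms differentiated in y average to 0. The remaining one is the slow derivative of
  the mean of \<open>leading\<close>, which is identically 0 from index 1 on; this is why the
  statement starts at index 2, as at index 1 the slow derivative of the mean of \<open>u0\<close>
  would survive.\<close>

lemma mean_subleading:
  assumes "p \<in> \<Omega>" shows "mean (\<lambda>y. subleading \<phi> u0 u1 (Suc (Suc k)) (y, p)) = 0"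
proof -
  let ?l = "leading \<phi> u0 (Suc k)" and ?s = "subleading \<phi> u0 u1 (Suc k)"
  have l: "smooth_profile \<Omega> ?l" by (rule smooth_profile_leading[where \<phi> = \<phi>, OF open_slow smooth_phase(1) u0])
  have s: "smooth_profile \<Omega> ?s" by (rule smooth_profile_subleading[where \<phi> = \<phi>, OF open_slow smooth_phase u0 u1])
  note V = smooth_profile_slice[OF smooth_profile_dy[OF open_slow l] assms]
    smooth_profile_slice[OF smooth_profile_dy[OF open_slow s] assms]
    smooth_profile_slice[OF smooth_profile_dX[OF open_slow l] assms]
  have "mean (\<lambda>y. subleading \<phi> u0 u1 (Suc (Suc k)) (y, p))
      = mean (\<lambda>y. field_dX ?l (y, p) + slow_dX (\<phi> 0) p * field_dy ?s (y, p) + slow_dX (\<phi> 1) p * field_dy ?l (y, p))"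
    by (simp only: subleading.simps(2)[of _ _ _ "Suc k"] plus_fun_def times_fun_def phase_dX_def case_prod_conv)
  also have "\<dots> = mean (\<lambda>y. field_dX ?l (y, p)) + slow_dX (\<phi> 0) p * mean (\<lambda>y. field_dy ?s (y, p))
      + slow_dX (\<phi> 1) p * mean (\<lambda>y. field_dy ?l (y, p))"
    by (subst mean_add mean_cmult, (intro periodic_continuous periodic_add periodic_mult
          periodic_const V)+)+ (simp only: mean_cmult)
  also have "\<dots> = slow_dX (\<lambda>q. mean (\<lambda>y. ?l (y, q))) p"
    by (simp only: mean_field_dX[OF open_slow l assms] mean_field_dy[OF s assms] mean_field_dy[OF l assms])
  also have "\<dots> = slow_dX (\<lambda>q. 0) p"
    by (rule slow_dX_cong[OF open_slow assms]) (rule mean_leading)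
  also have "\<dots> = 0" by (simp add: slow_dX_def case_prod_beta)
  finally show ?thesis .
qed

text \<open>Conservation form of the transport term: everything becomes a derivative of
  \<open>u0 * u0\<close> or \<open>u0 * u1\<close>, so that averaging leaves only the slow
  derivative.\<close>

lemma nonlinear_term:
  assumes "p \<in> \<Omega>"
  shows "6 * (u0 (y, p) * subleading \<phi> u0 u1 1 (y, p) + u1 (y, p) * leading \<phi> u0 1 (y, p))
    = 3 * field_dX (u0 * u0) (y, p) + 6 * slow_dX (\<phi> 0) p * field_dy (u0 * u1) (y, p)
      + 3 * slow_dX (\<phi> 1) p * field_dy (u0 * u0) (y, p)"
  by (simp add: field_d_mult[OF open_slow u0 u0 assms] field_d_mult[OF open_slow u0 u1 assms] phase_dX_def
      algebra_simps)

text \<open>The result does not contain \<open>u1\<close>. For a \<open>u1\<close> that solves the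
  equation it is Whitham's second equation; for \<open>u1 = 0\<close> the same identity gives the
  solvability condition of the converse.\<close>

lemma mean_order_zero:
  assumes p: "p \<in> \<Omega>"
  shows "mean (\<lambda>y. order_zero \<delta> \<phi> u0 u1 (y, p))
    = slow_dT (\<lambda>q. mean (\<lambda>y. u0 (y, q))) p + slow_dX (\<lambda>q. mean (\<lambda>y. 3 * (u0 (y, q))\<^sup>2)) p"
proof -
  let ?s = "subleading \<phi> u0 u1"
  have u00: "smooth_profile \<Omega> (u0 * u0)" and u01: "smooth_profile \<Omega> (u0 * u1)"
    by (intro smooth_profile_mult open_slow u0 u1)+
  have s: "smooth_profile \<Omega> (?s k)" for k by (rule smooth_profile_subleading[where \<phi> = \<phi>, OF open_slow smooth_phase u0 u1])
  have u3: "smooth_profile \<Omega> ((\<lambda>_. 3) * (u0 * u0))"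
    by (intro smooth_profile_mult smooth_profile_const open_slow u00)
  define A where "A = field_dT u0"
  define B where "B = field_dy u1"
  define C where "C = field_dy u0"
  define D where "D = field_dX (u0 * u0)"
  define E where "E = field_dy (u0 * u1)"
  define F where "F = field_dy (u0 * u0)"
  have V: "(\<lambda>y. A (y, p)) \<in> smooth_periodic" "(\<lambda>y. B (y, p)) \<in> smooth_periodic" "(\<lambda>y. C (y, p)) \<in> smooth_periodic"
    "(\<lambda>y. D (y, p)) \<in> smooth_periodic" "(\<lambda>y. E (y, p)) \<in> smooth_periodic" "(\<lambda>y. F (y, p)) \<in> smooth_periodic"
    "(\<lambda>y. ?s k (y, p)) \<in> smooth_periodic" for k
    unfolding A_def B_def C_def D_def E_def F_def
    by (intro smooth_profile_slice[OF _ p] smooth_profile_dT smooth_profile_dX smooth_profile_dy open_slow u0 u1 u00 u01 s)+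
  have eq: "order_zero \<delta> \<phi> u0 u1 (y, p) = A (y, p) + slow_dT (\<phi> 0) p * B (y, p) + slow_dT (\<phi> 1) p * C (y, p)
      + (3 * D (y, p) + 6 * slow_dX (\<phi> 0) p * E (y, p) + 3 * slow_dX (\<phi> 1) p * F (y, p))
      + ?s 3 (y, p) + \<delta> * (?s 2 (y, p) + ?s 4 (y, p))" for y
    unfolding nonlinear_term[OF p, symmetric] A_def B_def C_def D_def E_def F_def order_zero_def numeral_field
    by (simp add: phase_dT_def del: One_nat_def)
  have add: "mean (\<lambda>y. f y + g y) = mean f + mean g" if "f \<in> smooth_periodic" "g \<in> smooth_periodic" for f g
    by (intro mean_add periodic_continuous that)
  have s0: "mean (\<lambda>y. ?s 2 (y, p)) = 0" "mean (\<lambda>y. ?s 3 (y, p)) = 0" "mean (\<lambda>y. ?s 4 (y, p)) = 0"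
    using mean_subleading[OF p, of 0] mean_subleading[OF p, of 1] mean_subleading[OF p, of 2]
    by (simp_all only: eval_nat_numeral One_nat_def BitM.simps)
  have zero: "mean (\<lambda>y. B (y, p)) = 0" "mean (\<lambda>y. C (y, p)) = 0" "mean (\<lambda>y. E (y, p)) = 0" "mean (\<lambda>y. F (y, p)) = 0"
    unfolding B_def C_def E_def F_def
    using mean_field_dy[OF u1 p] mean_field_dy[OF u0 p] mean_field_dy[OF u01 p] mean_field_dy[OF u00 p] by auto
  have "mean (\<lambda>y. order_zero \<delta> \<phi> u0 u1 (y, p)) = mean (\<lambda>y. A (y, p)) + 3 * mean (\<lambda>y. D (y, p))"
    unfolding eq
    by (simp add: add V mean_cmult s0 zero periodic_add periodic_mult periodic_const)
  moreover have "mean (\<lambda>y. A (y, p)) = slow_dT (\<lambda>q. mean (\<lambda>y. u0 (y, q))) p"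
    unfolding A_def by (rule mean_field_dT[OF open_slow u0 p])
  moreover have "3 * mean (\<lambda>y. D (y, p)) = slow_dX (\<lambda>q. mean (\<lambda>y. 3 * (u0 (y, q))\<^sup>2)) p"
  proof -
    have "field_dX ((\<lambda>_. 3) * (u0 * u0)) (y, p) = 3 * D (y, p)" for y
    proof -
      have "field_dX (\<lambda>_. 3) (y, p) = 0" by (simp add: field_dX_def slow_dX_def case_prod_beta)
      then show ?thesis
        unfolding D_def field_d_mult(2)[OF open_slow smooth_profile_const[OF open_slow] u00 p] by simp
    qed
    then show ?thesis
      using mean_field_dX[OF open_slow u3 p] by (simp add: mean_cmult power2_eq_square)
  qed
  ultimately show ?thesis by simp
qed

lemma subleading_affine:
  assumes p: "p \<in> \<Omega>"
  shows "subleading \<phi> u0 u1 k (y, p)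
    = subleading \<phi> u0 0 k (y, p) + slow_dX (\<phi> 0) p ^ k * (deriv ^^ k) (\<lambda>s. u1 (s, p)) y"
proof (induction k arbitrary: y)
  case 0
  then show ?case by simp
next
  case (Suc k)
  have zero: "smooth_profile \<Omega> 0" using smooth_profile_const[OF open_slow, of 0] by (simp add: zero_fun_def)
  have V: "(\<lambda>y. subleading \<phi> u0 0 k (y, p)) \<in> smooth_periodic"
    by (rule smooth_profile_slice[OF smooth_profile_subleading[where \<phi> = \<phi>, OF open_slow smooth_phase u0 zero] p])
  have V1: "(\<lambda>s. u1 (s, p)) \<in> smooth_periodic" by (rule smooth_profile_slice[OF u1 p])
  have "deriv (\<lambda>y. subleading \<phi> u0 u1 k (y, p)) y = deriv (\<lambda>y. subleading \<phi> u0 0 k (y, p)) y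
      + slow_dX (\<phi> 0) p ^ k * (deriv ^^ Suc k) (\<lambda>s. u1 (s, p)) y"
    unfolding Suc
    by (rule DERIV_imp_deriv)
      (intro DERIV_add DERIV_cmult periodic_has_deriv[OF V] periodic_higher_has_deriv[OF V1])
  then show ?case
    by (simp only: subleading.simps plus_fun_def times_fun_def phase_dX_def case_prod_conv field_dy_slice
        power_Suc algebra_simps)
qed

text \<open>The phase relation turns the time derivative of the phase into the term -k c of the
  moving frame; together with the y-derivatives of \<open>u1\<close> it completes the
  linearization.\<close>

lemma order_zero_affine:
  assumes p: "p \<in> \<Omega>" and phase: "slow_dT (\<phi> 0) p = - slow_dX (\<phi> 0) p * cc"
  shows "order_zero \<delta> \<phi> u0 u1 (y, p) = order_zero \<delta> \<phi> u0 0 (y, p)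
    + linearized_op \<delta> (slow_dX (\<phi> 0) p) cc (\<lambda>s. u0 (s, p)) (\<lambda>s. u1 (s, p)) y"
proof -
  let ?V = "\<lambda>s. u0 (s, p)" and ?f = "\<lambda>s. u1 (s, p)"
  have "((\<lambda>s. (6 * ?V s - cc) * ?f s) has_real_derivative (6 * ?V y - cc) * deriv ?f y + (6 * deriv ?V y - 0) * ?f y) (at y)"
    by (intro DERIV_mult' DERIV_diff DERIV_cmult DERIV_const periodic_has_deriv smooth_profile_slice[OF _ p] u0 u1)
  then have d: "deriv (\<lambda>s. (6 * ?V s - cc) * ?f s) y = (6 * ?V y - cc) * deriv ?f y + (6 * deriv ?V y - 0) * ?f y"
    by (rule DERIV_imp_deriv)
  show ?thesis
    unfolding order_zero_def linearized_op_def d numeral_field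
    by (simp add: subleading_affine[OF p] phase_dT_def phase phase_dX_def field_dy_slice[of u0] field_dy_slice[of u1]
        algebra_simps del: One_nat_def)
      (simp add: phase_dX_def field_dy_slice algebra_simps)
qed

end

section \<open>The travelling waves\<close>

lemma linearized_op_eq:
  assumes "v \<in> smooth_periodic" "f \<in> smooth_periodic"
  shows "linearized_op \<delta> k cc v f y = k * ((6 * v y - cc) * deriv f y + 6 * deriv v y * f y)
    + k ^ 3 * (deriv ^^ 3) f y + \<delta> * (k\<^sup>2 * (deriv ^^ 2) f y + k ^ 4 * (deriv ^^ 4) f y)"
proof -
  have "((\<lambda>s. (6 * v s - cc) * f s) has_real_derivative (6 * v y - cc) * deriv f y + (6 * deriv v y - 0) * f y) (at y)"
    by (intro DERIV_mult' DERIV_diff DERIV_cmult DERIV_const periodic_has_deriv assms)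
  from DERIV_imp_deriv[OF this] show ?thesis by (simp add: linearized_op_def)
qed

text \<open>Every term of the operator is a total derivative, and the primitive \<open>G\<close> is
  itself periodic.\<close>

lemma mean_linearized_op:
  assumes "v \<in> smooth_periodic" "f \<in> smooth_periodic"
  shows "mean (linearized_op \<delta> k cc v f) = 0"
proof -
  define G where "G y = k * ((6 * v y - cc) * f y) + k ^ 3 * (deriv ^^ 2) f y
    + \<delta> * (k\<^sup>2 * (deriv ^^ 1) f y + k ^ 4 * (deriv ^^ 3) f y)" for y
  have "G \<in> smooth_periodic"
    unfolding G_def[abs_def]
    by (intro periodic_add periodic_mult periodic_diff periodic_const
        periodic_higher_deriv assms)
  moreover have "deriv G y = linearized_op \<delta> k cc v f y" for y
  proof -
    have "(G has_real_derivative k * ((6 * v y - cc) * deriv f y + (6 * deriv v y - 0) * f y)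
        + k ^ 3 * (deriv ^^ Suc 2) f y + \<delta> * (k\<^sup>2 * (deriv ^^ Suc 1) f y + k ^ 4 * (deriv ^^ Suc 3) f y)) (at y)"
      unfolding G_def[abs_def]
      by (intro DERIV_add DERIV_cmult DERIV_mult' DERIV_diff DERIV_const periodic_has_deriv
          periodic_higher_has_deriv assms)
    then show ?thesis
      unfolding linearized_op_eq[OF assms] by (simp add: DERIV_imp_deriv eval_nat_numeral)
  qed
  ultimately show ?thesis using mean_deriv[of G] by (metis ext)
qed

lemma linearized_op_lincomb:
  assumes "v \<in> smooth_periodic" "f \<in> smooth_periodic" "g \<in> smooth_periodic"
  shows "linearized_op \<delta> k cc v (\<lambda>y. f y + r * g y) y = linearized_op \<delta> k cc v f y + r * linearized_op \<delta> k cc v g y"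
proof -
  have 1: "deriv (\<lambda>y. f y + r * g y) y = deriv f y + r * deriv g y"
    using higher_deriv_lincomb[OF assms(2,3), of 1 r] by (simp add: fun_eq_iff)
  show ?thesis
    unfolding linearized_op_eq[OF assms(1) periodic_lincomb[OF assms(2,3)]]
      linearized_op_eq[OF assms(1,2)] linearized_op_eq[OF assms(1,3)] higher_deriv_lincomb[OF assms(2,3)] 1
    by (simp add: algebra_simps)
qed

text \<open>Index 0 and a one-dimensional kernel leave a complement of the range spanned by a single
  \<open>e\<close>. Elements of the range have zero mean, so the mean of any function is carried by
  its \<open>e\<close> component alone.\<close>

lemma fredholm_range:
  assumes fred: "fredholm_of_index smooth_periodic A 0"
    and dim: "fun_vs.dim (kernel_on smooth_periodic A) = 1"
    and mean0: "\<And>f. f \<in> smooth_periodic \<Longrightarrow> mean (A f) = 0"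
    and g: "g \<in> smooth_periodic" "mean g = 0"
  obtains f where "f \<in> smooth_periodic" "A f = g"
proof -
  obtain B C where B: "fun_vs.independent B" "fun_vs.span B = kernel_on smooth_periodic A"
    and C: "finite C" "C \<subseteq> smooth_periodic"
      "smooth_periodic = {g + h |g h. g \<in> A ` smooth_periodic \<and> h \<in> fun_vs.span C}"
    and card: "0 = int (card B) - int (card C)" and A: "A ` smooth_periodic \<subseteq> smooth_periodic"
    using fred unfolding fredholm_of_index_def by (elim conjE exE) (rule that)
  have "card B = 1" using fun_vs.dim_span_eq_card_independent[OF B(1)] B(2) dim by simp
  then have "card C = 1" using card by simp
  then obtain e where e: "C = {e}" by (rule card_1_singletonE)
  have eV: "e \<in> smooth_periodic" using C(2) e by simp
  have decomp: "\<exists>f\<in>smooth_periodic. \<exists>r. h = A f + fscale r e \<and> mean h = r * mean e"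
    if "h \<in> smooth_periodic" for h
  proof -
    have "h \<in> {g + h |g h. g \<in> A ` smooth_periodic \<and> h \<in> fun_vs.span C}" using that C(3) by simp
    then obtain u v where uv: "h = u + v" "u \<in> A ` smooth_periodic" "v \<in> fun_vs.span {e}"
      unfolding e by blast
    obtain f where f1: "f \<in> smooth_periodic" "u = A f" using uv(2) by blast
    obtain r where "v = fscale r e" using uv(3) unfolding fun_vs.span_singleton by blast
    with uv(1) f1 have f: "f \<in> smooth_periodic" "h = A f + fscale r e" by simp_all
    have AV: "A f \<in> smooth_periodic" using A f(1) by blast
    have "mean h = mean (\<lambda>y. A f y + r * e y)" by (simp add: f(2) plus_fun_def fscale_def)
    also have "\<dots> = mean (A f) + r * mean e"
      by (subst mean_add)
        (auto simp: mean_cmult intro!: periodic_continuous periodic_mult periodic_const AV eV)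
    finally have "mean h = r * mean e" using mean0[OF f(1)] by simp
    with f show ?thesis by blast
  qed
  \<comment> \<open>Decomposing the constant 1 shows this, since its mean is not 0. A function of
    zero mean then has no \<open>e\<close> component.\<close>
  have "mean e \<noteq> 0"
  proof
    assume "mean e = 0"
    moreover obtain r where "mean (\<lambda>_. 1) = r * mean e"
      using decomp[OF periodic_const[of 1]] by blast
    ultimately show False by (simp add: mean_const)
  qed
  moreover obtain f r where "f \<in> smooth_periodic" "g = A f + fscale r e" "mean g = r * mean e"
    using decomp[OF g(1)] by blast
  ultimately have "f \<in> smooth_periodic" "g = A f + fscale 0 e" using g(2) by simp_all
  then show ?thesis using that by (simp add: fscale_def plus_fun_def)
qed

context
  fixes \<delta> :: real and P :: "(real \<times> real) set" and U :: "real \<Rightarrow> real \<Rightarrow> real \<Rightarrow> real" and c :: "real \<Rightarrow> real \<Rightarrow> real"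
  assumes family: "travelling_wave_family \<delta> P U c"
begin

lemma wave_number_pos: "(k, M) \<in> P \<Longrightarrow> k > 0"
  using family[unfolded travelling_wave_family_def, THEN conjunct2, THEN conjunct1] by auto

lemma wave_smooth:
  "smooth_on (UNIV \<times> P) (\<lambda>(y, k, M). U y k M)" "smooth_on P (\<lambda>(k, M). c k M)"
  by (rule family[unfolded travelling_wave_family_def, THEN conjunct2, THEN conjunct2, THEN conjunct1])
    (rule family[unfolded travelling_wave_family_def, THEN conjunct2, THEN conjunct2, THEN conjunct2, THEN conjunct1])

lemma wave_props:
  assumes "(k, M) \<in> P"
  shows "U (y + 1) k M = U y k M" "\<exists>y y'. U y k M \<noteq> U y' k M" "mean (\<lambda>y. U y k M) = M"
    "profile_equation \<delta> k (c k M) (\<lambda>y. U y k M)"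
  using bspec[OF family[unfolded travelling_wave_family_def, THEN conjunct2, THEN conjunct2, THEN conjunct2, THEN conjunct2, THEN conjunct1] assms] by simp_all

lemma wave_linearization:
  assumes "(k, M) \<in> P"
  defines "L \<equiv> linearized_op \<delta> k (c k M) (\<lambda>y. U y k M)"
  shows "kernel_on smooth_periodic L = fun_vs.span {deriv (\<lambda>y. U y k M)}"
    "fun_vs.dim (kernel_on smooth_periodic L) = 1" "fredholm_of_index smooth_periodic L 0"
  using bspec[OF family[unfolded travelling_wave_family_def, THEN conjunct2, THEN conjunct2, THEN conjunct2, THEN conjunct2, THEN conjunct2, THEN conjunct2] assms(1)]
  unfolding L_def Let_def case_prod_conv by blast+

lemma wave_slice:
  assumes "(k, M) \<in> P" shows "(\<lambda>y. U y k M) \<in> smooth_periodic"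
  using smooth_on_slice[OF wave_smooth(1) assms] wave_props(1)[OF assms] by (intro smooth_periodicI) auto

text \<open>The normalization of the family makes U - M a function of k alone, so the
  \<open>M\<close> picked by \<open>SOME\<close> gives the same value as any other.\<close>

lemma qbar_eq:
  assumes "(k, M) \<in> P"
  shows "qbar P U k = 3 * mean (\<lambda>y. (U y k M - M)\<^sup>2)"
proof -
  obtain U0 c0 where *: "\<forall>(k, M)\<in>P. (\<forall>y. U y k M = M + U0 y k) \<and> c k M = 6 * M + c0 k"
    using family[unfolded travelling_wave_family_def, THEN conjunct2, THEN conjunct2, THEN conjunct2, THEN conjunct2, THEN conjunct2, THEN conjunct1] by blast
  have U0: "U y k M = M + U0 y k" if "(k, M) \<in> P" for k M y
    using bspec[OF * that] by simp
  have "(k, SOME M. (k, M) \<in> P) \<in> P" by (rule someI[of "\<lambda>M. (k, M) \<in> P", OF assms])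
  then show ?thesis using assms by (simp add: qbar_def U0)
qed

lemma qbar_mean_square:
  assumes "(k, M) \<in> P"
  shows "qbar P U k + 3 * M\<^sup>2 = mean (\<lambda>y. 3 * (U y k M)\<^sup>2)"
proof -
  let ?V = "\<lambda>y. U y k M"
  note V = wave_slice[OF assms]
  have V2: "(\<lambda>y. (?V y)\<^sup>2) \<in> smooth_periodic" "(\<lambda>y. (2 * M) * ?V y) \<in> smooth_periodic"
    unfolding power2_eq_square by (intro periodic_mult periodic_const V)+
  have "mean (\<lambda>y. (?V y - M)\<^sup>2) = mean (\<lambda>y. ((?V y)\<^sup>2 - (2 * M) * ?V y) + M\<^sup>2)"
    by (simp add: power2_eq_square algebra_simps)
  also have "\<dots> = mean (\<lambda>y. (?V y)\<^sup>2) - (2 * M) * mean ?V + M\<^sup>2"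
    using V2
    by (simp add: mean_add mean_diff mean_cmult mean_const periodic_continuous continuous_on_diff)
  finally show ?thesis
    by (simp add: qbar_eq[OF assms] wave_props(3)[OF assms] mean_cmult power2_eq_square algebra_simps)
qed

text \<open>Averaging removes the linearization and shows that the nonlocal constant vanishes by
  itself. Then f = r U' lies in the kernel with r <U'^2> = 0, and U' is not identically 0 because
  the wave is not constant.\<close>

lemma wave_operator_injective:
  assumes P: "(k, M) \<in> P" and f: "f \<in> smooth_periodic"
    and zero: "\<And>y. linearized_op \<delta> k (c k M) (\<lambda>y. U y k M) f y + mean (\<lambda>y. deriv (\<lambda>y. U y k M) y * f y) = 0"
  shows "f = (\<lambda>_. 0)"
proof -
  let ?V = "\<lambda>y. U y k M" and ?m = "mean (\<lambda>y. deriv (\<lambda>y. U y k M) y * f y)"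
  note V = wave_slice[OF P] and V' = periodic_deriv[OF wave_slice[OF P]]
  let ?L = "linearized_op \<delta> k (c k M) ?V"
  have L: "?L f = (\<lambda>y. - ?m)"
    by (rule ext) (simp only: eq_neg_iff_add_eq_0 zero)
  have m: "?m = 0" using mean_linearized_op[OF V f, of \<delta> k "c k M"] unfolding L by (simp add: mean_const)
  have "f \<in> kernel_on smooth_periodic ?L"
    using L m f by (simp add: kernel_on_def zero_fun_def)
  then obtain r where r: "f = (\<lambda>y. r * deriv ?V y)"
    unfolding wave_linearization(1)[OF P] fun_vs.span_singleton by (auto simp: fscale_def)
  show ?thesis
  proof (cases "r = 0")
    case False
    have sq: "(\<lambda>y. deriv ?V y * deriv ?V y) \<in> smooth_periodic" by (intro periodic_mult V')
    have "mean (\<lambda>y. r * (deriv ?V y * deriv ?V y)) = 0" using m by (simp add: r mult_ac)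
    then have "mean (\<lambda>y. deriv ?V y * deriv ?V y) = 0" using False by (simp only: mean_cmult mult_eq_0_iff) simp
    from mean_eq_0_imp_eq_0[OF sq _ this] have "deriv ?V y = 0" for y by simp
    then have "(?V has_real_derivative 0) (at y)" for y
      using periodic_has_deriv[OF V, of y] by simp
    then have "?V x = ?V y" for x y using DERIV_isconst_all[of ?V x y] by blast
    then show ?thesis using wave_props(2)[OF P] by blast
  qed (simp add: r)
qed

text \<open>The part of \<open>g\<close> with zero mean is solved through the linearization. Its
  mean is then matched by adding a multiple of U', which the linearization does not see and which
  changes only the nonlocal term.\<close>

lemma wave_operator_surjective:
  assumes P: "(k, M) \<in> P" and g: "g \<in> smooth_periodic"
  obtains f where "f \<in> smooth_periodic"
    "\<And>y. linearized_op \<delta> k (c k M) (\<lambda>y. U y k M) f y + mean (\<lambda>y. deriv (\<lambda>y. U y k M) y * f y) = g y"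
proof -
  let ?V = "\<lambda>y. U y k M"
  note V = wave_slice[OF P] and V' = periodic_deriv[OF wave_slice[OF P]]
  let ?L = "linearized_op \<delta> k (c k M) ?V"
  define g0 where "g0 y = g y - mean g" for y
  have g0: "g0 \<in> smooth_periodic" "mean g0 = 0"
    unfolding g0_def[abs_def]
    by (auto intro!: periodic_diff periodic_const g
        simp: mean_diff mean_const periodic_continuous[OF g])
  obtain f0 where f0: "f0 \<in> smooth_periodic" "?L f0 = g0"
    using fredholm_range[OF wave_linearization(3,2)[OF P] mean_linearized_op[OF V] g0] by blast
  have "deriv ?V \<in> kernel_on smooth_periodic ?L"
    unfolding wave_linearization(1)[OF P] by (rule fun_vs.span_base) simp
  then have LV: "?L (deriv ?V) y = 0" for y by (simp add: kernel_on_def zero_fun_def)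
  define S where "S = mean (\<lambda>y. deriv ?V y * deriv ?V y)"
  \<comment> \<open>Otherwise U' would be annihilated by the augmented operator and hence be 0, and
    its span could not have dimension 1.\<close>
  have S: "S \<noteq> 0"
  proof
    assume "S = 0"
    then have "deriv ?V = (\<lambda>_. 0)"
      by (intro wave_operator_injective[OF P V']) (simp add: LV S_def)
    then have "fun_vs.dim (kernel_on smooth_periodic ?L) = fun_vs.dim {\<lambda>_. 0 :: real}"
      unfolding wave_linearization(1)[OF P] by simp
    moreover have "fun_vs.dim {\<lambda>_. 0 :: real} = 0"
      using fun_vs.dim_le_card[of "{\<lambda>_. 0 :: real}" "{}"] by (simp add: zero_fun_def)
    ultimately show False using wave_linearization(2)[OF P] by simp
  qed
  \<comment> \<open>Solves <U' (f0 + r U')> = <g> for r.\<close>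
  define r where "r = (mean g - mean (\<lambda>y. deriv ?V y * f0 y)) / S"
  define f where "f y = f0 y + r * deriv ?V y" for y
  have "f \<in> smooth_periodic" unfolding f_def[abs_def] by (intro periodic_lincomb f0 V')
  moreover have "?L f y = g0 y" for y
    unfolding f_def[abs_def] linearized_op_lincomb[OF V f0(1) V'] by (simp add: LV f0(2))
  moreover have "mean (\<lambda>y. deriv ?V y * f y) = mean g"
  proof -
    have "mean (\<lambda>y. deriv ?V y * f y) = mean (\<lambda>y. deriv ?V y * f0 y + r * (deriv ?V y * deriv ?V y))"
      by (simp add: f_def algebra_simps)
    also have "\<dots> = mean (\<lambda>y. deriv ?V y * f0 y) + r * S"
      unfolding S_def
      by (subst mean_add)
        (auto simp: mean_cmult intro!: periodic_continuous periodic_mult periodic_const V' f0)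
    also have "\<dots> = mean g" using S by (simp add: r_def)
    finally show ?thesis .
  qed
  ultimately show ?thesis by (intro that[of f]) (simp_all add: g0_def)
qed

end

section \<open>Whitham modulation\<close>

text \<open>A solution constructed with one sequence of phases therefore serves every sequence with
  the same first two entries.\<close>

lemma order_zero_cong:
  assumes "\<phi> 0 = \<psi> 0" "\<phi> 1 = \<psi> 1"
  shows "order_zero \<delta> \<phi> u0 u1 = order_zero \<delta> \<psi> u0 u1"
proof -
  have p: "phase_dX \<phi> 0 = phase_dX \<psi> 0" "phase_dX \<phi> 1 = phase_dX \<psi> 1"
    "phase_dT \<phi> 0 = phase_dT \<psi> 0" "phase_dT \<phi> 1 = phase_dT \<psi> 1"
    using assms by (simp_all add: phase_dX_def phase_dT_def)
  have l: "leading \<phi> u0 k = leading \<psi> u0 k" for k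
    by (induction k) (simp_all only: leading.simps p)
  have "subleading \<phi> u0 u1 k = subleading \<psi> u0 u1 k" for k
    by (induction k) (simp_all only: subleading.simps p l)
  then show ?thesis by (simp only: order_zero_def p l)
qed

lemma leading_eq:
  assumes "(\<lambda>s. u0 (s, p)) \<in> smooth_periodic"
  shows "leading \<phi> u0 k (y, p) = slow_dX (\<phi> 0) p ^ k * (deriv ^^ k) (\<lambda>s. u0 (s, p)) y"
proof (induction k arbitrary: y)
  case (Suc k)
  have "deriv (\<lambda>y. leading \<phi> u0 k (y, p)) y = slow_dX (\<phi> 0) p ^ k * (deriv ^^ Suc k) (\<lambda>s. u0 (s, p)) y"
    unfolding Suc by (rule DERIV_imp_deriv) (intro DERIV_cmult periodic_higher_has_deriv[OF assms])
  then show ?case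
    by (simp only: leading.simps times_fun_def phase_dX_def case_prod_conv field_dy_slice power_Suc mult.assoc)
qed simp

lemma slow_dX_minus:
  assumes "f differentiable (at p)" shows "slow_dX (\<lambda>q. - f q) p = - slow_dX f p"
proof -
  have "((\<lambda>q. - f q) has_derivative (\<lambda>v. - dderiv f v p)) (at p)"
    by (intro has_derivative_minus differentiable_imp_has_derivative assms)
  then show ?thesis
    using slow_dX_dderiv[OF assms] slow_dX_dderiv[OF differentiableI] dderiv_eqI by metis
qed

context
  fixes \<delta> :: real and P \<Omega> :: "(real \<times> real) set" and U :: "real \<Rightarrow> real \<Rightarrow> real \<Rightarrow> real"
    and c :: "real \<Rightarrow> real \<Rightarrow> real" and u0 :: field and \<phi>0 M0 :: "real \<times> real \<Rightarrow> real"
  assumes pos: "\<delta> > 0" and family: "travelling_wave_family \<delta> P U c" and open_slow: "open \<Omega>"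
    and phase: "smooth_on \<Omega> \<phi>0" and modulated: "modulated_wave P U c \<Omega> u0 \<phi>0 M0"
begin

lemma modulated_in: "p \<in> \<Omega> \<Longrightarrow> (slow_dX \<phi>0 p, M0 p) \<in> P"
  using modulated by (simp add: modulated_wave_def Let_def)

lemma modulated_profile: "p \<in> \<Omega> \<Longrightarrow> (\<lambda>y. u0 (y, p)) = (\<lambda>y. U y (slow_dX \<phi>0 p) (M0 p))"
  using modulated by (simp add: modulated_wave_def Let_def)

lemma modulated_frequency: "p \<in> \<Omega> \<Longrightarrow> slow_dT \<phi>0 p = - slow_dX \<phi>0 p * c (slow_dX \<phi>0 p) (M0 p)"
  using modulated by (simp add: modulated_wave_def Let_def)

lemma modulated_slice: "p \<in> \<Omega> \<Longrightarrow> (\<lambda>y. u0 (y, p)) \<in> smooth_periodic"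
  using wave_slice[OF family modulated_in] by (simp add: modulated_profile)

lemma modulated_mean: "p \<in> \<Omega> \<Longrightarrow> mean (\<lambda>y. u0 (y, p)) = M0 p"
  using wave_props(3)[OF family modulated_in] by (simp add: modulated_profile)

lemma modulated_mean_square:
  assumes "p \<in> \<Omega>"
  shows "mean (\<lambda>y. 3 * (u0 (y, p))\<^sup>2) = qbar P U (slow_dX \<phi>0 p) + 3 * (M0 p)\<^sup>2"
  using qbar_mean_square[OF family modulated_in[OF assms]] fun_cong[OF modulated_profile[OF assms]] by simp

lemma order_minus_one:
  assumes "\<phi> 0 = \<phi>0" "u 0 = u0"
  shows "holds_at_order \<delta> \<Omega> u \<phi> (-1)"
  unfolding holds_at_order_def
proof (intro allI ballI)
  fix y p assume p: "p \<in> \<Omega>"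
  have "profile_equation \<delta> (slow_dX \<phi>0 p) (c (slow_dX \<phi>0 p) (M0 p)) (\<lambda>y. u0 (y, p))"
    unfolding modulated_profile[OF p] by (rule wave_props(4)[OF family modulated_in[OF p]])
  then show "fls_nth (residual \<delta> u \<phi>) (-1) (y, p) = 0"
    unfolding residual_nth(1) assms(2) numeral_field
    by (simp add: leading_eq[of u0, OF modulated_slice[OF p]] assms(1) phase_dT_def phase_dX_def modulated_frequency[OF p]
        field_dy_slice profile_equation_def algebra_simps)
qed

lemma wave_number_equation:
  assumes p: "p \<in> \<Omega>"
  shows "slow_dT (slow_dX \<phi>0) p + slow_dX (\<lambda>q. slow_dX \<phi>0 q * c (slow_dX \<phi>0 q) (M0 q)) p = 0"
proof -
  have "slow_dX (\<lambda>q. slow_dX \<phi>0 q * c (slow_dX \<phi>0 q) (M0 q)) p = slow_dX (\<lambda>q. - slow_dT \<phi>0 q) p"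
    by (rule slow_dX_cong[OF open_slow p]) (simp add: modulated_frequency)
  also have "\<dots> = - slow_dX (slow_dT \<phi>0) p"
    by (rule slow_dX_minus[OF smooth_on_differentiable[OF smooth_slow_dT[OF open_slow phase] p]])
  finally show ?thesis using mixed_slow_derivatives[OF open_slow phase p] by simp
qed

lemma mean_equation:
  assumes p: "p \<in> \<Omega>"
  shows "slow_dT (\<lambda>q. mean (\<lambda>y. u0 (y, q))) p + slow_dX (\<lambda>q. mean (\<lambda>y. 3 * (u0 (y, q))\<^sup>2)) p
    = slow_dT M0 p + slow_dX (\<lambda>q. qbar P U (slow_dX \<phi>0 q) + 3 * (M0 q)\<^sup>2) p"
proof -
  have "slow_dT (\<lambda>q. mean (\<lambda>y. u0 (y, q))) p = slow_dT M0 p"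
    by (rule slow_dT_cong[OF open_slow p]) (rule modulated_mean)
  moreover have "slow_dX (\<lambda>q. mean (\<lambda>y. 3 * (u0 (y, q))\<^sup>2)) p
      = slow_dX (\<lambda>q. qbar P U (slow_dX \<phi>0 q) + 3 * (M0 q)\<^sup>2) p"
    by (rule slow_dX_cong[OF open_slow p]) (rule modulated_mean_square)
  ultimately show ?thesis by simp
qed

context
  assumes mass: "smooth_on \<Omega> M0"
begin

lemma modulated_smooth_speed: "smooth_on \<Omega> (\<lambda>p. c (slow_dX \<phi>0 p) (M0 p))"
proof -
  have "smooth_on \<Omega> (\<lambda>p. (\<lambda>(k, M). c k M) (slow_dX \<phi>0 p, M0 p))"
  proof (rule smooth_on_compose[OF open_slow _ wave_smooth(2)[OF family]])
    show "smooth_on \<Omega> (\<lambda>p. (slow_dX \<phi>0 p, M0 p) \<bullet> b)" for b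
      unfolding inner_prod_def inner_real_def
      by (simp, intro smooth_on_add smooth_on_mult smooth_on_const smooth_slow_dX open_slow phase mass)
  qed (use modulated_in in auto)
  then show ?thesis by simp
qed

text \<open>In the converse only the phase and \<open>M0\<close> are assumed smooth. Smoothness of
  the profile comes from composing the family with them.\<close>

lemma modulated_smooth_profile: "smooth_profile \<Omega> u0"
  unfolding smooth_profile_def
proof (intro conjI allI ballI)
  note op = open_fast_slow[OF open_slow]
  have comp: "smooth_on (UNIV \<times> \<Omega>) (\<lambda>x. (\<lambda>(y, k, M). U y k M) (fst x, slow_dX \<phi>0 (snd x), M0 (snd x)))"
  proof (rule smooth_on_compose[OF op _ wave_smooth(1)[OF family]])
    show "smooth_on (UNIV \<times> \<Omega>) (\<lambda>x. (fst x, slow_dX \<phi>0 (snd x), M0 (snd x)) \<bullet> b)"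
      for b :: "real \<times> real \<times> real"
      unfolding inner_prod_def inner_real_def
      by (simp, intro smooth_on_add smooth_on_mult smooth_on_const smooth_on_compose_snd smooth_slow_dX
          smooth_on_bounded_linear[OF bounded_linear_fst] op open_slow phase mass)
  qed (use modulated_in in auto)
  show "smooth_on (UNIV \<times> \<Omega>) u0"
    by (rule smooth_on_cong[OF op _ comp]) (use fun_cong[OF modulated_profile] in auto)
  show "u0 (y + 1, p) = u0 (y, p)" if "p \<in> \<Omega>" for y p
    using periodic_period[OF modulated_slice[OF that]] .
qed

text \<open>The augmented and normalized operator satisfies the assumptions of the parameter theory.
  Zero mean of \<open>R\<close> then makes the augmentation vanish on the solution found.\<close>

lemma smooth_linearized_solution:
  assumes R: "smooth_profile \<Omega> R" and mean_R: "\<And>p. p \<in> \<Omega> \<Longrightarrow> mean (\<lambda>y. R (y, p)) = 0"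
  obtains u1 where "smooth_profile \<Omega> u1"
    "\<And>y p. p \<in> \<Omega> \<Longrightarrow> linearized_op \<delta> (slow_dX \<phi>0 p) (c (slow_dX \<phi>0 p) (M0 p)) (\<lambda>s. u0 (s, p))
      (\<lambda>s. u1 (s, p)) y = R (y, p)"
proof -
  define K where "K = slow_dX \<phi>0"
  define S where "S p = c (K p) (M0 p)" for p
  define W where "W p = 1 / (\<delta> * K p ^ 4)" for p
  \<comment> \<open>The product rule for ((6 U - c) f)' gives the coefficients of order 0 and 1. In
    those of order 2 and 3, \<open>W\<close> carries the division by the leading
    coefficient.\<close>
  define a where "a j x = W (snd x) * (if j = 0 then 6 * K (snd x) * field_dy u0 x
      else if j = 1 then K (snd x) * (6 * u0 x - S (snd x))
      else if j = 2 then \<delta> * K (snd x) ^ 2 else K (snd x) ^ 3)" for j :: nat and x :: "real \<times> real \<times> real"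
  define b where "b x = W (snd x) * field_dy u0 x" for x :: "real \<times> real \<times> real"
  let ?L = "\<lambda>p. linearized_op \<delta> (K p) (S p) (\<lambda>s. u0 (s, p))"
  let ?m = "\<lambda>p f. mean (\<lambda>s. deriv (\<lambda>s. u0 (s, p)) s * f s)"
  have K_pos: "K p > 0" if "p \<in> \<Omega>" for p
    using wave_number_pos[OF family modulated_in[OF that]] by (simp add: K_def)
  have W_inv: "W p * (\<delta> * K p ^ 4) = 1" "W p \<noteq> 0" if "p \<in> \<Omega>" for p
    using K_pos[OF that] pos by (simp_all add: W_def)
  have K: "smooth_on \<Omega> K" unfolding K_def by (rule smooth_slow_dX[OF open_slow phase])
  have S: "smooth_on \<Omega> S" using modulated_smooth_speed by (simp add: S_def[abs_def] K_def)
  have W: "smooth_on \<Omega> W"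
    unfolding W_def[abs_def] using K_pos pos
    by (intro smooth_on_divide smooth_on_mult smooth_on_const smooth_on_power open_slow K) force
  note op = open_fast_slow[OF open_slow] and u0_smooth = modulated_smooth_profile
  have u0': "smooth_profile \<Omega> (field_dy u0)" by (rule smooth_profile_dy[OF open_slow u0_smooth])
  have smooth: "smooth_on (UNIV \<times> \<Omega>) u0" "smooth_on (UNIV \<times> \<Omega>) (field_dy u0)" "smooth_on (UNIV \<times> \<Omega>) R"
    and per: "\<And>y p. p \<in> \<Omega> \<Longrightarrow> u0 (y + 1, p) = u0 (y, p)"
      "\<And>y p. p \<in> \<Omega> \<Longrightarrow> field_dy u0 (y + 1, p) = field_dy u0 (y, p)"
      "\<And>y p. p \<in> \<Omega> \<Longrightarrow> R (y + 1, p) = R (y, p)"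
    using u0_smooth u0' R by (simp_all add: smooth_profile_def)
  have op_eq: "nonlocal_op a b p f y = W p * (?L p f y + ?m p f)" if p: "p \<in> \<Omega>" and f: "f \<in> smooth_periodic" for p f y
  proof -
    have sum4: "(\<Sum>j<4. h j) = h 0 + h 1 + h 2 + h 3" for h :: "nat \<Rightarrow> real" by (simp add: eval_nat_numeral)
    have m: "mean (\<lambda>s. b (s, p) * f s) = W p * ?m p f"
      by (simp add: b_def field_dy_slice mult.assoc mean_cmult)
    have "(deriv ^^ 4) f y = W p * (\<delta> * K p ^ 4) * (deriv ^^ 4) f y" using W_inv(1)[OF p] by simp
    then show ?thesis
      unfolding nonlocal_op_def sum4 m linearized_op_eq[OF modulated_slice[OF p] f]
      by (simp add: a_def field_dy_slice algebra_simps)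
  qed
  interpret periodic_operator_family \<Omega> a b
  proof
    show "smooth_on (UNIV \<times> \<Omega>) (a j)" for j
      unfolding a_def[abs_def]
      by (cases "j = 0"; cases "j = 1"; cases "j = 2"; simp;
          intro smooth_on_mult smooth_on_diff smooth_on_const smooth_on_power smooth_on_compose_snd op open_slow smooth K S W)
    show "smooth_on (UNIV \<times> \<Omega>) b"
      unfolding b_def[abs_def]
      by (intro smooth_on_mult smooth_on_compose_snd op open_slow smooth W)
    show "a j (y + 1, p) = a j (y, p)" if "p \<in> \<Omega>" for j y p using that by (simp add: a_def per)
    show "b (y + 1, p) = b (y, p)" if "p \<in> \<Omega>" for y p using that by (simp add: b_def per)
    show "f = (\<lambda>_. 0)" if p: "p \<in> \<Omega>" and f: "f \<in> smooth_periodic" and zero: "\<And>y. nonlocal_op a b p f y = 0" for p f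
    proof (rule wave_operator_injective[OF family modulated_in[OF p] f])
      have "?L p f y + ?m p f = 0" for y using zero[of y] W_inv(2)[OF p] by (simp add: op_eq[OF p f])
      then show "linearized_op \<delta> (slow_dX \<phi>0 p) (c (slow_dX \<phi>0 p) (M0 p)) (\<lambda>y. U y (slow_dX \<phi>0 p) (M0 p)) f y
          + mean (\<lambda>y. deriv (\<lambda>y. U y (slow_dX \<phi>0 p) (M0 p)) y * f y) = 0" for y
        by (simp add: K_def S_def modulated_profile[OF p])
    qed
    show "\<exists>f\<in>smooth_periodic. \<forall>y. nonlocal_op a b p f y = g y" if p: "p \<in> \<Omega>" and g: "g \<in> smooth_periodic" for p g
    proof -
      have "(\<lambda>y. (\<delta> * K p ^ 4) * g y) \<in> smooth_periodic" by (intro periodic_mult periodic_const g)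
      from wave_operator_surjective[OF family modulated_in[OF p] this] obtain f where f: "f \<in> smooth_periodic"
        "\<And>y. ?L p f y + ?m p f = (\<delta> * K p ^ 4) * g y"
        unfolding modulated_profile[OF p, symmetric] K_def S_def by blast
      have "nonlocal_op a b p f y = g y" for y
        unfolding op_eq[OF p f(1)] f(2) mult.assoc[symmetric] using W_inv(1)[OF p] by (simp add: mult.assoc)
      then show ?thesis using f(1) by blast
    qed
  qed (rule open_slow)
  obtain u1 where u1: "smooth_on (UNIV \<times> \<Omega>) u1" "\<And>p. p \<in> \<Omega> \<Longrightarrow> (\<lambda>y. u1 (y, p)) \<in> smooth_periodic"
    "\<And>y p. p \<in> \<Omega> \<Longrightarrow> nonlocal_op a b p (\<lambda>y. u1 (y, p)) y = W (snd (y, p)) * R (y, p)"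
  proof (rule smooth_solution[of "\<lambda>x. W (snd x) * R x"])
    show "smooth_on (UNIV \<times> \<Omega>) (\<lambda>x. W (snd x) * R x)"
      by (intro smooth_on_mult smooth_on_compose_snd op open_slow smooth W)
    show "W (snd (y + 1, p)) * R (y + 1, p) = W (snd (y, p)) * R (y, p)" if "p \<in> \<Omega>" for y p
      using per(3)[OF that] by simp
  qed (rule that)
  have "smooth_profile \<Omega> u1"
    using u1(1) periodic_period[OF u1(2)] by (simp add: smooth_profile_def)
  moreover have "?L p (\<lambda>s. u1 (s, p)) y = R (y, p)" if p: "p \<in> \<Omega>" for y p
  proof -
    let ?f = "\<lambda>s. u1 (s, p)"
    have eq: "R (y, p) = ?L p ?f y + ?m p ?f" for y
      using u1(3)[OF p, of y] W_inv(2)[OF p] by (simp add: op_eq[OF p u1(2)[OF p]])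
    have L: "?L p ?f = (\<lambda>y. R (y, p) - ?m p ?f)" by (rule ext) (simp add: eq)
    \<comment> \<open>The linearization has zero mean and so does \<open>R\<close>, which leaves the
      nonlocal constant with mean 0, hence equal to 0.\<close>
    have "mean (\<lambda>y. R (y, p) - ?m p ?f) = 0"
      using mean_linearized_op[OF modulated_slice[OF p] u1(2)[OF p], of \<delta> "K p" "S p"] unfolding L .
    then have "?m p ?f = 0"
      by (simp add: mean_diff mean_const mean_R[OF p] periodic_continuous smooth_profile_slice[OF R p])
    then show ?thesis by (simp add: eq)
  qed
  ultimately show ?thesis by (intro that[of u1]) (simp_all add: K_def S_def)
qed

lemma order_zero_solvable:
  assumes \<phi>1: "smooth_on \<Omega> \<phi>1" and whitham: "whitham_system P U c \<Omega> (slow_dX \<phi>0) M0"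
  obtains u1 where "smooth_profile \<Omega> u1"
    "\<And>\<phi> y p. \<phi> 0 = \<phi>0 \<Longrightarrow> \<phi> 1 = \<phi>1 \<Longrightarrow> p \<in> \<Omega> \<Longrightarrow> order_zero \<delta> \<phi> u0 u1 (y, p) = 0"
proof -
  \<comment> \<open>A representative sequence of phases; its entries beyond index 1 are
    arbitrary.\<close>
  define \<psi> where "\<psi> j = (if j = 0 then \<phi>0 else \<phi>1)" for j :: nat
  have \<psi>: "\<psi> 0 = \<phi>0" "\<psi> 1 = \<phi>1" by (simp_all add: \<psi>_def)
  have \<psi>_smooth: "smooth_on \<Omega> (\<psi> 0)" "smooth_on \<Omega> (\<psi> 1)" unfolding \<psi> by (rule phase, rule \<phi>1)
  note u0_smooth = modulated_smooth_profile
  have zero: "smooth_profile \<Omega> 0" using smooth_profile_const[OF open_slow, of 0] by (simp add: zero_fun_def)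
  \<comment> \<open>The order-zero coefficient is affine in \<open>u1\<close>, so its value at
    \<open>u1 = 0\<close> with the sign reversed is the right-hand side of the linear
    equation.\<close>
  define R where "R = (\<lambda>_. - 1) * order_zero \<delta> \<psi> u0 0"
  have R: "smooth_profile \<Omega> R"
    unfolding R_def
    by (intro smooth_profile_mult smooth_profile_const smooth_profile_order_zero open_slow \<psi>_smooth u0_smooth zero)
  have mean_R: "mean (\<lambda>y. R (y, p)) = 0" if p: "p \<in> \<Omega>" for p
  proof -
    have "mean (\<lambda>y. order_zero \<delta> \<psi> u0 0 (y, p)) = 0"
      unfolding mean_order_zero[OF open_slow \<psi>_smooth u0_smooth zero p] mean_equation[OF p]
      using whitham p by (simp add: whitham_system_def)
    then show ?thesis using mean_cmult[of "-1"] by (simp add: R_def)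
  qed
  obtain u1 where u1: "smooth_profile \<Omega> u1"
    "\<And>y p. p \<in> \<Omega> \<Longrightarrow> linearized_op \<delta> (slow_dX \<phi>0 p) (c (slow_dX \<phi>0 p) (M0 p)) (\<lambda>s. u0 (s, p))
      (\<lambda>s. u1 (s, p)) y = R (y, p)"
    using smooth_linearized_solution[OF R mean_R] by blast
  show ?thesis
  proof (rule that[OF u1(1)])
    fix \<phi> :: "nat \<Rightarrow> real \<times> real \<Rightarrow> real" and y p
    assume \<phi>: "\<phi> 0 = \<phi>0" "\<phi> 1 = \<phi>1" and p: "p \<in> \<Omega>"
    have "order_zero \<delta> \<phi> u0 u1 = order_zero \<delta> \<psi> u0 u1" by (rule order_zero_cong) (simp_all only: \<phi> \<psi>)
    moreover have "order_zero \<delta> \<psi> u0 u1 (y, p) = order_zero \<delta> \<psi> u0 0 (y, p) + R (y, p)"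
      using order_zero_affine[where \<phi> = \<psi>, OF open_slow \<psi>_smooth u0_smooth u1(1) p, of "c (slow_dX \<phi>0 p) (M0 p)" \<delta> y]
        modulated_frequency[OF p] u1(2)[OF p, of y] by (simp only: \<psi>)
    ultimately show "order_zero \<delta> \<phi> u0 u1 (y, p) = 0" by (simp add: R_def)
  qed
qed

end

end

theorem mainTheorem2:
  fixes \<delta> :: real
    and P \<Omega> :: "(real \<times> real) set"
    and U :: "real \<Rightarrow> real \<Rightarrow> real \<Rightarrow> real"
    and c :: "real \<Rightarrow> real \<Rightarrow> real"
  assumes "\<delta> > 0"
    and "travelling_wave_family \<delta> P U c"
    and "open \<Omega>"
  shows
    "(\<forall>(k, M)\<in>P. qbar P U k = 3 * mean (\<lambda>y. (U y k M - M)\<^sup>2) \<and>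
                 qbar P U k + 3 * M\<^sup>2 = mean (\<lambda>y. 3 * (U y k M)\<^sup>2)) \<and>
     (\<forall>u \<phi> k0 M0.
        formal_ansatz \<Omega> u \<phi> \<and>
        k0 = slow_dX (\<phi> 0) \<and>
        M0 = (\<lambda>p. mean (\<lambda>y. u 0 (y, p))) \<and>
        modulated_wave P U c \<Omega> (u 0) (\<phi> 0) M0
        \<longrightarrow> holds_at_order \<delta> \<Omega> u \<phi> (-1) \<and>
            (holds_at_order \<delta> \<Omega> u \<phi> 0 \<longrightarrow> whitham_system P U c \<Omega> k0 M0)) \<and>
     (\<forall>\<phi>0 k0 M0 u0.
        smooth_on \<Omega> \<phi>0 \<and> smooth_on \<Omega> M0 \<and>
        k0 = slow_dX \<phi>0 \<and>
        modulated_wave P U c \<Omega> u0 \<phi>0 M0 \<and>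
        whitham_system P U c \<Omega> k0 M0
        \<longrightarrow> (\<forall>\<phi>1. smooth_on \<Omega> \<phi>1 \<longrightarrow>
              (\<exists>u1. smooth_profile \<Omega> u1 \<and>
                 (\<forall>u \<phi>. formal_ansatz \<Omega> u \<phi> \<and> \<phi> 0 = \<phi>0 \<and> \<phi> 1 = \<phi>1 \<and> u 0 = u0 \<and> u 1 = u1
                         \<longrightarrow> holds_at_order \<delta> \<Omega> u \<phi> 0))))"
proof (intro conjI)
  show "\<forall>(k, M)\<in>P. qbar P U k = 3 * mean (\<lambda>y. (U y k M - M)\<^sup>2) \<and>
      qbar P U k + 3 * M\<^sup>2 = mean (\<lambda>y. 3 * (U y k M)\<^sup>2)"
    using qbar_eq[OF assms(2)] qbar_mean_square[OF assms(2)] by blast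
  show "\<forall>u \<phi> k0 M0. formal_ansatz \<Omega> u \<phi> \<and> k0 = slow_dX (\<phi> 0) \<and> M0 = (\<lambda>p. mean (\<lambda>y. u 0 (y, p))) \<and>
      modulated_wave P U c \<Omega> (u 0) (\<phi> 0) M0
      \<longrightarrow> holds_at_order \<delta> \<Omega> u \<phi> (-1) \<and> (holds_at_order \<delta> \<Omega> u \<phi> 0 \<longrightarrow> whitham_system P U c \<Omega> k0 M0)"
  proof (intro allI impI, elim conjE, intro conjI impI)
    fix u \<phi> k0 M0
    assume ansatz: "formal_ansatz \<Omega> u \<phi>" and k0: "k0 = slow_dX (\<phi> 0)"
      and mod: "modulated_wave P U c \<Omega> (u 0) (\<phi> 0) M0"
    have u: "smooth_profile \<Omega> (u j)" and \<phi>: "smooth_on \<Omega> (\<phi> j)" for j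
      using ansatz by (simp_all add: formal_ansatz_def)
    show "holds_at_order \<delta> \<Omega> u \<phi> (-1)"
      by (rule order_minus_one[OF assms \<phi> mod]) (rule refl)+
    assume holds: "holds_at_order \<delta> \<Omega> u \<phi> 0"
    show "whitham_system P U c \<Omega> k0 M0"
      unfolding whitham_system_def k0
    proof (intro ballI conjI)
      fix p assume p: "p \<in> \<Omega>"
      show "slow_dT (slow_dX (\<phi> 0)) p + slow_dX (\<lambda>q. slow_dX (\<phi> 0) q * c (slow_dX (\<phi> 0) q) (M0 q)) p = 0"
        by (rule wave_number_equation[OF assms \<phi> mod p])
      have "order_zero \<delta> \<phi> (u 0) (u 1) (y, p) = 0" for y
        using holds p unfolding holds_at_order_def residual_nth(2) by blast
      then have "mean (\<lambda>y. order_zero \<delta> \<phi> (u 0) (u 1) (y, p)) = 0" by (simp add: mean_const)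
      then show "slow_dT M0 p + slow_dX (\<lambda>q. qbar P U (slow_dX (\<phi> 0) q) + 3 * (M0 q)\<^sup>2) p = 0"
        unfolding mean_order_zero[where \<phi> = \<phi>, OF assms(3) \<phi> \<phi> u u p] mean_equation[OF assms \<phi> mod p] .
    qed
  qed
  show "\<forall>\<phi>0 k0 M0 u0. smooth_on \<Omega> \<phi>0 \<and> smooth_on \<Omega> M0 \<and> k0 = slow_dX \<phi>0 \<and>
      modulated_wave P U c \<Omega> u0 \<phi>0 M0 \<and> whitham_system P U c \<Omega> k0 M0
      \<longrightarrow> (\<forall>\<phi>1. smooth_on \<Omega> \<phi>1 \<longrightarrow> (\<exists>u1. smooth_profile \<Omega> u1 \<and>
        (\<forall>u \<phi>. formal_ansatz \<Omega> u \<phi> \<and> \<phi> 0 = \<phi>0 \<and> \<phi> 1 = \<phi>1 \<and> u 0 = u0 \<and> u 1 = u1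
          \<longrightarrow> holds_at_order \<delta> \<Omega> u \<phi> 0)))"
  proof (intro allI impI, elim conjE)
    fix \<phi>0 k0 M0 \<phi>1 :: "real \<times> real \<Rightarrow> real" and u0
    assume \<phi>0: "smooth_on \<Omega> \<phi>0" and M0: "smooth_on \<Omega> M0" and k0: "k0 = slow_dX \<phi>0"
      and mod: "modulated_wave P U c \<Omega> u0 \<phi>0 M0" and whitham: "whitham_system P U c \<Omega> k0 M0"
      and \<phi>1: "smooth_on \<Omega> \<phi>1"
    \<comment> \<open>\<open>u1\<close> is obtained before the series are fixed, since no higher
      term of either series reaches order zero.\<close>
    obtain u1 where u1: "smooth_profile \<Omega> u1"
      "\<And>\<phi> y p. \<phi> 0 = \<phi>0 \<Longrightarrow> \<phi> 1 = \<phi>1 \<Longrightarrow> p \<in> \<Omega> \<Longrightarrow> order_zero \<delta> \<phi> u0 u1 (y, p) = 0"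
      using order_zero_solvable[OF assms \<phi>0 mod M0 \<phi>1 whitham[unfolded k0]] by metis
    show "\<exists>u1. smooth_profile \<Omega> u1 \<and>
        (\<forall>u \<phi>. formal_ansatz \<Omega> u \<phi> \<and> \<phi> 0 = \<phi>0 \<and> \<phi> 1 = \<phi>1 \<and> u 0 = u0 \<and> u 1 = u1
          \<longrightarrow> holds_at_order \<delta> \<Omega> u \<phi> 0)"
    proof (intro exI[of _ u1] conjI allI impI, rule u1(1), elim conjE)
      fix u :: "nat \<Rightarrow> field" and \<phi> :: "nat \<Rightarrow> real \<times> real \<Rightarrow> real"
      assume "\<phi> 0 = \<phi>0" "\<phi> 1 = \<phi>1" "u 0 = u0" "u 1 = u1"
      then show "holds_at_order \<delta> \<Omega> u \<phi> 0"
        unfolding holds_at_order_def residual_nth(2) using u1(2) by blast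
    qed
  qed
qed

end
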